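(* Let $n\ge 2$ be an integer and let $\alpha=\frac{1}{n+1}$. If $u$ is an axially symmetric solution (i.e. $u(\xi)=u(\xi_1)$ depends only on the first coordinate $\xi_1$) of $$\alpha P_n u+(n-1)!\left(1-\frac{e^{nu}}{\int_{\mathbb{S}^n}e^{nu}\,dw}\right)=0\quad\text{on }\mathbb{S}^n,$$ then $u$ must be constant.
   Context: $\mathbb{S}^n\subset\mathbb{R}^{n+1}$ is the unit sphere with its round metric, points are $\xi=(\xi_1,\dots,\xi_{n+1})$, $\Delta$ is the Laplace–Beltrami operator, and $dw$ is the volume form normalized so that $\int_{\mathbb{S}^n}dw=1$. The Paneitz operator is $$P_n=\prod_{k=0}^{\frac{n-2}{2}}\bigl(-\Delta+k(n-k-1)\bigr)\ \text{ for } n \text{ even},\qquad P_n=\Bigl(-\Delta+\bigl(\tfrac{n-1}{2}\bigr)^2\Bigr)^{1/2}\prod_{k=0}^{\frac{n-3}{2}}\bigl(-\Delta+k(n-k-1)\bigr)\ \text{ for } n\text{ odd}$$ (defined spectrally; $P_n$ acts on spherical harmonics of degree $k$ as multiplication by $\prod_{s=0}^{n-1}(k+s)$). Axially symmetric solutions are taken to be in $C^\infty(\mathbb{S}^n)$. *)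

theory Defs
  imports "HOL-Analysis.Analysis"
begin

text \<open>
  Functions on the unit sphere of a Euclidean space \<open>'a\<close> are represented by functions on all of
  \<open>'a\<close>, of which only the values on \<open>sphere 0 1\<close> matter. Smoothness and derivatives on the sphere are
  those of the degree-0 homogeneous extension \<open>\<lambda>x. f (sgn x)\<close> away from the origin, where
  \<open>sgn x = x /\<^sub>R norm x\<close>. The sphere has dimension \<open>n = DIM('a) - 1\<close>;
  where a formula needs this dimension, it is the explicit argument \<open>n\<close>.
\<close>

primrec iter_partial :: "'a::euclidean_space list \<Rightarrow> ('a \<Rightarrow> real) \<Rightarrow> 'a \<Rightarrow> real" where
  "iter_partial [] f = f"
| "iter_partial (b # bs) f = (\<lambda>x. frechet_derivative (iter_partial bs f) (at x) b)"

definition smooth_on_sphere :: "('a::euclidean_space \<Rightarrow> real) \<Rightarrow> bool" where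
  "smooth_on_sphere f \<longleftrightarrow>
     (\<forall>bs. set bs \<subseteq> Basis \<longrightarrow> iter_partial bs (\<lambda>x. f (sgn x)) differentiable_on (- {0}))"

definition laplacian :: "('a::euclidean_space \<Rightarrow> real) \<Rightarrow> 'a \<Rightarrow> real" where
  "laplacian f x = (\<Sum>b\<in>Basis. iter_partial [b, b] f x)"

text \<open>
  On the unit sphere, the Laplace--Beltrami operator is the Euclidean Laplacian of the degree-0
  homogeneous extension: the radial part of the Laplacian vanishes on that extension.
\<close>

definition laplace_beltrami :: "('a::euclidean_space \<Rightarrow> real) \<Rightarrow> 'a \<Rightarrow> real" where
  "laplace_beltrami f = laplacian (\<lambda>x. f (sgn x))"

text \<open>
  The normalized volume measure \<open>dw\<close> as the cone measure: the image of the uniform distribution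
  on the unit ball under radial projection. The origin, which \<open>sgn\<close> fixes, is a null set.
\<close>

definition sphere_measure :: "'a::euclidean_space measure" where
  "sphere_measure =
     restrict_space (distr (uniform_measure lborel (ball 0 1)) borel sgn) (sphere 0 1)"

text \<open>
  Spherical harmonics of degree \<open>k\<close>, represented by the homogeneous harmonic polynomials of which
  they are the restrictions. By homogeneity such a polynomial is determined by its values on the
  sphere, so that the projection below is unique as a function on \<open>'a\<close>.
\<close>

definition spherical_harmonics :: "nat \<Rightarrow> ('a::euclidean_space \<Rightarrow> real) set" where
  "spherical_harmonics k =
     {Y. real_polynomial_function Y \<and> (\<forall>c x. Y (c *\<^sub>R x) = c ^ k * Y x) \<and> (\<forall>x. laplacian Y x = 0)}"

text \<open>The \<open>L\<^sup>2(dw)\<close>-orthogonal projection to the (finite-dimensional) space of spherical harmonics.\<close>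

definition harmonic_proj :: "nat \<Rightarrow> ('a::euclidean_space \<Rightarrow> real) \<Rightarrow> 'a \<Rightarrow> real" where
  "harmonic_proj k f =
     (THE Y. Y \<in> spherical_harmonics k \<and>
        (\<forall>Z\<in>spherical_harmonics k. (\<integral>\<xi>. (f \<xi> - Y \<xi>) * Z \<xi> \<partial>sphere_measure) = 0))"

text \<open>The operator \<open>-\<Delta> + c\<close>.\<close>

definition neg_lb_plus :: "real \<Rightarrow> ('a::euclidean_space \<Rightarrow> real) \<Rightarrow> 'a \<Rightarrow> real" where
  "neg_lb_plus c f = (\<lambda>\<xi>. - laplace_beltrami f \<xi> + c * f \<xi>)"

text \<open>
  The operator \<open>(-\<Delta> + c)\<^bsup>1/2\<^esup>\<close>, defined spectrally: spherical harmonics of degree \<open>k\<close> are the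
  eigenfunctions of \<open>-\<Delta>\<close> with eigenvalue \<open>k (k + n - 1)\<close>. For smooth \<open>f\<close> the series
  converges absolutely and uniformly on the sphere.
\<close>

definition sqrt_neg_lb_plus :: "nat \<Rightarrow> real \<Rightarrow> ('a::euclidean_space \<Rightarrow> real) \<Rightarrow> 'a \<Rightarrow> real" where
  "sqrt_neg_lb_plus n c f =
     (\<lambda>\<xi>. \<Sum>k. sqrt (real k * (real k + real n - 1) + c) * harmonic_proj k f \<xi>)"

text \<open>
  For \<open>n \<ge> 2\<close>, the indices \<open>0 \<le> k \<le> (n-2)/2\<close> (\<open>n\<close> even) and \<open>0 \<le> k \<le> (n-3)/2\<close> (\<open>n\<close> odd) of the
  product are in both cases those with \<open>k < n div 2\<close>. The factors commute on smooth functions.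
\<close>

definition paneitz_product :: "nat \<Rightarrow> ('a::euclidean_space \<Rightarrow> real) \<Rightarrow> 'a \<Rightarrow> real" where
  "paneitz_product n f =
     fold (\<lambda>k. neg_lb_plus (real k * (real n - real k - 1))) [0..<n div 2] f"

definition paneitz :: "nat \<Rightarrow> ('a::euclidean_space \<Rightarrow> real) \<Rightarrow> 'a \<Rightarrow> real" where
  "paneitz n f =
     (if even n then paneitz_product n f
      else sqrt_neg_lb_plus n (((real n - 1) / 2)\<^sup>2) (paneitz_product n f))"

end

theory Submission
  imports Defs
begin

text \<open>
  Write \<open>F = e\<^bsup>nu\<^esup> / \<integral>e\<^bsup>nu\<^esup>\<close> and let \<open>X f = \<langle>\<nabla>f, \<nabla>\<xi>\<^sub>1\<rangle>\<close>, so that \<open>X F = n F X u\<close> and, by the divergence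
  theorem, \<open>\<integral>X f = n \<integral>\<xi>\<^sub>1 f\<close>. Applying the latter to \<open>f = \<xi>\<^sub>1 F\<close> and using the equation tested against the
  second zonal harmonic, the terms with the second coefficient of \<open>u\<close> cancel precisely when \<open>\<alpha> = 1 / (n + 1)\<close>, leaving
  \<open>\<integral>\<xi>\<^sub>1 (X u) (F - 1) = 0\<close>, that is, \<open>\<integral>\<xi>\<^sub>1 (X u) (P u) = 0\<close>. Expanding \<open>u\<close> in zonal harmonics, with coefficients
  \<open>a\<^sub>k\<close>, turns the left-hand side into a quadratic form that couples \<open>a\<^sub>k\<close> only with \<open>a\<^sub>k\<close> and \<open>a\<^bsub>k+2\<^esub>\<close>, and
  this form is positive definite on the coefficients with \<open>k \<ge> 1\<close>. Hence \<open>F = 1\<close>.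
\<close>

section \<open>Smooth functions on the sphere\<close>

text \<open>The factor xi_1 in the tested identity is what gives it content. In the pairing of X u
  with P u alone, the coefficient of a_k a_{k+1} is a multiple of (k + n) P_k - k P_{k+1}, where P_k
  = k (k + 1) ... (k + n - 1) is the eigenvalue of P; this is zero, an expression of the conformal
  invariance of P. With the factor xi_1 the couplings move to k and k + 2, a diagonal appears, and
  the form has a sign. The price is the second moment of F. For general alpha the equation gives F
  the degree-2 coefficient alpha n (n + 1) a_2, since P_2 = (n + 1)!. The divergence theorem then
  yields (n + 1)^2 alpha a_2 for the integral of xi_1 (X u) F, while the integral of xi_1 X u is (n
  + 1) a_2; these agree at alpha = 1 / (n + 1). The expansion of u is used in the L2 sense, so
  definiteness is read off from finite partial sums whose boundary terms tend to zero. For odd n the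
  operator is itself an infinite series, and its coefficients rest on convergence almost
  everywhere.\<close>

definition pderiv_dir :: "'a::euclidean_space \<Rightarrow> ('a \<Rightarrow> real) \<Rightarrow> 'a \<Rightarrow> real" where
  "pderiv_dir b f x = frechet_derivative f (at x) b"

text \<open>Stated for arbitrary functions, since partial derivatives of a degree-0 extension have
  degree -1 and are no longer of the form \<open>f (sgn x)\<close>.\<close>

definition smooth_off_0 :: "('a::euclidean_space \<Rightarrow> real) \<Rightarrow> bool" where
  "smooth_off_0 f \<longleftrightarrow>
     (\<forall>bs. set bs \<subseteq> Basis \<longrightarrow> iter_partial bs f differentiable_on (- {0}))"

lemma smooth_on_sphere_iff: "smooth_on_sphere f \<longleftrightarrow> smooth_off_0 (\<lambda>x. f (sgn x))"
  by (simp add: smooth_on_sphere_def smooth_off_0_def)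

text \<open>\<open>iter_partial\<close> recurses on the outermost derivative; peeling off the
  innermost one lets an induction change the function instead.\<close>

lemma iter_partial_snoc: "iter_partial (bs @ [b]) f = iter_partial bs (pderiv_dir b f)"
  by (induction bs) (simp_all add: pderiv_dir_def[abs_def])

lemma smooth_off_0_pderiv_dir: "smooth_off_0 f \<Longrightarrow> b \<in> Basis \<Longrightarrow> smooth_off_0 (pderiv_dir b f)"
  unfolding smooth_off_0_def by (metis iter_partial_snoc Un_subset_iff empty_subsetI insert_subset list.simps(15) set_append set_empty)

lemma differentiable_on_off_0:
  "(f :: 'a::euclidean_space \<Rightarrow> real) differentiable_on (- {0}) \<longleftrightarrow> (\<forall>x. x \<noteq> 0 \<longrightarrow> f differentiable (at x))"
  by (auto simp: differentiable_on_eq_differentiable_at open_Compl)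

lemma smooth_off_0_differentiable: "smooth_off_0 f \<Longrightarrow> x \<noteq> 0 \<Longrightarrow> f differentiable (at x)"
  unfolding smooth_off_0_def
  by (metis differentiable_on_off_0 empty_subsetI iter_partial.simps(1) set_empty)

lemma differentiable_cong_off_0:
  fixes f g :: "'a::euclidean_space \<Rightarrow> real"
  assumes "\<And>x. x \<noteq> 0 \<Longrightarrow> f x = g x" "x \<noteq> 0" "f differentiable (at x)"
  shows "g differentiable (at x)"
  using assms(3) unfolding differentiable_def
  by (metis (no_types, lifting) Compl_iff assms(1,2) closed_singleton has_derivative_transform_within_open
      open_Compl singletonD singletonI)

text \<open>\<open>frechet_derivative\<close> is a choice among the derivatives at a point, so two
  functions with the same derivatives, possibly none, get the same value.\<close>

lemma pderiv_dir_cong_off_0: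
  fixes f g :: "'a::euclidean_space \<Rightarrow> real"
  assumes "\<And>x. x \<noteq> 0 \<Longrightarrow> f x = g x" "x \<noteq> 0"
  shows "pderiv_dir b f x = pderiv_dir b g x"
proof -
  have *: "(g has_derivative f') (at x)"
    if "(f has_derivative f') (at x)" "\<And>x. x \<noteq> 0 \<Longrightarrow> f x = g x" for f' and f g :: "'a \<Rightarrow> real"
    by (rule has_derivative_transform_within_open[OF that(1), of "- {0}"]) (use that(2) assms in auto)
  have "(f has_derivative f') (at x) \<longleftrightarrow> (g has_derivative f') (at x)" for f'
    using *[of f f' g] *[of g f' f] assms by auto
  then show ?thesis by (simp add: pderiv_dir_def frechet_derivative_def)
qed

lemma iter_partial_cong_off_0:
  fixes f g :: "'a::euclidean_space \<Rightarrow> real"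
  assumes "\<And>x. x \<noteq> 0 \<Longrightarrow> f x = g x" "x \<noteq> 0"
  shows "iter_partial bs f x = iter_partial bs g x"
  using assms(2)
proof (induction bs arbitrary: x)
  case (Cons b bs)
  then show ?case
    using pderiv_dir_cong_off_0[of "iter_partial bs f" "iter_partial bs g" x b]
    by (simp add: pderiv_dir_def)
qed (use assms in auto)

text \<open>Smoothness is the greatest class of functions that are differentiable off the origin and closed
  under partial derivatives. Hence every algebra of differentiable functions that is closed under
  partial derivatives, such as \<open>smooth_alg\<close> below, consists of smooth functions.\<close>

lemma smooth_off_0_coinduct:
  assumes "f \<in> A"
    and diff: "\<And>g x. g \<in> A \<Longrightarrow> x \<noteq> 0 \<Longrightarrow> g differentiable (at x)"
    and closed: "\<And>g b. g \<in> A \<Longrightarrow> b \<in> Basis \<Longrightarrow> \<exists>h\<in>A. \<forall>x. x \<noteq> 0 \<longrightarrow> pderiv_dir b g x = h x"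
  shows "smooth_off_0 f"
proof -
  have "iter_partial bs g differentiable (at x)" if "set bs \<subseteq> Basis" "g \<in> A" "x \<noteq> 0" for bs g x
    using that
  proof (induction bs arbitrary: g x rule: rev_induct)
    case (snoc b bs)
    obtain h where h: "h \<in> A" "\<And>x. x \<noteq> 0 \<Longrightarrow> pderiv_dir b g x = h x"
      using closed[of g b] snoc.prems by auto
    have "iter_partial bs h differentiable (at x)"
      using snoc h by auto
    then show ?case
      unfolding iter_partial_snoc
      using differentiable_cong_off_0[of "iter_partial bs h" "iter_partial bs (pderiv_dir b g)" x]
        iter_partial_cong_off_0 h(2) snoc.prems by metis
  qed (use diff in auto)
  then show ?thesis
    using assms(1) by (auto simp: smooth_off_0_def differentiable_on_off_0)
qed

lemma smooth_off_0_cong: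
  assumes "smooth_off_0 f" "\<And>x. x \<noteq> 0 \<Longrightarrow> f x = g x"
  shows "smooth_off_0 g"
  unfolding smooth_off_0_def differentiable_on_off_0
proof (intro allI impI)
  fix bs :: "'a list" and x :: 'a
  assume "set bs \<subseteq> Basis" "x \<noteq> 0"
  then have "iter_partial bs f differentiable (at x)"
    using assms(1) by (simp add: smooth_off_0_def differentiable_on_off_0)
  then show "iter_partial bs g differentiable (at x)"
    by (rule differentiable_cong_off_0[rotated 2]) (use iter_partial_cong_off_0[of f g] assms(2) \<open>x \<noteq> 0\<close> in auto)
qed

section \<open>Calculus rules for directional derivatives\<close>

lemma pderiv_dir_eqI: "(f has_derivative D) (at x) \<Longrightarrow> pderiv_dir b f x = D b"
  by (metis frechet_derivative_at pderiv_dir_def)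

lemma has_derivative_pderiv_dir:
  fixes f :: "'a::euclidean_space \<Rightarrow> real"
  assumes "f differentiable (at x)"
  shows "(f has_derivative (\<lambda>h. \<Sum>b\<in>Basis. (h \<bullet> b) * pderiv_dir b f x)) (at x)"
proof -
  have D: "(f has_derivative frechet_derivative f (at x)) (at x)"
    using assms frechet_derivative_works by blast
  then have lin: "linear (frechet_derivative f (at x))"
    by (simp add: assms linear_frechet_derivative)
  have "frechet_derivative f (at x) h = (\<Sum>b\<in>Basis. (h \<bullet> b) * pderiv_dir b f x)" for h
  proof -
    have "frechet_derivative f (at x) h = frechet_derivative f (at x) (\<Sum>b\<in>Basis. (h \<bullet> b) *\<^sub>R b)"
      by (simp add: euclidean_representation)
    also have "\<dots> = (\<Sum>b\<in>Basis. (h \<bullet> b) * pderiv_dir b f x)"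
      by (simp add: linear_sum[OF lin] linear_cmul[OF lin] pderiv_dir_def)
    finally show ?thesis .
  qed
  then have "frechet_derivative f (at x) = (\<lambda>h. \<Sum>b\<in>Basis. (h \<bullet> b) * pderiv_dir b f x)" by auto
  with D show ?thesis by simp
qed

lemma pderiv_dir_const [simp]: "pderiv_dir b (\<lambda>x. c) x = 0"
  by (simp add: pderiv_dir_def)

lemma has_derivative_pderiv_dir_works:
  "(f :: 'a::euclidean_space \<Rightarrow> real) differentiable (at x) \<Longrightarrow> (f has_derivative (\<lambda>b. pderiv_dir b f x)) (at x)"
  unfolding pderiv_dir_def using frechet_derivative_works by metis

lemma pderiv_dir_add:
  "f differentiable (at x) \<Longrightarrow> g differentiable (at x) \<Longrightarrow>
    pderiv_dir b (\<lambda>x. f x + g x) x = pderiv_dir b f x + pderiv_dir b g x"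
  by (rule pderiv_dir_eqI[OF has_derivative_add[OF has_derivative_pderiv_dir_works has_derivative_pderiv_dir_works]])

lemma pderiv_dir_diff:
  "f differentiable (at x) \<Longrightarrow> g differentiable (at x) \<Longrightarrow>
    pderiv_dir b (\<lambda>x. f x - g x) x = pderiv_dir b f x - pderiv_dir b g x"
  by (rule pderiv_dir_eqI[OF has_derivative_diff[OF has_derivative_pderiv_dir_works has_derivative_pderiv_dir_works]])

lemma pderiv_dir_mult:
  "f differentiable (at x) \<Longrightarrow> g differentiable (at x) \<Longrightarrow>
    pderiv_dir b (\<lambda>x. f x * g x) x = f x * pderiv_dir b g x + pderiv_dir b f x * g x"
  by (rule pderiv_dir_eqI[OF has_derivative_mult[OF has_derivative_pderiv_dir_works has_derivative_pderiv_dir_works]])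

lemma pderiv_dir_cmult:
  "g differentiable (at x) \<Longrightarrow> pderiv_dir b (\<lambda>x. c * g x) x = c * pderiv_dir b g x"
  using pderiv_dir_mult[of "\<lambda>_. c" x g b] by simp

lemma pderiv_dir_exp:
  assumes "f differentiable (at x)"
  shows "pderiv_dir b (\<lambda>x. exp (f x)) x = exp (f x) * pderiv_dir b f x"
proof (rule pderiv_dir_eqI)
  show "((\<lambda>x. exp (f x)) has_derivative (\<lambda>b. exp (f x) * pderiv_dir b f x)) (at x)"
    using has_derivative_exp[OF has_derivative_pderiv_dir_works[OF assms]] by (simp add: mult.commute)
qed

lemma pderiv_dir_bounded_linear: "bounded_linear f \<Longrightarrow> pderiv_dir b f x = f b"
  by (rule pderiv_dir_eqI) (rule bounded_linear_imp_has_derivative)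

lemma pderiv_dir_inner: "pderiv_dir b (\<lambda>x. x \<bullet> c) x = b \<bullet> c"
  by (rule pderiv_dir_bounded_linear) (rule bounded_linear_inner_left)

lemma differentiable_norm_off_0:
  "x \<noteq> 0 \<Longrightarrow> (norm :: 'a::euclidean_space \<Rightarrow> real) differentiable (at x)"
  by (rule differentiable_norm_at)

lemma pderiv_dir_norm: "x \<noteq> 0 \<Longrightarrow> pderiv_dir b norm x = (x \<bullet> b) / norm x"
  by (subst pderiv_dir_eqI[OF has_derivative_norm])
     (auto simp: sgn_div_norm inner_commute divide_inverse mult.commute)

lemma inverse_norm_has_derivative:
  "x \<noteq> 0 \<Longrightarrow> ((\<lambda>x::'a::euclidean_space. inverse (norm x)) has_derivative
     (\<lambda>h. - ((x \<bullet> h) * inverse (norm x) ^ 3))) (at x)"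
  by (rule has_derivative_eq_rhs[OF Deriv.has_derivative_inverse[OF _ has_derivative_norm]])
     (auto simp: fun_eq_iff sgn_div_norm power3_eq_cube field_simps inner_commute)

text \<open>All smooth functions are generators, so the closure rules become closure properties of
  smoothness once the two classes are shown equal in \<open>smooth_alg_eq\<close>. The generator
  \<open>inverse (norm x)\<close> covers \<open>sgn\<close>, and its derivatives stay in the
  algebra.\<close>

inductive_set smooth_alg :: "('a::euclidean_space \<Rightarrow> real) set" where
  base: "smooth_off_0 f \<Longrightarrow> f \<in> smooth_alg"
| const: "(\<lambda>x. c) \<in> smooth_alg"
| coord: "(\<lambda>x. x \<bullet> v) \<in> smooth_alg"
| inv_norm: "(\<lambda>x. inverse (norm x)) \<in> smooth_alg"
| add: "f \<in> smooth_alg \<Longrightarrow> g \<in> smooth_alg \<Longrightarrow> (\<lambda>x. f x + g x) \<in> smooth_alg"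
| mult: "f \<in> smooth_alg \<Longrightarrow> g \<in> smooth_alg \<Longrightarrow> (\<lambda>x. f x * g x) \<in> smooth_alg"
| exp: "f \<in> smooth_alg \<Longrightarrow> (\<lambda>x. exp (f x)) \<in> smooth_alg"

lemma differentiable_exp:
  "(f :: 'a::euclidean_space \<Rightarrow> real) differentiable (at x) \<Longrightarrow> (\<lambda>x. exp (f x)) differentiable (at x)"
  unfolding differentiable_def using has_derivative_exp by blast

lemma smooth_alg_differentiable: "f \<in> smooth_alg \<Longrightarrow> x \<noteq> 0 \<Longrightarrow> f differentiable (at x)"
proof (induction rule: smooth_alg.induct)
  case (base f)
  then show ?case by (simp add: smooth_off_0_differentiable)
next
  case (coord v)
  then show ?case
    using bounded_linear_imp_differentiable bounded_linear_inner_left by blast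
next
  case inv_norm
  then show ?case using inverse_norm_has_derivative differentiable_def by blast
qed (auto intro: differentiable_add differentiable_mult differentiable_exp)

lemma smooth_alg_pderiv_dir:
  "f \<in> smooth_alg \<Longrightarrow> b \<in> Basis \<Longrightarrow> \<exists>h\<in>smooth_alg. \<forall>x. x \<noteq> 0 \<longrightarrow> pderiv_dir b f x = h x"
proof (induction rule: smooth_alg.induct)
  case (base f)
  then show ?case using smooth_off_0_pderiv_dir smooth_alg.base by blast
next
  case (const c)
  then show ?case by (auto intro: smooth_alg.const)
next
  case (coord v)
  then show ?case by (auto simp: pderiv_dir_inner intro: smooth_alg.const)
next
  case inv_norm
  let ?i = "\<lambda>x. inverse (norm x)"
  have "(\<lambda>x. (-1) * ((x \<bullet> b) * (?i x * (?i x * ?i x)))) \<in> smooth_alg"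
    by (intro smooth_alg.mult smooth_alg.const smooth_alg.coord smooth_alg.inv_norm)
  then show ?case
    by (intro bexI) (auto simp: pderiv_dir_eqI[OF inverse_norm_has_derivative] power3_eq_cube)
next
  case (add f g)
  then obtain f' g' where "f' \<in> smooth_alg" "\<forall>x. x \<noteq> 0 \<longrightarrow> pderiv_dir b f x = f' x"
    "g' \<in> smooth_alg" "\<forall>x. x \<noteq> 0 \<longrightarrow> pderiv_dir b g x = g' x" by metis
  then show ?case
    using add by (intro bexI[of _ "\<lambda>x. f' x + g' x"])
      (auto simp: pderiv_dir_add smooth_alg_differentiable intro: smooth_alg.add)
next
  case (mult f g)
  then obtain f' g' where "f' \<in> smooth_alg" "\<forall>x. x \<noteq> 0 \<longrightarrow> pderiv_dir b f x = f' x"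
    "g' \<in> smooth_alg" "\<forall>x. x \<noteq> 0 \<longrightarrow> pderiv_dir b g x = g' x" by metis
  then show ?case
    using mult by (intro bexI[of _ "\<lambda>x. f x * g' x + f' x * g x"])
      (auto simp: pderiv_dir_mult smooth_alg_differentiable intro: smooth_alg.add smooth_alg.mult)
next
  case (exp f)
  then obtain f' where "f' \<in> smooth_alg" "\<forall>x. x \<noteq> 0 \<longrightarrow> pderiv_dir b f x = f' x" by metis
  then show ?case
    using exp by (intro bexI[of _ "\<lambda>x. exp (f x) * f' x"])
      (auto simp: pderiv_dir_exp smooth_alg_differentiable intro: smooth_alg.exp smooth_alg.mult)
qed

lemma smooth_alg_eq: "smooth_alg = {f. smooth_off_0 f}"
  using smooth_off_0_coinduct[OF _ smooth_alg_differentiable smooth_alg_pderiv_dir]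
  by (auto intro: smooth_alg.base)

lemmas smooth_off_0_intros =
  smooth_alg.const[unfolded smooth_alg_eq mem_Collect_eq]
  smooth_alg.coord[unfolded smooth_alg_eq mem_Collect_eq]
  smooth_alg.inv_norm[unfolded smooth_alg_eq mem_Collect_eq]
  smooth_alg.add[unfolded smooth_alg_eq mem_Collect_eq]
  smooth_alg.mult[unfolded smooth_alg_eq mem_Collect_eq]
  smooth_alg.exp[unfolded smooth_alg_eq mem_Collect_eq]

lemma smooth_off_0_norm: "smooth_off_0 norm"
proof (rule smooth_off_0_cong)
  \<comment> \<open>The norm is written as its square, a polynomial, times the generator 1 /
    norm.\<close>
  show "smooth_off_0 (\<lambda>x::'a. (\<Sum>b\<in>Basis. (x \<bullet> b) * (x \<bullet> b)) * inverse (norm x))"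
  proof -
    have "smooth_off_0 (\<lambda>x::'a. \<Sum>b\<in>B. (x \<bullet> b) * (x \<bullet> b))" if "finite B" for B
      using that
    proof induction
      case (insert b B)
      then show ?case
        using smooth_off_0_intros(4)[OF smooth_off_0_intros(5)[OF smooth_off_0_intros(2)[of b] smooth_off_0_intros(2)[of b]]]
        by simp
    qed (auto intro: smooth_off_0_intros)
    then show ?thesis by (intro smooth_off_0_intros) auto
  qed
  show "(\<Sum>b\<in>Basis. (x \<bullet> b) * (x \<bullet> b)) * inverse (norm x) = norm x" if "x \<noteq> 0" for x :: 'a
    using that by (simp add: euclidean_inner[symmetric] dot_square_norm power2_eq_square)
qed

text \<open>On the unit sphere, \<open>tderiv b f\<close> is the tangential derivative \<open>\<langle>\<nabla>f, \<nabla>\<xi>\<^sub>b\<rangle>\<close>.\<close>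

definition tderiv :: "'a::euclidean_space \<Rightarrow> ('a \<Rightarrow> real) \<Rightarrow> 'a \<Rightarrow> real" where
  "tderiv b f = pderiv_dir b (\<lambda>x. f (sgn x))"

section \<open>Tangential derivatives and the Laplace-Beltrami operator\<close>

lemma ext_differentiable:
  "smooth_on_sphere f \<Longrightarrow> x \<noteq> 0 \<Longrightarrow> (\<lambda>x. f (sgn x)) differentiable (at x)"
  by (simp add: smooth_on_sphere_iff smooth_off_0_differentiable)

lemma smooth_on_sphere_cong:
  assumes "smooth_on_sphere f" "\<And>x. x \<in> sphere 0 1 \<Longrightarrow> f x = g x"
  shows "smooth_on_sphere g"
  using assms unfolding smooth_on_sphere_iff
  by (auto elim!: smooth_off_0_cong simp: norm_sgn)

lemma smooth_on_sphere_const: "smooth_on_sphere (\<lambda>x. c)"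
  and smooth_on_sphere_add: "smooth_on_sphere f \<Longrightarrow> smooth_on_sphere g \<Longrightarrow> smooth_on_sphere (\<lambda>x. f x + g x)"
  and smooth_on_sphere_mult: "smooth_on_sphere f \<Longrightarrow> smooth_on_sphere g \<Longrightarrow> smooth_on_sphere (\<lambda>x. f x * g x)"
  and smooth_on_sphere_exp: "smooth_on_sphere f \<Longrightarrow> smooth_on_sphere (\<lambda>x. exp (f x))"
  unfolding smooth_on_sphere_iff by (intro smooth_off_0_intros; assumption)+

lemma smooth_on_sphere_cmult: "smooth_on_sphere f \<Longrightarrow> smooth_on_sphere (\<lambda>x. c * f x)"
  by (intro smooth_on_sphere_mult smooth_on_sphere_const)

lemma smooth_on_sphere_minus: "smooth_on_sphere f \<Longrightarrow> smooth_on_sphere (\<lambda>x. - f x)"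
  using smooth_on_sphere_cmult[of f "-1"] by simp

lemma smooth_on_sphere_sum:
  "finite I \<Longrightarrow> (\<And>i. i \<in> I \<Longrightarrow> smooth_on_sphere (f i)) \<Longrightarrow> smooth_on_sphere (\<lambda>x. \<Sum>i\<in>I. f i x)"
  by (induction rule: finite_induct) (auto intro: smooth_on_sphere_add smooth_on_sphere_const)

lemma smooth_on_sphere_inner: "smooth_on_sphere (\<lambda>x. x \<bullet> v)"
  unfolding smooth_on_sphere_iff sgn_div_norm inner_scaleR_left
  by (intro smooth_off_0_intros)

lemma smooth_on_sphere_polynomial:
  fixes p :: "'a::euclidean_space \<Rightarrow> real"
  assumes "real_polynomial_function p" shows "smooth_on_sphere p"
  using assms
proof induction
  case (linear f)
  then have lin: "linear f" by (simp add: bounded_linear.linear)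
  have "f x = x \<bullet> (\<Sum>b\<in>Basis. f b *\<^sub>R b)" for x
  proof -
    have "f x = f (\<Sum>b\<in>Basis. (x \<bullet> b) *\<^sub>R b)" by (simp add: euclidean_representation)
    also have "\<dots> = (\<Sum>b\<in>Basis. (x \<bullet> b) * f b)"
      by (simp add: linear_sum[OF lin] linear_cmul[OF lin])
    finally show ?thesis by (simp add: inner_sum_right mult.commute)
  qed
  then have "f = (\<lambda>x. x \<bullet> (\<Sum>b\<in>Basis. f b *\<^sub>R b))" by (rule ext)
  then show ?case using smooth_on_sphere_inner by metis
qed (auto intro: smooth_on_sphere_const smooth_on_sphere_add smooth_on_sphere_mult)

lemma pderiv_dir_ext_scale:
  fixes f :: "'a::euclidean_space \<Rightarrow> real"
  assumes "smooth_on_sphere f" "x \<noteq> 0" "c > 0"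
  shows "pderiv_dir b (\<lambda>x. f (sgn x)) (c *\<^sub>R x) = pderiv_dir b (\<lambda>x. f (sgn x)) x / c"
proof -
  let ?f = "\<lambda>x. f (sgn x)"
  have D: "(?f has_derivative (\<lambda>b. pderiv_dir b ?f (c *\<^sub>R x))) (at (c *\<^sub>R x))"
    using ext_differentiable[OF assms(1), of "c *\<^sub>R x"] assms by (auto intro: has_derivative_pderiv_dir_works)
  have "((\<lambda>y. ?f (c *\<^sub>R y)) has_derivative (\<lambda>b. pderiv_dir (c *\<^sub>R b) ?f (c *\<^sub>R x))) (at x)"
    by (rule has_derivative_compose[where f = "\<lambda>y. c *\<^sub>R y" and f' = "\<lambda>y. c *\<^sub>R y" and x = x
          and g = ?f, OF _ D]) (auto intro!: derivative_eq_intros)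
  moreover have "(\<lambda>y. ?f (c *\<^sub>R y)) = ?f" using assms by (simp add: sgn_scaleR)
  ultimately have "pderiv_dir b ?f x = pderiv_dir (c *\<^sub>R b) ?f (c *\<^sub>R x)" by (metis pderiv_dir_eqI)
  also have "\<dots> = c * pderiv_dir b ?f (c *\<^sub>R x)"
    using linear_cmul[OF linear_frechet_derivative[OF ext_differentiable[OF assms(1), of "c *\<^sub>R x"]]]
      assms by (simp add: pderiv_dir_def)
  finally show ?thesis using assms by simp
qed

text \<open>Partial derivatives of the extension have degree -1; the factor \<open>norm x\<close>
  restores degree 0, which makes \<open>tderiv b f\<close> smooth again and \<open>tderiv\<close>
  iterable.\<close>

lemma tderiv_sgn:
  assumes "smooth_on_sphere f" "x \<noteq> 0"
  shows "tderiv b f (sgn x) = norm x * pderiv_dir b (\<lambda>x. f (sgn x)) x"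
  using pderiv_dir_ext_scale[OF assms, of "inverse (norm x)" b] assms
  by (simp add: tderiv_def sgn_div_norm field_simps)

lemma smooth_on_sphere_tderiv:
  assumes "smooth_on_sphere f" "b \<in> Basis"
  shows "smooth_on_sphere (tderiv b f)"
  unfolding smooth_on_sphere_iff
proof (rule smooth_off_0_cong)
  show "smooth_off_0 (\<lambda>x. norm x * pderiv_dir b (\<lambda>x. f (sgn x)) x)"
    using assms by (intro smooth_off_0_intros smooth_off_0_norm smooth_off_0_pderiv_dir)
      (auto simp: smooth_on_sphere_iff)
qed (use assms in \<open>auto simp: tderiv_sgn\<close>)

lemma sphere_nonzero: "x \<in> sphere 0 1 \<Longrightarrow> x \<noteq> (0::'a::euclidean_space)"
  by auto

lemma sgn_sphere: "x \<in> sphere 0 1 \<Longrightarrow> sgn x = (x::'a::euclidean_space)"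
  by (simp add: sgn_div_norm)

lemma tderiv_cong:
  assumes "\<And>x. x \<in> sphere 0 1 \<Longrightarrow> f x = g x" "x \<in> sphere 0 1"
  shows "tderiv b f x = tderiv b g x"
  unfolding tderiv_def using assms by (intro pderiv_dir_cong_off_0) (auto simp: norm_sgn)

lemma tderiv_add: "smooth_on_sphere f \<Longrightarrow> smooth_on_sphere g \<Longrightarrow> x \<in> sphere 0 1 \<Longrightarrow>
    tderiv b (\<lambda>x. f x + g x) x = tderiv b f x + tderiv b g x"
  unfolding tderiv_def
  by (rule pderiv_dir_add[OF ext_differentiable ext_differentiable]) (auto simp: sphere_nonzero)

lemma tderiv_cmult: "smooth_on_sphere f \<Longrightarrow> x \<in> sphere 0 1 \<Longrightarrow> tderiv b (\<lambda>x. c * f x) x = c * tderiv b f x"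
  unfolding tderiv_def
  by (rule pderiv_dir_cmult[OF ext_differentiable]) (auto simp: sphere_nonzero)

lemma tderiv_mult: "smooth_on_sphere f \<Longrightarrow> smooth_on_sphere g \<Longrightarrow> x \<in> sphere 0 1 \<Longrightarrow>
    tderiv b (\<lambda>x. f x * g x) x = f x * tderiv b g x + tderiv b f x * g x"
  unfolding tderiv_def
  using pderiv_dir_mult[OF ext_differentiable[of f x] ext_differentiable[of g x], of b]
  by (simp add: sgn_sphere sphere_nonzero)

lemma tderiv_exp: "smooth_on_sphere f \<Longrightarrow> x \<in> sphere 0 1 \<Longrightarrow>
    tderiv b (\<lambda>x. exp (f x)) x = exp (f x) * tderiv b f x"
  unfolding tderiv_def
  using pderiv_dir_exp[OF ext_differentiable[of f x], of b]
  by (simp add: sgn_sphere sphere_nonzero)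

text \<open>Euler's relation in degree 0: the extension is constant along rays, so its derivative
  along x vanishes.\<close>

lemma tderiv_radial:
  assumes "smooth_on_sphere f" "x \<in> sphere 0 1"
  shows "(\<Sum>b\<in>Basis. (x \<bullet> b) * tderiv b f x) = 0"
proof -
  let ?f = "\<lambda>x. f (sgn x)"
  have x0: "x \<noteq> 0" using assms by auto
  have D: "(?f has_derivative (\<lambda>h. \<Sum>b\<in>Basis. (h \<bullet> b) * pderiv_dir b ?f x)) (at (1 *\<^sub>R x))"
    using has_derivative_pderiv_dir[OF ext_differentiable[OF assms(1) x0]] by simp
  have "((\<lambda>t. ?f (t *\<^sub>R x)) has_derivative (\<lambda>t. \<Sum>b\<in>Basis. (t *\<^sub>R x \<bullet> b) * pderiv_dir b ?f x)) (at 1)"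
    by (rule has_derivative_compose[where f = "\<lambda>t. t *\<^sub>R x" and f' = "\<lambda>t. t *\<^sub>R x" and x = 1
          and g = ?f, OF _ D]) (auto intro!: derivative_eq_intros)
  moreover have "((\<lambda>t. ?f (t *\<^sub>R x)) has_derivative (\<lambda>t. 0)) (at 1)"
  proof (rule has_derivative_transform_within_open[OF has_derivative_const, where s = "{0<..}"])
    show "f (sgn x) = f (sgn (t *\<^sub>R x))" if "t \<in> {0<..}" for t :: real
      using that by (simp add: sgn_scaleR)
  qed auto
  ultimately have "(\<lambda>t. \<Sum>b\<in>Basis. (t *\<^sub>R x \<bullet> b) * pderiv_dir b ?f x) = (\<lambda>t. 0)"
    by (rule has_derivative_unique)
  from fun_cong[OF this, of 1] show ?thesis by (simp add: tderiv_def)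
qed

text \<open>The first-order term comes from differentiating the factor \<open>norm x\<close> of
  \<open>tderiv_sgn\<close>. Summed over the basis it is the radial derivative, which is zero; hence
  \<open>laplace_beltrami_eq\<close>.\<close>

lemma tderiv_tderiv:
  assumes "smooth_on_sphere f" "x \<in> sphere 0 1" "b \<in> Basis"
  shows "tderiv b (tderiv b f) x = (x \<bullet> b) * tderiv b f x + iter_partial [b, b] (\<lambda>x. f (sgn x)) x"
proof -
  let ?f = "\<lambda>x. f (sgn x)"
  have x0: "x \<noteq> 0" and n1: "norm x = 1" using assms by auto
  have "tderiv b (tderiv b f) x = pderiv_dir b (\<lambda>x. tderiv b f (sgn x)) x" by (simp add: tderiv_def)
  also have "\<dots> = pderiv_dir b (\<lambda>x. norm x * pderiv_dir b ?f x) x"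
    using assms(1) x0 by (intro pderiv_dir_cong_off_0) (auto simp: tderiv_sgn)
  also have "\<dots> = norm x * pderiv_dir b (pderiv_dir b ?f) x + pderiv_dir b norm x * pderiv_dir b ?f x"
    using assms x0 by (intro pderiv_dir_mult differentiable_norm_off_0 smooth_off_0_differentiable
        smooth_off_0_pderiv_dir) (auto simp: smooth_on_sphere_iff)
  also have "\<dots> = (x \<bullet> b) * tderiv b f x + iter_partial [b, b] ?f x"
    using x0 n1 by (simp add: pderiv_dir_norm tderiv_def) (simp add: pderiv_dir_def[abs_def])
  finally show ?thesis .
qed

lemma laplace_beltrami_eq:
  assumes "smooth_on_sphere f" "x \<in> sphere 0 1"
  shows "laplace_beltrami f x = (\<Sum>b\<in>Basis. tderiv b (tderiv b f) x)"
  using tderiv_radial[OF assms] tderiv_tderiv[OF assms]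
  by (simp add: laplace_beltrami_def laplacian_def sum.distrib)

lemma smooth_on_sphere_laplace_beltrami:
  assumes "smooth_on_sphere f" shows "smooth_on_sphere (laplace_beltrami f)"
proof (rule smooth_on_sphere_cong)
  show "smooth_on_sphere (\<lambda>x. \<Sum>b\<in>Basis. tderiv b (tderiv b f) x)"
    using assms by (intro smooth_on_sphere_sum smooth_on_sphere_tderiv) auto
qed (simp add: laplace_beltrami_eq[OF assms])

lemma smooth_on_sphere_neg_lb_plus:
  "smooth_on_sphere f \<Longrightarrow> smooth_on_sphere (neg_lb_plus c f)"
  unfolding neg_lb_plus_def
  by (intro smooth_on_sphere_add smooth_on_sphere_minus smooth_on_sphere_cmult
      smooth_on_sphere_laplace_beltrami)

lemma continuous_on_smooth:
  assumes "smooth_on_sphere f" shows "continuous_on (sphere 0 1) f"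
proof -
  have "continuous_on (sphere 0 1) (\<lambda>x. f (sgn x))"
    by (intro continuous_at_imp_continuous_on ballI differentiable_imp_continuous_within ext_differentiable assms)
       auto
  then show ?thesis using continuous_on_cong[of "sphere 0 1" "sphere 0 1" "\<lambda>x. f (sgn x)" f] sgn_sphere by metis
qed

section \<open>The divergence theorem\<close>

lemma sets_sphere_measure:
  "sets (sphere_measure :: 'a::euclidean_space measure) = sets (restrict_space borel (sphere 0 1))"
  unfolding sphere_measure_def by (intro sets_restrict_space_cong) auto

lemma space_sphere_measure [simp]: "space (sphere_measure :: 'a::euclidean_space measure) = sphere 0 1"
  by (simp add: sphere_measure_def space_restrict_space)

lemma unit_ball_measure_pos: "measure lborel (ball 0 1 :: 'a::euclidean_space set) > 0"
  by simp

lemma emeasure_ball_eq: "emeasure lborel (ball 0 1 :: 'a::euclidean_space set) = ennreal (measure lborel (ball 0 1 :: 'a set))"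
  using emeasure_lborel_ball_finite[of "0::'a" 1] by (simp add: emeasure_eq_ennreal_measure)

text \<open>A density with real values is what \<open>integral_density\<close> asks for in
  \<open>savg_eq_ball\<close>; \<open>uniform_measure\<close> divides in the extended reals.\<close>

lemma uniform_ball_eq:
  "uniform_measure lborel (ball 0 1 :: 'a::euclidean_space set) =
     density lborel (\<lambda>x. ennreal (indicator (ball 0 1) x / measure lborel (ball 0 1 :: 'a set)))"
  unfolding uniform_measure_def emeasure_ball_eq
  by (intro density_cong) (auto simp: indicator_def divide_ennreal[symmetric] unit_ball_measure_pos simp flip: ennreal_1)

lemma finite_measure_sphere: "finite_measure (sphere_measure :: 'a::euclidean_space measure)"
proof -
  have "finite_measure (uniform_measure lborel (ball 0 1 :: 'a set))"
  proof
    have "emeasure lborel (ball 0 1 :: 'a set) \<noteq> 0"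
      using unit_ball_measure_pos by (simp add: emeasure_ball_eq)
    then show "emeasure (uniform_measure lborel (ball 0 1 :: 'a set)) (space (uniform_measure lborel (ball 0 1))) \<noteq> \<infinity>"
      using emeasure_lborel_ball_finite[of "0::'a" 1]
      by (simp add: ennreal_divide_eq_top_iff)
  qed
  then have "finite_measure (distr (uniform_measure lborel (ball 0 1 :: 'a set)) borel sgn)"
    by (rule finite_measure.finite_measure_distr) simp
  then show ?thesis
    unfolding sphere_measure_def by (intro finite_measure_restrict_space) auto
qed

interpretation S: finite_measure "sphere_measure :: 'a::euclidean_space measure"
  by (rule finite_measure_sphere)

lemma measurable_sphere_continuous:
  fixes f :: "'a::euclidean_space \<Rightarrow> real"
  assumes "continuous_on (sphere 0 1) f"
  shows "f \<in> borel_measurable sphere_measure"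
  using borel_measurable_continuous_on_restrict[OF assms]
  by (simp cong: measurable_cong_sets add: sets_sphere_measure)

lemma integrable_sphere:
  fixes f :: "'a::euclidean_space \<Rightarrow> real"
  assumes "continuous_on (sphere 0 1) f"
  shows "integrable sphere_measure f"
proof -
  have "bounded (f ` sphere 0 1)"
    using assms compact_continuous_image compact_imp_bounded compact_sphere by blast
  then obtain B where "\<forall>x\<in>sphere 0 1. norm (f x) \<le> B"
    by (auto simp: bounded_iff)
  then show ?thesis
    by (intro S.integrable_const_bound[of _ B] measurable_sphere_continuous assms AE_I2) auto
qed

abbreviation (input) savg :: "('a::euclidean_space \<Rightarrow> real) \<Rightarrow> real" where
  "savg f \<equiv> integral\<^sup>L sphere_measure f"

abbreviation (input) scont :: "('a::euclidean_space \<Rightarrow> real) \<Rightarrow> bool" where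
  "scont f \<equiv> continuous_on (sphere 0 1) f"

lemma savg_cong: "(\<And>x. x \<in> sphere 0 1 \<Longrightarrow> f x = g x) \<Longrightarrow> savg f = savg g"
  by (rule Bochner_Integration.integral_cong) auto

lemma savg_add: "scont f \<Longrightarrow> scont g \<Longrightarrow> savg (\<lambda>x. f x + g x) = savg f + savg g"
  and savg_diff: "scont f \<Longrightarrow> scont g \<Longrightarrow> savg (\<lambda>x. f x - g x) = savg f - savg g"
  by (simp_all add: integrable_sphere)

lemma savg_cmult: "savg (\<lambda>x. c * f x) = c * savg f"
  by simp

lemma savg_sum: "(\<And>i. i \<in> I \<Longrightarrow> scont (f i)) \<Longrightarrow> savg (\<lambda>x. \<Sum>i\<in>I. f i x) = (\<Sum>i\<in>I. savg (f i))"
  by (simp add: integrable_sphere)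

lemma savg_nonneg: "(\<And>x. x \<in> sphere 0 1 \<Longrightarrow> 0 \<le> f x) \<Longrightarrow> 0 \<le> savg f"
  by (rule Bochner_Integration.integral_nonneg) auto

lemma savg_mono:
  "scont f \<Longrightarrow> scont g \<Longrightarrow> (\<And>x. x \<in> sphere 0 1 \<Longrightarrow> f x \<le> g x) \<Longrightarrow> savg f \<le> savg g"
  by (rule integral_mono) (auto simp: integrable_sphere)

text \<open>The indicator is 1 off the origin and 0 at it. It makes the extension the composition of
  \<open>sgn\<close> with a Borel function, whatever f does off the sphere.\<close>

definition cone_ext :: "('a::euclidean_space \<Rightarrow> real) \<Rightarrow> 'a \<Rightarrow> real" where
  "cone_ext f x = indicator (sphere 0 1) (sgn x) * f (sgn x)"

lemma cone_ext_off_0: "x \<noteq> 0 \<Longrightarrow> cone_ext f x = f (sgn x)"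
  by (simp add: cone_ext_def norm_sgn)

lemma borel_measurable_sgn_euclidean [measurable]: "(sgn :: 'a::euclidean_space \<Rightarrow> 'a) \<in> borel_measurable borel"
  unfolding sgn_div_norm by measurable

lemma measurable_cone_ext [measurable]:
  fixes f :: "'a::euclidean_space \<Rightarrow> real"
  assumes "scont f" shows "cone_ext f \<in> borel_measurable borel"
proof -
  have [measurable]: "(\<lambda>x. indicator (sphere 0 1) x *\<^sub>R f x) \<in> borel_measurable borel"
    by (rule borel_measurable_continuous_on_indicator[OF _ assms]) simp
  have "(\<lambda>x. indicator (sphere 0 1) (sgn x) *\<^sub>R f (sgn x)) \<in> borel_measurable borel"
    by (rule measurable_compose[OF borel_measurable_sgn_euclidean \<open>_ \<in> borel_measurable borel\<close>])
  then show ?thesis by (simp add: cone_ext_def[abs_def])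
qed

lemma cone_ext_scale: "c > 0 \<Longrightarrow> cone_ext f (c *\<^sub>R x) = cone_ext f x"
  by (simp add: cone_ext_def sgn_scaleR)

lemma cone_ext_bounded:
  fixes f :: "'a::euclidean_space \<Rightarrow> real"
  assumes "scont f"
  obtains B where "B > 0" "\<And>x. \<bar>cone_ext f x\<bar> \<le> B"
proof -
  have "bounded (f ` sphere 0 1)"
    using assms compact_continuous_image compact_imp_bounded compact_sphere by blast
  then obtain B where "B > 0" "\<And>x. x \<in> sphere 0 1 \<Longrightarrow> norm (f x) \<le> B"
    by (auto simp: bounded_pos)
  then have "\<bar>cone_ext f x\<bar> \<le> B" for x
    by (auto simp: cone_ext_def indicator_def)
  with \<open>B > 0\<close> that show ?thesis by blast
qed

lemma savg_eq_ball:
  fixes f :: "'a::euclidean_space \<Rightarrow> real"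
  assumes "scont f"
  shows "savg f = (\<integral>x. indicator (ball 0 1) x * cone_ext f x \<partial>lborel) / measure lborel (ball 0 1 :: 'a set)"
proof -
  let ?V = "measure lborel (ball 0 1 :: 'a set)"
  have m: "(\<lambda>x. indicator (sphere 0 1) x *\<^sub>R f x) \<in> borel_measurable borel"
    by (rule borel_measurable_continuous_on_indicator[OF _ assms]) simp
  have "savg f = (\<integral>x. indicator (sphere 0 1) x *\<^sub>R f x
      \<partial>(distr (uniform_measure lborel (ball 0 1)) borel sgn))"
    unfolding sphere_measure_def by (rule integral_restrict_space) simp
  also have "\<dots> = (\<integral>x. cone_ext f x \<partial>(uniform_measure lborel (ball 0 1)))"
    using m by (subst integral_distr) (simp_all add: cone_ext_def[abs_def])
  also have "\<dots> = (\<integral>x. (indicator (ball 0 1) x / ?V) *\<^sub>R cone_ext f x \<partial>lborel)"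
    unfolding uniform_ball_eq
    by (subst integral_density)
       (auto intro!: measurable_cone_ext assms borel_measurable_divide borel_measurable_indicator)
  also have "\<dots> = (\<integral>x. indicator (ball 0 1) x * cone_ext f x / ?V \<partial>lborel)"
    by (intro Bochner_Integration.integral_cong) auto
  finally show ?thesis by simp
qed

lemma savg_const [simp]: "savg (\<lambda>_::'a::euclidean_space. c) = c"
proof -
  have m: "cone_ext (\<lambda>_::'a. c) \<in> borel_measurable borel"
    by (rule measurable_cone_ext) simp
  have "(\<integral>x. indicator (ball 0 1) x * cone_ext (\<lambda>_. c) x \<partial>(lborel :: 'a measure))
      = (\<integral>x. indicator (ball 0 1) x * c \<partial>(lborel :: 'a measure))"
  proof (rule integral_cong_AE)
    have "AE x in lborel. x \<noteq> (0::'a)" by (rule AE_lborel_singleton)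
    then show "AE x::'a in lborel. indicator (ball 0 1) x * cone_ext (\<lambda>_. c) x = indicator (ball 0 1) x * c"
      by eventually_elim (simp add: cone_ext_off_0)
  qed (auto intro!: m borel_measurable_times borel_measurable_indicator)
  also have "\<dots> = measure lborel (ball 0 1 :: 'a set) * c"
    by simp
  finally show ?thesis
    using unit_ball_measure_pos[where 'a='a] by (subst savg_eq_ball) auto
qed

lemma measure_sphere [simp]: "measure (sphere_measure :: 'a::euclidean_space measure) (sphere 0 1) = 1"
  using savg_const[of 1, where 'a='a] by simp

section \<open>Radial moments and integrals of derivatives\<close>

lemma scale_ball_integral:
  fixes H :: "'a::euclidean_space \<Rightarrow> real"
  assumes [measurable]: "H \<in> borel_measurable borel" and hom: "\<And>c x. c > 0 \<Longrightarrow> H (c *\<^sub>R x) = H x"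
    and s: "s > 0"
  shows "(\<integral>x. indicator (ball 0 s) x * H x \<partial>lborel) =
     s ^ DIM('a) * (\<integral>x. indicator (ball 0 1) x * H x \<partial>lborel)"
proof -
  have [measurable]: "(\<lambda>x. indicator (ball 0 s) x * H x) \<in> borel_measurable borel"
    by (intro borel_measurable_times borel_measurable_indicator assms) simp
  have "(lborel :: 'a measure) = density (distr lborel borel (\<lambda>x. 0 + s *\<^sub>R x)) (\<lambda>_. ennreal (\<bar>s\<bar> ^ DIM('a)))"
    using lborel_affine[of s "0::'a"] s by simp
  then have "(\<integral>x. indicator (ball 0 s) x * H x \<partial>lborel) =
     (\<integral>x. indicator (ball 0 s) x * H x \<partial>(density (distr lborel borel (\<lambda>x. 0 + s *\<^sub>R x)) (\<lambda>_. ennreal (\<bar>s\<bar> ^ DIM('a)))))"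
    by simp
  also have "\<dots> = (\<integral>x. \<bar>s\<bar> ^ DIM('a) *\<^sub>R (indicator (ball 0 s) x * H x) \<partial>(distr lborel borel (\<lambda>x. 0 + s *\<^sub>R x)))"
    by (subst integral_density) auto
  also have "\<dots> = (\<integral>x. \<bar>s\<bar> ^ DIM('a) *\<^sub>R (indicator (ball 0 s) (s *\<^sub>R x) * H (s *\<^sub>R x)) \<partial>lborel)"
    by (subst integral_distr) auto
  also have "\<dots> = (\<integral>x. s ^ DIM('a) * (indicator (ball 0 1) x * H x) \<partial>lborel)"
    using s hom by (intro Bochner_Integration.integral_cong) (auto simp: indicator_def)
  finally show ?thesis by simp
qed

lemma integrable_ball_bounded:
  fixes H :: "'a::euclidean_space \<Rightarrow> real"
  assumes [measurable]: "H \<in> borel_measurable borel" and B: "\<And>x. x \<in> ball 0 1 \<Longrightarrow> \<bar>H x\<bar> \<le> B"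
  shows "integrable lborel (\<lambda>x. indicator (ball 0 1) x * H x)"
  using integrableI_bounded_set_indicator[of "ball 0 1" lborel H B]
    emeasure_lborel_ball_finite[of "0::'a" 1] B by auto

text \<open>A substitute for polar coordinates. Write I for the integral of H over the unit ball and
  m for the dimension. Since 1 - |x|^(j+1) is the integral of (j + 1) s^j over s from |x| to 1,
  Fubini and the scaling law for \<open>ball 0 s\<close> turn the integral of (1 - |x|^(j+1)) H into
  (j + 1) / (m + j + 1) times I.\<close>

lemma ball_moment:
  fixes H :: "'a::euclidean_space \<Rightarrow> real"
  assumes [measurable]: "H \<in> borel_measurable borel" and hom: "\<And>c x. c > 0 \<Longrightarrow> H (c *\<^sub>R x) = H x"
    and B: "\<And>x. \<bar>H x\<bar> \<le> B"
  shows "(\<integral>x. indicator (ball 0 1) x * (norm x ^ Suc j * H x) \<partial>lborel) =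
     real DIM('a) / (real DIM('a) + real (Suc j)) * (\<integral>x. indicator (ball 0 1) x * H x \<partial>lborel)"
proof -
  let ?I = "\<integral>x. indicator (ball 0 1) x * H x \<partial>lborel"
  define G where "G s x = indicator {0<..1} s * (real (Suc j) * s ^ j) * (indicator (ball 0 s) x * H x)"
    for s :: real and x :: 'a
  have G_alt: "G s x = indicator {p \<in> {0<..1} \<times> ball 0 1. norm (snd p) < fst p} (s, x) * (real (Suc j) * s ^ j * H x)" for s x
    by (auto simp: G_def indicator_def)
  have [measurable]: "{p \<in> {0<..1::real} \<times> ball (0::'a) 1. norm (snd p) < fst p} \<in> sets (borel \<Otimes>\<^sub>M borel)"
  proof -
    have [measurable]: "{0<..1::real} \<times> ball (0::'a) 1 \<in> sets (borel \<Otimes>\<^sub>M borel)" by auto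
    have "{p \<in> {0<..1::real} \<times> ball (0::'a) 1. norm (snd p) < fst p} =
      ({0<..1::real} \<times> ball (0::'a) 1) \<inter> {p \<in> space (borel \<Otimes>\<^sub>M borel). norm (snd p) < fst p}"
      by (auto simp: space_pair_measure)
    also have "\<dots> \<in> sets (borel \<Otimes>\<^sub>M borel)" by measurable
    finally show ?thesis .
  qed
  have Gm [measurable]: "case_prod G \<in> borel_measurable (lborel \<Otimes>\<^sub>M lborel)"
  proof -
    have eq: "case_prod G = (\<lambda>p. indicator {p \<in> {0<..1} \<times> ball 0 1. norm (snd p) < fst p} p * (real (Suc j) * fst p ^ j * H (snd p)))"
      by (auto simp: fun_eq_iff G_alt)
    have "case_prod G \<in> borel_measurable (borel \<Otimes>\<^sub>M borel)"
      unfolding eq by measurable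
    moreover have "sets (borel \<Otimes>\<^sub>M borel) = sets ((lborel :: real measure) \<Otimes>\<^sub>M (lborel :: 'a measure))"
      by (intro sets_pair_measure_cong) auto
    ultimately show ?thesis
      by (metis measurable_cong_sets)
  qed
  have Gint: "integrable (lborel \<Otimes>\<^sub>M lborel) (case_prod G)"
  proof (rule Bochner_Integration.integrable_bound[of _ "\<lambda>p. indicator ({0<..1} \<times> ball 0 1) p * (real (Suc j) * B)"])
    have "emeasure (lborel \<Otimes>\<^sub>M lborel) ({0<..1::real} \<times> ball (0::'a) 1) < \<infinity>"
      using emeasure_lborel_ball_finite[of "0::'a" 1]
      by (subst lborel.emeasure_pair_measure_Times) (auto simp: ennreal_mult_less_top)
    moreover have "{0<..1::real} \<times> ball (0::'a) 1 \<in> sets (lborel \<Otimes>\<^sub>M lborel)"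
      by (intro pair_measureI) auto
    ultimately show "integrable (lborel \<Otimes>\<^sub>M lborel) (\<lambda>p. indicator ({0<..1::real} \<times> ball (0::'a) 1) p * (real (Suc j) * B))"
      by (intro integrable_mult_left integrable_real_indicator) (simp_all only: infinity_ennreal_def)
    have "\<bar>G s x\<bar> \<le> indicator ({0<..1} \<times> ball 0 1) (s, x) * (real (Suc j) * B)" for s x
    proof (cases "(s, x) \<in> {p \<in> {0<..1} \<times> ball 0 1. norm (snd p) < fst p}")
      case True
      then have "s ^ j \<le> 1" "0 \<le> s ^ j" by (auto intro: power_le_one)
      then have "s ^ j * \<bar>H x\<bar> \<le> 1 * B"
        using B[of x] by (intro mult_mono) auto
      then show ?thesis using True \<open>0 \<le> s ^ j\<close> by (auto simp: G_alt abs_mult mult.assoc)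
    next
      case False
      then have "G s x = 0" by (simp add: G_alt)
      moreover have "0 \<le> B" using B[of 0] by linarith
      ultimately show ?thesis by simp
    qed
    then show "AE p in lborel \<Otimes>\<^sub>M lborel. norm (case_prod G p) \<le> norm (indicator ({0<..1} \<times> ball 0 1) p * (real (Suc j) * B))"
      by (intro AE_I2) (auto intro: order_trans[OF _ abs_ge_self])
  qed simp
  have pw: "(\<integral>s. indicator {a..b} s * (real (Suc k) * s ^ k) \<partial>lborel) = b ^ Suc k - a ^ Suc k"
    if "a \<le> b" for a b :: real and k
  proof -
    have "((\<lambda>s. real (Suc k) * s ^ k) has_integral (b ^ Suc k - a ^ Suc k)) {a..b}"
      by (rule fundamental_theorem_of_calculus[OF that])
         (auto intro!: derivative_eq_intros simp: has_real_derivative_iff_has_vector_derivative[symmetric],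
          cases k, auto simp: algebra_simps)
    moreover have "set_integrable lborel {a..b} (\<lambda>s. real (Suc k) * s ^ k)"
      by (intro borel_integrable_atLeastAtMost' continuous_intros)
    ultimately have "(LBINT s:{a..b}. real (Suc k) * s ^ k) = b ^ Suc k - a ^ Suc k"
      using set_borel_integral_eq_integral(2) integral_unique by metis
    then show ?thesis by (simp only: set_lebesgue_integral_def real_scaleR_def)
  qed
  have sing: "AE s in lborel. s \<noteq> (a::real)" for a by (rule AE_lborel_singleton)
  have "(\<integral>s. (\<integral>x. G s x \<partial>lborel) \<partial>lborel) =
     (\<integral>s. (real (Suc j) / real (DIM('a) + Suc j) * ?I) * (indicator {0..1} s * (real (Suc (DIM('a) + j)) * s ^ (DIM('a) + j))) \<partial>lborel)"
  proof (rule integral_cong_AE)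
    have *: "(\<integral>x. G s x \<partial>lborel) = indicator {0<..1} s * (real (Suc j) * s ^ j) * (s ^ DIM('a) * ?I)" for s
      unfolding G_def using scale_ball_integral[OF assms(1) hom, of s]
      by (cases "s > 0") (auto simp: indicator_def)
    show "AE s in lborel. (\<integral>x. G s x \<partial>lborel) = (real (Suc j) / real (DIM('a) + Suc j) * ?I) * (indicator {0..1} s * (real (Suc (DIM('a) + j)) * s ^ (DIM('a) + j)))"
      using sing[of 0]
    proof eventually_elim
      case (elim s)
      show ?case
        unfolding * using elim by (auto simp: indicator_def power_add field_simps)
    qed
  qed (measurable)
  also have "\<dots> = real (Suc j) / real (DIM('a) + Suc j) * ?I"
    using pw[of 0 1 "DIM('a) + j"] by (subst integral_mult_right_zero) (simp only: zero_le_one, simp)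
  finally have 1: "(\<integral>s. (\<integral>x. G s x \<partial>lborel) \<partial>lborel) = real (Suc j) / real (DIM('a) + Suc j) * ?I" .
  have 2: "(\<integral>s. G s x \<partial>lborel) = indicator (ball 0 1) x * (1 - norm x ^ Suc j) * H x" for x :: 'a
  proof -
    have "(\<integral>s. G s x \<partial>lborel) = (\<integral>s. indicator (ball 0 1) x * H x * (indicator {norm x..1} s * (real (Suc j) * s ^ j)) \<partial>lborel)"
    proof (rule integral_cong_AE)
      show "AE s in lborel. G s x = indicator (ball 0 1) x * H x * (indicator {norm x..1} s * (real (Suc j) * s ^ j))"
        using sing[of "norm x"]
      proof eventually_elim
        case (elim s)
        then have "norm x \<le> s \<Longrightarrow> 0 < s" using norm_ge_zero[of x] by linarith
        then show ?case using elim by (auto simp: G_def indicator_def)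
      qed
    next
      show "(\<lambda>s. G s x) \<in> borel_measurable lborel"
        using measurable_compose[OF measurable_Pair2'[of x lborel lborel] Gm] by simp
    qed auto
    also have "\<dots> = indicator (ball 0 1) x * H x * (1 - norm x ^ Suc j)"
      using pw[of "norm x" 1 j] by (cases "norm x \<le> 1") auto
    finally show ?thesis by simp
  qed
  have "(\<integral>s. (\<integral>x. G s x \<partial>lborel) \<partial>lborel) = (\<integral>x. (\<integral>s. G s x \<partial>lborel) \<partial>lborel)"
    using lborel_pair.Fubini_integral[OF Gint] by simp
  also have "\<dots> = (\<integral>x. indicator (ball 0 1) x * H x - indicator (ball 0 1) x * (norm x ^ Suc j * H x) \<partial>lborel)"
    unfolding 2 by (intro Bochner_Integration.integral_cong) (auto simp: algebra_simps)
  also have "\<dots> = ?I - (\<integral>x. indicator (ball 0 1) x * (norm x ^ Suc j * H x) \<partial>lborel)"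
  proof (rule Bochner_Integration.integral_diff)
    show "integrable lborel (\<lambda>x. indicator (ball 0 1) x * H x)"
      by (rule integrable_ball_bounded[of _ B]) (use B in auto)
    have "norm x ^ Suc j * \<bar>H x\<bar> \<le> 1 * B" if "x \<in> ball 0 1" for x
      using that B by (intro mult_mono power_le_one) auto
    then show "integrable lborel (\<lambda>x. indicator (ball 0 1) x * (norm x ^ Suc j * H x))"
      by (intro integrable_ball_bounded[of _ B]) (auto simp: abs_mult)
  qed
  finally show ?thesis
    unfolding 1 by (simp add: field_simps)
qed

lemma integral_translation_diff:
  fixes \<phi> :: "'a::euclidean_space \<Rightarrow> real"
  assumes int: "integrable lborel \<phi>"
  shows "integrable lborel (\<lambda>x. \<phi> (x + v))" "(\<integral>x. \<phi> (x + v) \<partial>lborel) = (\<integral>x. \<phi> x \<partial>lborel)"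
proof -
  have m: "\<phi> \<in> borel_measurable borel" using borel_measurable_integrable[OF int] by simp
  have d: "distr lborel borel ((+) v) = lborel"
    using lborel_affine[of 1 v] by (simp add: density_1)
  show "integrable lborel (\<lambda>x. \<phi> (x + v))"
    using int m d integrable_distr_eq[of "(+) v" lborel borel \<phi>] by (simp add: add.commute)
  show "(\<integral>x. \<phi> (x + v) \<partial>lborel) = (\<integral>x. \<phi> x \<partial>lborel)"
    using m d integral_distr[of "(+) v" lborel borel \<phi>] by (simp add: add.commute)
qed

text \<open>Difference quotients of an integrable function integrate to zero by translation
  invariance. The mean value theorem bounds them by K, and dominated convergence passes to the
  derivative, which is measurable as a pointwise limit of the quotients.\<close>

lemma integral_directional_derivative_eq_0:
  fixes \<phi> D :: "'a::euclidean_space \<Rightarrow> real"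
  assumes der: "\<And>x. \<exists>L. (\<phi> has_derivative L) (at x) \<and> L v = D x"
    and bd: "\<And>x. \<bar>D x\<bar> \<le> K"
    and supp: "\<And>x. norm x \<ge> 1 \<Longrightarrow> \<phi> x = 0"
    and v: "norm v \<le> 1"
  shows "(\<integral>x. D x \<partial>lborel) = 0"
proof -
  have cont: "continuous_on UNIV \<phi>"
    using der has_derivative_continuous by (force simp: continuous_on_eq_continuous_within)
  have m [measurable]: "\<phi> \<in> borel_measurable borel"
    using cont by (rule borel_measurable_continuous_onI)
  have "compact (\<phi> ` cball 0 1)"
    using cont by (intro compact_continuous_image) (auto intro: continuous_on_subset)
  then obtain C where C: "\<forall>x\<in>cball 0 1. \<bar>\<phi> x\<bar> \<le> C"
    by (auto dest!: compact_imp_bounded simp: bounded_iff)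
  have int: "integrable lborel \<phi>"
  proof (rule Bochner_Integration.integrable_bound[of _ "\<lambda>x. indicator (cball 0 1) x * C"])
    show "integrable lborel (\<lambda>x::'a. indicator (cball 0 1) x * C)"
      using emeasure_lborel_cball_finite[of "0::'a" 1]
      by (intro integrable_mult_left integrable_real_indicator) auto
    show "AE x in lborel. norm (\<phi> x) \<le> norm (indicator (cball 0 1) x * C)"
      using C supp by (intro AE_I2) (force simp: indicator_def)
  qed simp
  have K0: "0 \<le> K" using bd[of 0] by linarith
  have dirder: "((\<lambda>t. \<phi> (x + t *\<^sub>R v)) has_real_derivative D (x + s *\<^sub>R v)) (at s)" for x s
  proof -
    obtain L where L: "(\<phi> has_derivative L) (at (x + s *\<^sub>R v))" "L v = D (x + s *\<^sub>R v)"
      using der by blast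
    then have lin: "linear L" using has_derivative_linear by blast
    have "((\<lambda>t. \<phi> (x + t *\<^sub>R v)) has_derivative (\<lambda>t. L (t *\<^sub>R v))) (at s)"
      by (rule has_derivative_compose[where f = "\<lambda>t. x + t *\<^sub>R v" and f' = "\<lambda>t. t *\<^sub>R v" and x = s
          and g = \<phi>, OF _ L(1)]) (auto intro!: derivative_eq_intros)
    then show ?thesis
      by (simp add: has_field_derivative_def linear_cmul[OF lin] L(2) mult_commute_abs)
  qed
  define q where "q i x = (\<phi> (x + (1 / real (Suc i)) *\<^sub>R v) - \<phi> x) * real (Suc i)" for i x
  have q0: "(\<integral>x. q i x \<partial>lborel) = 0" for i
    unfolding q_def using integral_translation_diff[OF int] int by simp
  have lip: "\<bar>\<phi> (x + t *\<^sub>R v) - \<phi> x\<bar> \<le> t * K" if "t > 0" for x t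
  proof -
    have "\<exists>z>0. z < t \<and> \<phi> (x + t *\<^sub>R v) - \<phi> (x + 0 *\<^sub>R v) = (t - 0) * D (x + z *\<^sub>R v)"
      by (rule MVT2[OF that, of "\<lambda>t. \<phi> (x + t *\<^sub>R v)"]) (rule dirder)
    then obtain z where "\<phi> (x + t *\<^sub>R v) - \<phi> x = t * D (x + z *\<^sub>R v)" by auto
    then show ?thesis using bd that by (simp add: abs_mult)
  qed
  have qlim: "(\<lambda>i. q i x) \<longlonglongrightarrow> D x" for x
  proof -
    have "((\<lambda>h. (\<phi> (x + (0 + h) *\<^sub>R v) - \<phi> (x + 0 *\<^sub>R v)) / h) \<longlongrightarrow> D (x + 0 *\<^sub>R v)) (at 0)"
      using dirder[of x 0] unfolding DERIV_def .
    moreover have "filterlim (\<lambda>i. 1 / real (Suc i)) (at 0) sequentially"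
      by (intro filterlim_atI LIMSEQ_Suc lim_1_over_n) auto
    ultimately have "((\<lambda>i. (\<phi> (x + (0 + 1 / real (Suc i)) *\<^sub>R v) - \<phi> (x + 0 *\<^sub>R v)) / (1 / real (Suc i))) \<longlongrightarrow> D (x + 0 *\<^sub>R v)) sequentially"
      by (rule filterlim_compose)
    then show ?thesis by (simp add: q_def)
  qed
  have Dm: "D \<in> borel_measurable lborel"
    by (rule borel_measurable_LIMSEQ_real[OF qlim]) (auto simp: q_def)
  have "(\<lambda>i. \<integral>x. q i x \<partial>lborel) \<longlonglongrightarrow> (\<integral>x. D x \<partial>lborel)"
  \<comment> \<open>Radius 2: \<open>\<phi>\<close> vanishes outside the unit ball and the shifts
    have length at most 1.\<close>
  proof (rule integral_dominated_convergence[where w = "\<lambda>x. indicator (cball 0 2) x * K"])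
    show "integrable lborel (\<lambda>x::'a. indicator (cball 0 2) x * K)"
      using emeasure_lborel_cball_finite[of "0::'a" 2]
      by (intro integrable_mult_left integrable_real_indicator) auto
    have "\<bar>q i x\<bar> \<le> indicator (cball 0 2) x * K" for i x
    proof (cases "norm x \<le> 2")
      case True
      have "\<bar>q i x\<bar> \<le> (1 / real (Suc i) * K) * real (Suc i)"
        unfolding q_def abs_mult by (intro mult_mono lip) (auto simp: K0)
      then show ?thesis using True by simp
    next
      case False
      have "norm ((1 / real (Suc i)) *\<^sub>R v) \<le> 1"
        using v mult_mono[of "1 / real (Suc i)" 1 "norm v" 1] by simp
      then have "norm (x + (1 / real (Suc i)) *\<^sub>R v) \<ge> 1"
        using False norm_triangle_ineq2[of x "- ((1 / real (Suc i)) *\<^sub>R v)"]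
        by (simp only: norm_minus_cancel diff_minus_eq_add)
      then show ?thesis using False supp by (simp add: q_def)
    qed
    then show "AE x in lborel. norm (q i x) \<le> indicator (cball 0 2) x * K" for i
      by simp
    show "q i \<in> borel_measurable lborel" for i unfolding q_def[abs_def] by measurable
  qed (use qlim Dm in auto)
  then show ?thesis by (simp add: q0 LIMSEQ_const_iff)
qed

text \<open>For the origin and the unit sphere, where the double zeros of the cutoff make the
  function vanish quadratically although its angular factor is merely bounded.\<close>

lemma has_derivative_zero_quadratic:
  fixes f :: "'a::euclidean_space \<Rightarrow> real"
  assumes "\<And>y. \<bar>f y - f x\<bar> \<le> C * norm (y - x) ^ 2"
  shows "(f has_derivative (\<lambda>_. 0)) (at x)"
proof (rule has_derivativeI_sandwich[of 1 _ _ _ _ "\<lambda>y. C * norm (y - x)"])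
  show "((\<lambda>y. C * norm (y - x)) \<longlongrightarrow> 0) (at x)"
    by (auto intro!: tendsto_eq_intros)
  show "norm (f y - f x - 0) / norm (y - x) \<le> C * norm (y - x)" if "y \<noteq> x" for y
    using assms[of y] that by (simp add: divide_simps power2_eq_square mult.assoc)
qed auto

text \<open>The divergence theorem on the sphere, obtained from translation invariance of Lebesgue measure:
  the derivative of \<open>w(norm x) * f (sgn x)\<close> with \<open>w r = r\<^sup>2 (1 - r)\<^sup>2\<close> integrates to zero over the unit ball,
  where \<open>w\<close> is chosen to make this function differentiable at the origin and across the boundary.
  The radial factors are then removed by \<open>ball_moment\<close>.\<close>

theorem savg_tderiv:
  fixes f :: "'a::euclidean_space \<Rightarrow> real"
  assumes f: "smooth_on_sphere f" and b: "b \<in> Basis"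
  shows "savg (tderiv b f) = (real DIM('a) - 1) * savg (\<lambda>x. (x \<bullet> b) * f x)"
proof -
  let ?m = "real DIM('a)" and ?B = "ball 0 1 :: 'a set"
  define P where "P = cone_ext (\<lambda>x. (x \<bullet> b) * f x)"
  define Q where "Q = cone_ext (tderiv b f)"
  have cP: "scont (\<lambda>x. (x \<bullet> b) * f x)" and cQ: "scont (tderiv b f)"
    using f b by (auto intro!: continuous_on_smooth smooth_on_sphere_mult smooth_on_sphere_inner smooth_on_sphere_tderiv)
  have [measurable]: "P \<in> borel_measurable borel" "Q \<in> borel_measurable borel"
    unfolding P_def Q_def by (intro measurable_cone_ext cP cQ)+
  obtain BP where BP: "\<And>x. \<bar>P x\<bar> \<le> BP" using cone_ext_bounded[OF cP] unfolding P_def by metis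
  obtain BQ where BQ: "\<And>x. \<bar>Q x\<bar> \<le> BQ" using cone_ext_bounded[OF cQ] unfolding Q_def by metis
  obtain C where C: "C > 0" "\<And>x. \<bar>cone_ext f x\<bar> \<le> C"
    using cone_ext_bounded[OF continuous_on_smooth[OF f]] by metis
  define w where "w r = r ^ 2 * (1 - r) ^ 2" for r :: real
  define \<phi> where "\<phi> x = (if norm x < 1 then w (norm x) * cone_ext f x else 0)" for x :: 'a
  \<comment> \<open>The product rule in direction b gives w'(r) (x . b) f + (w(r) / r)
    \<open>tderiv b f\<close>, taken at \<open>sgn x\<close> with r = \<open>norm x\<close>; the two
    polynomials are w' and w / r.\<close>
  define D where "D x = indicator ?B x * ((2 * norm x - 6 * norm x ^ 2 + 4 * norm x ^ 3) * P x
      + (norm x - 2 * norm x ^ 2 + norm x ^ 3) * Q x)" for x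
  have "(\<integral>x. D x \<partial>lborel) = 0"
  \<comment> \<open>2 + 6 + 4 = 12 and 1 + 2 + 1 = 4 bound the two polynomials for r at most
    1.\<close>
  proof (rule integral_directional_derivative_eq_0[of \<phi> b D "12 * BP + 4 * BQ"])
    show "\<exists>L. (\<phi> has_derivative L) (at x) \<and> L b = D x" for x
    proof -
      consider "x = 0" | "norm x = 1" | "norm x > 1" | "x \<noteq> 0" "norm x < 1" by fastforce
      then show ?thesis
      proof cases
        case 1
        have "\<bar>\<phi> y - \<phi> x\<bar> \<le> C * norm (y - x) ^ 2" for y
        proof (cases "norm y < 1")
          case True
          have "norm y ^ 2 * (1 - norm y) ^ 2 * \<bar>cone_ext f y\<bar> \<le> norm y ^ 2 * 1 * C"
            using True C by (intro mult_mono power_le_one) auto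
          then show ?thesis using True 1 by (simp add: \<phi>_def w_def abs_mult mult.commute)
        qed (use 1 C in \<open>auto simp: \<phi>_def w_def\<close>)
        then have "(\<phi> has_derivative (\<lambda>_. 0)) (at x)" by (rule has_derivative_zero_quadratic)
        then show ?thesis
          using 1 by (intro exI[of _ "\<lambda>_. 0"]) (auto simp: D_def)
      next
        case 2
        have "\<bar>\<phi> y - \<phi> x\<bar> \<le> C * norm (y - x) ^ 2" for y
        proof (cases "norm y < 1")
          case True
          have "1 - norm y \<le> norm (y - x)" using 2 norm_triangle_ineq3[of x y] by (simp add: norm_minus_commute)
          then have "norm y ^ 2 * (1 - norm y) ^ 2 * \<bar>cone_ext f y\<bar> \<le> 1 * norm (y - x) ^ 2 * C"
            using True C by (intro mult_mono power_le_one power_mono) auto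
          then show ?thesis using True 2 by (simp add: \<phi>_def w_def abs_mult mult.commute)
        qed (use 2 C in \<open>auto simp: \<phi>_def w_def\<close>)
        then have "(\<phi> has_derivative (\<lambda>_. 0)) (at x)" by (rule has_derivative_zero_quadratic)
        then show ?thesis
          using 2 by (intro exI[of _ "\<lambda>_. 0"]) (auto simp: D_def)
      next
        case 3
        have "open {y::'a. norm y > 1}" by (intro open_Collect_less continuous_intros)
        then have "(\<phi> has_derivative (\<lambda>_. 0)) (at x)"
          using 3 by (intro has_derivative_transform_within_open[OF has_derivative_const, of "{y. norm y > 1}" x 0])
            (auto simp: \<phi>_def)
        then show ?thesis using 3 by (intro exI[of _ "\<lambda>_. 0"]) (auto simp: D_def)
      next
        case 4
        let ?f = "\<lambda>x. f (sgn x)"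
        have "(w has_real_derivative (2 * norm x - 6 * norm x ^ 2 + 4 * norm x ^ 3)) (at (norm x))"
          unfolding w_def[abs_def]
          by (auto intro!: derivative_eq_intros) (simp add: algebra_simps power2_eq_square power3_eq_cube)
        then have dw: "(w has_derivative (\<lambda>h. h * (2 * norm x - 6 * norm x ^ 2 + 4 * norm x ^ 3))) (at (norm x))"
          by (simp add: has_field_derivative_def mult_commute_abs)
        have "((\<lambda>y. w (norm y)) has_derivative (\<lambda>h. (h \<bullet> sgn x) * (2 * norm x - 6 * norm x ^ 2 + 4 * norm x ^ 3))) (at x)"
          by (rule has_derivative_compose[where g = w, OF has_derivative_norm[OF 4(1)] dw])
        from has_derivative_mult[OF this has_derivative_pderiv_dir_works[OF ext_differentiable[OF f 4(1)]]]
        have d: "((\<lambda>y. w (norm y) * ?f y) has_derivative (\<lambda>h. w (norm x) * pderiv_dir h ?f x +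
          (h \<bullet> sgn x) * (2 * norm x - 6 * norm x ^ 2 + 4 * norm x ^ 3) * ?f x)) (at x)" .
        have "open {y::'a. norm y < 1 \<and> y \<noteq> 0}"
          by (intro open_Collect_conj open_Collect_less open_Collect_neq continuous_intros)
        then have "(\<phi> has_derivative (\<lambda>h. w (norm x) * pderiv_dir h ?f x +
          (h \<bullet> sgn x) * (2 * norm x - 6 * norm x ^ 2 + 4 * norm x ^ 3) * ?f x)) (at x)"
          using 4 by (intro has_derivative_transform_within_open[OF d, of "{y. norm y < 1 \<and> y \<noteq> 0}"])
            (auto simp: \<phi>_def cone_ext_off_0)
        moreover have "w (norm x) * pderiv_dir b ?f x +
          (b \<bullet> sgn x) * (2 * norm x - 6 * norm x ^ 2 + 4 * norm x ^ 3) * ?f x = D x"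
          using 4 unfolding D_def P_def Q_def cone_ext_off_0[OF 4(1)] tderiv_sgn[OF f 4(1)]
          by (simp add: w_def inner_commute algebra_simps power2_eq_square power3_eq_cube)
        ultimately show ?thesis by blast
      qed
    qed
    show "\<bar>D x\<bar> \<le> 12 * BP + 4 * BQ" for x
    proof (cases "norm x < 1")
      case True
      define r where "r = norm x"
      have r: "0 \<le> r" "r \<le> 1" using True by (auto simp: r_def)
      have r2: "0 \<le> r ^ 2" "r ^ 2 \<le> 1" "0 \<le> r ^ 3" "r ^ 3 \<le> 1" using r by (auto intro: power_le_one)
      have "\<bar>2 * r - 6 * r ^ 2 + 4 * r ^ 3\<bar> \<le> 12" "\<bar>r - 2 * r ^ 2 + r ^ 3\<bar> \<le> 4"
        using r r2 by linarith+
      then have "\<bar>(2 * r - 6 * r ^ 2 + 4 * r ^ 3) * P x\<bar> \<le> 12 * BP" "\<bar>(r - 2 * r ^ 2 + r ^ 3) * Q x\<bar> \<le> 4 * BQ"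
        unfolding abs_mult using BP BQ by (auto intro!: mult_mono)
      then show ?thesis using True unfolding D_def r_def by simp
    next
      case False
      have "0 \<le> BP" "0 \<le> BQ" using BP[of 0] BQ[of 0] by linarith+
      then show ?thesis using False by (simp add: D_def)
    qed
  qed (use b in \<open>auto simp: \<phi>_def\<close>)
  define IP where "IP = (\<integral>x. indicator ?B x * P x \<partial>lborel)"
  define IQ where "IQ = (\<integral>x. indicator ?B x * Q x \<partial>lborel)"
  have mom: "(\<integral>x. indicator ?B x * (norm x ^ Suc j * P x) \<partial>lborel) = ?m / (?m + Suc j) * IP"
            "(\<integral>x. indicator ?B x * (norm x ^ Suc j * Q x) \<partial>lborel) = ?m / (?m + Suc j) * IQ" for j
    unfolding IP_def IQ_def
    by - (rule ball_moment; (rule BP BQ)?; simp add: P_def Q_def cone_ext_scale measurable_cone_ext cP cQ)+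
  have int: "integrable lborel (\<lambda>x. indicator ?B x * (norm x ^ j * P x))"
            "integrable lborel (\<lambda>x. indicator ?B x * (norm x ^ j * Q x))" for j
  proof -
    have "norm x ^ j * \<bar>P x\<bar> \<le> 1 * BP" "norm x ^ j * \<bar>Q x\<bar> \<le> 1 * BQ" if "x \<in> ?B" for x
      using that mult_mono[OF power_le_one[of "norm x" j] BP[of x]]
        mult_mono[OF power_le_one[of "norm x" j] BQ[of x]] by auto
    then show "integrable lborel (\<lambda>x. indicator ?B x * (norm x ^ j * P x))"
              "integrable lborel (\<lambda>x. indicator ?B x * (norm x ^ j * Q x))"
      by (intro integrable_ball_bounded[of _ BP] integrable_ball_bounded[of _ BQ]; simp add: abs_mult)+
  qed
  let ?P = "\<lambda>j x. indicator ?B x * (norm x ^ j * P x)" and ?Q = "\<lambda>j x. indicator ?B x * (norm x ^ j * Q x)"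
  have "D = (\<lambda>x. 2 * ?P (Suc 0) x - 6 * ?P (Suc 1) x + 4 * ?P (Suc 2) x + ?Q (Suc 0) x - 2 * ?Q (Suc 1) x + ?Q (Suc 2) x)"
    by (auto simp: fun_eq_iff D_def algebra_simps power2_eq_square power3_eq_cube)
  then have "(\<integral>x. D x \<partial>lborel) = 2 * (?m / (?m + 1) * IP) - 6 * (?m / (?m + 2) * IP) + 4 * (?m / (?m + 3) * IP)
     + ?m / (?m + 1) * IQ - 2 * (?m / (?m + 2) * IQ) + ?m / (?m + 3) * IQ"
    using mom[of 0] mom[of 1] mom[of 2] int[of "Suc 0"] int[of "Suc 1"] int[of "Suc 2"]
    by (simp only: Bochner_Integration.integral_add Bochner_Integration.integral_diff integral_mult_right_zero
        Bochner_Integration.integrable_add Bochner_Integration.integrable_diff integrable_mult_right) simp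
  moreover have "?m > 0" by simp
  \<comment> \<open>In polar coordinates, the integral of w' r^(m-1) is -(m - 1) times that of (w /
    r) r^(m-1), by parts; this is the source of the factor m - 1.\<close>
  moreover have "2 * (m / (m + 1) * a) - 6 * (m / (m + 2) * a) + 4 * (m / (m + 3) * a)
     + m / (m + 1) * c - 2 * (m / (m + 2) * c) + m / (m + 3) * c
     = 2 * m * (c - (m - 1) * a) / ((m + 1) * (m + 2) * (m + 3))" if "m > 0" for m a c :: real
  proof -
    have "m + 1 \<noteq> 0" "m + 2 \<noteq> 0" "m + 3 \<noteq> 0" using that by auto
    then show ?thesis by (simp add: divide_simps) algebra
  qed
  ultimately have "2 * ?m * (IQ - (?m - 1) * IP) / ((?m + 1) * (?m + 2) * (?m + 3)) = 0"
    using \<open>(\<integral>x. D x \<partial>lborel) = 0\<close> by metis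
  then have "IQ = (?m - 1) * IP" by (auto simp: add_nonneg_eq_0_iff)
  then show ?thesis
    unfolding savg_eq_ball[OF cP] savg_eq_ball[OF cQ] using IP_def IQ_def P_def Q_def by simp
qed

section \<open>Spherical harmonics\<close>

lemma savg_tderiv_parts:
  fixes f g :: "'a::euclidean_space \<Rightarrow> real"
  assumes f: "smooth_on_sphere f" and g: "smooth_on_sphere g" and b: "b \<in> Basis"
  shows "savg (\<lambda>x. tderiv b f x * g x) =
    (real DIM('a) - 1) * savg (\<lambda>x. (x \<bullet> b) * (f x * g x)) - savg (\<lambda>x. f x * tderiv b g x)"
proof -
  have "savg (tderiv b (\<lambda>x. f x * g x)) = savg (\<lambda>x. tderiv b f x * g x + f x * tderiv b g x)"
    using f g by (intro savg_cong) (simp add: tderiv_mult)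
  also have "\<dots> = savg (\<lambda>x. tderiv b f x * g x) + savg (\<lambda>x. f x * tderiv b g x)"
    using f g b by (intro savg_add continuous_on_smooth smooth_on_sphere_mult smooth_on_sphere_tderiv)
  finally show ?thesis
    using savg_tderiv[OF smooth_on_sphere_mult[OF f g] b] by simp
qed

text \<open>Green's formula. For each b the divergence theorem adds a multiple of (x . b) times
  \<open>tderiv b f x * g x\<close>; these terms sum to the radial derivative of f times g, which is
  zero.\<close>

lemma savg_laplace_beltrami:
  fixes f g :: "'a::euclidean_space \<Rightarrow> real"
  assumes f: "smooth_on_sphere f" and g: "smooth_on_sphere g"
  shows "savg (\<lambda>x. laplace_beltrami f x * g x) = - (\<Sum>b\<in>Basis. savg (\<lambda>x. tderiv b f x * tderiv b g x))"
proof -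
  have *: "scont (\<lambda>x. (x \<bullet> b) * (tderiv b f x * g x))" if "b \<in> Basis" for b :: 'a
    using f g that by (intro continuous_on_smooth smooth_on_sphere_mult smooth_on_sphere_inner smooth_on_sphere_tderiv)
  have "savg (\<lambda>x. laplace_beltrami f x * g x) = savg (\<lambda>x. \<Sum>b\<in>Basis. tderiv b (tderiv b f) x * g x)"
    by (intro savg_cong) (simp add: laplace_beltrami_eq f sum_distrib_right)
  also have "\<dots> = (\<Sum>b\<in>Basis. savg (\<lambda>x. tderiv b (tderiv b f) x * g x))"
    using f g by (intro savg_sum continuous_on_smooth smooth_on_sphere_mult smooth_on_sphere_tderiv)
  also have "\<dots> = (\<Sum>b\<in>Basis. (real DIM('a) - 1) * savg (\<lambda>x. (x \<bullet> b) * (tderiv b f x * g x)) - savg (\<lambda>x. tderiv b f x * tderiv b g x))"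
    using f g by (intro sum.cong savg_tderiv_parts smooth_on_sphere_tderiv refl)
  also have "\<dots> = (real DIM('a) - 1) * (\<Sum>b\<in>Basis. savg (\<lambda>x. (x \<bullet> b) * (tderiv b f x * g x)))
      - (\<Sum>b\<in>Basis. savg (\<lambda>x. tderiv b f x * tderiv b g x))"
    by (simp add: sum_subtractf sum_distrib_left)
  also have "(\<Sum>b\<in>Basis. savg (\<lambda>x. (x \<bullet> b) * (tderiv b f x * g x))) = savg (\<lambda>x. \<Sum>b\<in>Basis. (x \<bullet> b) * (tderiv b f x * g x))"
    using * by (intro savg_sum[symmetric])
  also have "\<dots> = savg (\<lambda>x::'a. 0)"
    using tderiv_radial[OF f] by (intro savg_cong) (simp add: mult.assoc[symmetric] sum_distrib_right[symmetric])
  finally show ?thesis by simp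
qed

lemma laplace_beltrami_self_adjoint:
  assumes "smooth_on_sphere f" "smooth_on_sphere g"
  shows "savg (\<lambda>x. laplace_beltrami f x * g x) = savg (\<lambda>x. f x * laplace_beltrami g x)"
  using savg_laplace_beltrami[OF assms] savg_laplace_beltrami[OF assms(2,1)] by (simp add: mult.commute)

section \<open>Homogeneous harmonic polynomials as eigenfunctions\<close>

lemma polynomial_differentiable:
  fixes p :: "'a::euclidean_space \<Rightarrow> real"
  shows "real_polynomial_function p \<Longrightarrow> p differentiable (at x)"
  by (induction rule: real_polynomial_function.induct)
     (auto intro: differentiable_add differentiable_mult bounded_linear_imp_differentiable)

lemma polynomial_pderiv_dir:
  fixes p :: "'a::euclidean_space \<Rightarrow> real"
  shows "real_polynomial_function p \<Longrightarrow> real_polynomial_function (pderiv_dir b p)"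
proof (induction rule: real_polynomial_function.induct)
  case (linear f)
  then have "pderiv_dir b f = (\<lambda>x. f b)" by (simp add: fun_eq_iff pderiv_dir_bounded_linear)
  then show ?case by auto
next
  case (const c)
  have "pderiv_dir b (\<lambda>x. c) = (\<lambda>x. 0)" by (simp add: fun_eq_iff)
  then show ?case by auto
next
  case (add f g)
  then have "pderiv_dir b (\<lambda>x. f x + g x) = (\<lambda>x. pderiv_dir b f x + pderiv_dir b g x)"
    by (simp add: fun_eq_iff pderiv_dir_add polynomial_differentiable)
  then show ?case using add by auto
next
  case (mult f g)
  then have "pderiv_dir b (\<lambda>x. f x * g x) = (\<lambda>x. f x * pderiv_dir b g x + pderiv_dir b f x * g x)"
    by (simp add: fun_eq_iff pderiv_dir_mult polynomial_differentiable)
  then show ?case using mult by auto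
qed

lemma laplacian_pderiv_dir: "laplacian f x = (\<Sum>b\<in>Basis. pderiv_dir b (pderiv_dir b f) x)"
  by (simp add: laplacian_def pderiv_dir_def[abs_def])

lemma euler_homogeneous:
  fixes Y :: "'a::euclidean_space \<Rightarrow> real"
  assumes "real_polynomial_function Y" "\<And>c x. Y (c *\<^sub>R x) = c ^ k * Y x"
  shows "(\<Sum>b\<in>Basis. (x \<bullet> b) * pderiv_dir b Y x) = real k * Y x"
proof -
  have D: "(Y has_derivative (\<lambda>h. \<Sum>b\<in>Basis. (h \<bullet> b) * pderiv_dir b Y x)) (at (1 *\<^sub>R x))"
    using has_derivative_pderiv_dir[OF polynomial_differentiable[OF assms(1)]] by simp
  have "((\<lambda>t. Y (t *\<^sub>R x)) has_derivative (\<lambda>t. \<Sum>b\<in>Basis. (t *\<^sub>R x \<bullet> b) * pderiv_dir b Y x)) (at 1)"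
    by (rule has_derivative_compose[where f = "\<lambda>t. t *\<^sub>R x" and f' = "\<lambda>t. t *\<^sub>R x" and x = 1
          and g = Y, OF _ D]) (auto intro!: derivative_eq_intros)
  moreover have "((\<lambda>t. Y (t *\<^sub>R x)) has_derivative (\<lambda>t. t * (real k * Y x))) (at 1)"
    unfolding assms(2) by (auto intro!: derivative_eq_intros)
  ultimately have "(\<lambda>t. \<Sum>b\<in>Basis. (t *\<^sub>R x \<bullet> b) * pderiv_dir b Y x) = (\<lambda>t. t * (real k * Y x))"
    by (rule has_derivative_unique)
  from fun_cong[OF this, of 1] show ?thesis by simp
qed

text \<open>The factor c stays on the left, so that k = 0 calls for no exponent k - 1 and c = 0 for
  no exception.\<close>

lemma homogeneous_pderiv_dir:
  fixes Y :: "'a::euclidean_space \<Rightarrow> real"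
  assumes "real_polynomial_function Y" "\<And>c x. Y (c *\<^sub>R x) = c ^ k * Y x"
  shows "c * pderiv_dir b Y (c *\<^sub>R x) = c ^ k * pderiv_dir b Y x"
proof -
  have D: "(Y has_derivative (\<lambda>h. pderiv_dir h Y (c *\<^sub>R x))) (at (c *\<^sub>R x))"
    by (rule has_derivative_pderiv_dir_works[OF polynomial_differentiable[OF assms(1)]])
  have "((\<lambda>y. Y (c *\<^sub>R y)) has_derivative (\<lambda>b. pderiv_dir (c *\<^sub>R b) Y (c *\<^sub>R x))) (at x)"
    by (rule has_derivative_compose[where f = "\<lambda>y. c *\<^sub>R y" and f' = "\<lambda>y. c *\<^sub>R y" and x = x
          and g = Y, OF _ D]) (auto intro!: derivative_eq_intros)
  then have "pderiv_dir b (\<lambda>y. Y (c *\<^sub>R y)) x = pderiv_dir (c *\<^sub>R b) Y (c *\<^sub>R x)" by (rule pderiv_dir_eqI)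
  moreover have "pderiv_dir (c *\<^sub>R b) Y (c *\<^sub>R x) = c * pderiv_dir b Y (c *\<^sub>R x)"
    using linear_cmul[OF linear_frechet_derivative[OF polynomial_differentiable[OF assms(1)]]]
    by (simp add: pderiv_dir_def)
  moreover have "pderiv_dir b (\<lambda>y. Y (c *\<^sub>R y)) x = c ^ k * pderiv_dir b Y x"
    unfolding assms(2) by (rule pderiv_dir_cmult) (rule polynomial_differentiable[OF assms(1)])
  ultimately show ?thesis by simp
qed

text \<open>Differentiate Y y = |y|^k Y (sgn y); the radial factor gives k (x . b) Y. Homogeneity is
  asked for c > 0 only, because for the derivatives of Y it is obtained by dividing by c.\<close>

lemma tderiv_homogeneous:
  fixes Y :: "'a::euclidean_space \<Rightarrow> real"
  assumes Y: "real_polynomial_function Y" "\<And>c x. c > 0 \<Longrightarrow> Y (c *\<^sub>R x) = c ^ k * Y x"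
    and x: "x \<in> sphere 0 1"
  shows "tderiv b Y x = pderiv_dir b Y x - real k * (x \<bullet> b) * Y x"
proof -
  have x0: "x \<noteq> 0" and n1: "norm x = 1" using x by auto
  have s: "smooth_on_sphere Y" using Y(1) by (rule smooth_on_sphere_polynomial)
  have pn: "((\<lambda>y. norm y ^ k) has_derivative (\<lambda>h. real k * (h \<bullet> x))) (at x)"
    using has_derivative_power[OF has_derivative_norm[OF x0], of k] n1 sgn_sphere[OF x] by simp
  have "pderiv_dir b Y x = pderiv_dir b (\<lambda>y. norm y ^ k * Y (sgn y)) x"
  proof (rule pderiv_dir_cong_off_0[OF _ x0])
    show "Y y = norm y ^ k * Y (sgn y)" if "y \<noteq> 0" for y
    proof -
      have "Y (norm y *\<^sub>R sgn y) = norm y ^ k * Y (sgn y)" using that by (intro Y(2)) simp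
      then show ?thesis using that by (simp add: sgn_div_norm)
    qed
  qed
  also have "\<dots> = norm x ^ k * pderiv_dir b (\<lambda>y. Y (sgn y)) x + pderiv_dir b (\<lambda>y. norm y ^ k) x * Y (sgn x)"
    using pn ext_differentiable[OF s x0] by (intro pderiv_dir_mult) (auto simp: differentiable_def)
  also have "\<dots> = tderiv b Y x + real k * (x \<bullet> b) * Y x"
    using n1 sgn_sphere[OF x] by (simp add: tderiv_def pderiv_dir_eqI[OF pn] inner_commute)
  finally show ?thesis by simp
qed

lemma sum_coord_square: "x \<in> sphere 0 1 \<Longrightarrow> (\<Sum>b\<in>Basis. (x \<bullet> b) * (x \<bullet> b)) = 1"
  by (simp add: euclidean_inner[symmetric] dot_square_norm)

lemma tderiv_inner:
  assumes "x \<in> sphere 0 1"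
  shows "tderiv b (\<lambda>x. x \<bullet> v) x = b \<bullet> v - (x \<bullet> b) * (x \<bullet> v)"
proof -
  have "real_polynomial_function (\<lambda>x::'a. x \<bullet> v)"
    by (intro real_polynomial_function.intros(1) bounded_linear_inner_left)
  from tderiv_homogeneous[OF this, of 1 x b] assms show ?thesis by (simp add: pderiv_dir_inner)
qed

lemma spherical_harmonicsD:
  assumes "Y \<in> spherical_harmonics k"
  shows "real_polynomial_function Y" "Y (c *\<^sub>R x) = c ^ k * Y x" "laplacian Y x = 0"
    "smooth_on_sphere Y"
  using assms smooth_on_sphere_polynomial by (auto simp: spherical_harmonics_def)

text \<open>Sum the second tangential derivatives: the Euclidean Laplacian vanishes, Euler's
  relation gives -(k - 1) k, and the sum of 1 - (x . b)^2 over the basis, DIM - 1, gives -k (DIM -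
  1).\<close>

lemma laplace_beltrami_harmonic:
  fixes Y :: "'a::euclidean_space \<Rightarrow> real"
  assumes "Y \<in> spherical_harmonics k" and x: "x \<in> sphere 0 1"
  shows "laplace_beltrami Y x = - (real k * (real k + real DIM('a) - 2)) * Y x"
proof -
  note Y = spherical_harmonicsD[OF assms(1)]
  have p: "real_polynomial_function (pderiv_dir b Y)" for b
    using Y(1) by (rule polynomial_pderiv_dir)
  have Xp: "tderiv b (pderiv_dir b Y) x = pderiv_dir b (pderiv_dir b Y) x - (real k - 1) * (x \<bullet> b) * pderiv_dir b Y x" for b
  proof (cases k)
    case (Suc j)
    have "pderiv_dir b Y (c *\<^sub>R y) = c ^ j * pderiv_dir b Y y" if "c > 0" for c y
      using homogeneous_pderiv_dir[OF Y(1,2), of c b y] that by (simp add: Suc)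
    then show ?thesis using tderiv_homogeneous[where b = b and k = j and Y = "pderiv_dir b Y", OF p] x by (simp add: Suc)
  next
    \<comment> \<open>There is no degree k - 1 here, but \<open>pderiv_dir b Y\<close> is
      zero.\<close>
    case 0
    have "Y x = Y 0" for x using Y(2)[of 0 x] 0 by simp
    then have "Y = (\<lambda>x. Y 0)" by auto
    then have "pderiv_dir b Y y = 0" for b y using pderiv_dir_const[of b "Y 0" y] by metis
    then have "pderiv_dir b Y = (\<lambda>_. 0)" by auto
    then show ?thesis by (simp add: tderiv_def)
  qed
  have X1: "tderiv b Y y = pderiv_dir b Y y - real k * ((y \<bullet> b) * Y y)" if "y \<in> sphere 0 1" for b y
    using tderiv_homogeneous[OF Y(1), of k y b] Y(2) that by simp
  have X2: "tderiv b (tderiv b Y) x = pderiv_dir b (pderiv_dir b Y) x - (real k - 1) * ((x \<bullet> b) * pderiv_dir b Y x)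
     - real k * ((1 - (x \<bullet> b) * (x \<bullet> b)) * Y x + (x \<bullet> b) * tderiv b Y x)" if "b \<in> Basis" for b
  proof -
    have "tderiv b (tderiv b Y) x = tderiv b (\<lambda>y. pderiv_dir b Y y + (- real k) * ((y \<bullet> b) * Y y)) x"
      using X1 x by (intro tderiv_cong) simp_all
    also have "\<dots> = tderiv b (pderiv_dir b Y) x + tderiv b (\<lambda>y. (- real k) * ((y \<bullet> b) * Y y)) x"
      using smooth_on_sphere_polynomial[OF p] Y(4) x
      by (intro tderiv_add smooth_on_sphere_cmult smooth_on_sphere_mult smooth_on_sphere_inner)
    also have "tderiv b (\<lambda>y. (- real k) * ((y \<bullet> b) * Y y)) x = (- real k) * tderiv b (\<lambda>y. (y \<bullet> b) * Y y) x"
      using Y(4) x by (intro tderiv_cmult smooth_on_sphere_mult smooth_on_sphere_inner)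
    also have "tderiv b (\<lambda>y. (y \<bullet> b) * Y y) x = (x \<bullet> b) * tderiv b Y x + tderiv b (\<lambda>y. y \<bullet> b) x * Y x"
      using Y(4) x by (intro tderiv_mult smooth_on_sphere_inner)
    finally show ?thesis using that by (simp add: Xp tderiv_inner[OF x] inner_Basis algebra_simps)
  qed
  have "laplace_beltrami Y x = (\<Sum>b\<in>Basis. pderiv_dir b (pderiv_dir b Y) x - (real k - 1) * ((x \<bullet> b) * pderiv_dir b Y x)
     - real k * ((1 - (x \<bullet> b) * (x \<bullet> b)) * Y x + (x \<bullet> b) * tderiv b Y x))"
    unfolding laplace_beltrami_eq[OF Y(4) x] by (intro sum.cong X2 refl)
  also have "\<dots> = laplacian Y x - (real k - 1) * (\<Sum>b\<in>Basis. (x \<bullet> b) * pderiv_dir b Y x)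
     - real k * ((real DIM('a) - (\<Sum>b\<in>Basis. (x \<bullet> b) * (x \<bullet> b))) * Y x + (\<Sum>b\<in>Basis. (x \<bullet> b) * tderiv b Y x))"
    by (simp add: laplacian_pderiv_dir sum_subtractf sum.distrib sum_distrib_left[symmetric]
        sum_distrib_right[symmetric])
  also have "\<dots> = - (real k - 1) * (real k * Y x) - real k * ((real DIM('a) - 1) * Y x)"
    using Y(3) euler_homogeneous[OF Y(1,2)] sum_coord_square[OF x] tderiv_radial[OF Y(4) x]
    by (simp add: algebra_simps)
  finally show ?thesis by (simp add: algebra_simps)
qed

lemma savg_laplace_beltrami_harmonic:
  fixes f :: "'a::euclidean_space \<Rightarrow> real"
  assumes f: "smooth_on_sphere f" and Z: "Z \<in> spherical_harmonics k"
  shows "savg (\<lambda>x. laplace_beltrami f x * Z x) = - (real k * (real k + real DIM('a) - 2)) * savg (\<lambda>x. f x * Z x)"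
proof -
  have "savg (\<lambda>x. laplace_beltrami f x * Z x) = savg (\<lambda>x. f x * laplace_beltrami Z x)"
    using f spherical_harmonicsD(4)[OF Z] by (rule laplace_beltrami_self_adjoint)
  also have "\<dots> = savg (\<lambda>x. - (real k * (real k + real DIM('a) - 2)) * (f x * Z x))"
    by (intro savg_cong) (simp add: laplace_beltrami_harmonic[OF Z])
  finally show ?thesis by simp
qed

lemma scont_mult: "scont f \<Longrightarrow> scont g \<Longrightarrow> scont (\<lambda>x. f x * g x)"
  by (intro continuous_intros)

lemma savg_neg_lb_plus:
  fixes f :: "'a::euclidean_space \<Rightarrow> real"
  assumes f: "smooth_on_sphere f" and Z: "Z \<in> spherical_harmonics k"
  shows "savg (\<lambda>x. neg_lb_plus c f x * Z x) = (real k * (real k + real DIM('a) - 2) + c) * savg (\<lambda>x. f x * Z x)"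
proof -
  have c: "scont f" "scont Z" "scont (laplace_beltrami f)"
    using f Z spherical_harmonicsD(4) by (auto intro!: continuous_on_smooth smooth_on_sphere_laplace_beltrami)
  have "savg (\<lambda>x. neg_lb_plus c f x * Z x) = savg (\<lambda>x. c * (f x * Z x) - laplace_beltrami f x * Z x)"
    by (intro savg_cong) (simp add: neg_lb_plus_def algebra_simps)
  also have "\<dots> = savg (\<lambda>x. c * (f x * Z x)) - savg (\<lambda>x. laplace_beltrami f x * Z x)"
    using c by (intro savg_diff continuous_intros)
  finally show ?thesis
    unfolding savg_laplace_beltrami_harmonic[OF f Z] by (simp add: algebra_simps)
qed

text \<open>Self-adjointness moves each factor onto the eigenfunction Z, so the coefficients of the
  image are known without expanding f.\<close>

lemma fold_neg_lb_plus:
  fixes f :: "'a::euclidean_space \<Rightarrow> real"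
  assumes "smooth_on_sphere f" and Z: "Z \<in> spherical_harmonics k"
  shows "smooth_on_sphere (fold (\<lambda>s. neg_lb_plus (c s)) ss f)"
    "savg (\<lambda>x. fold (\<lambda>s. neg_lb_plus (c s)) ss f x * Z x) =
      (\<Prod>s\<leftarrow>ss. real k * (real k + real DIM('a) - 2) + c s) * savg (\<lambda>x. f x * Z x)"
  using assms(1)
proof (induction ss arbitrary: f)
  case (Cons s ss)
  { case 1 then show ?case using Cons.IH(1) by (simp add: smooth_on_sphere_neg_lb_plus) }
  { case 2 then show ?case
      using Cons.IH(2)[of "neg_lb_plus (c s) f"] by (simp add: smooth_on_sphere_neg_lb_plus savg_neg_lb_plus Z) }
qed auto

text \<open>The eigenvalues for j and k differ by (k - j) (k + j + DIM - 2), whose second factor is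
  positive when DIM is at least 2 and j differs from k.\<close>

lemma harmonic_orthogonal:
  fixes Y Z :: "'a::euclidean_space \<Rightarrow> real"
  assumes Y: "Y \<in> spherical_harmonics j" and Z: "Z \<in> spherical_harmonics k" and "j \<noteq> k" "DIM('a) \<ge> 2"
  shows "savg (\<lambda>x. Y x * Z x) = 0"
proof -
  let ?d = "real DIM('a) - 2"
  have "- (real k * (real k + real DIM('a) - 2)) * savg (\<lambda>x. Y x * Z x) =
    savg (\<lambda>x. laplace_beltrami Y x * Z x)"
    using savg_laplace_beltrami_harmonic[OF spherical_harmonicsD(4)[OF Y] Z] by simp
  also have "\<dots> = savg (\<lambda>x. - (real j * (real j + real DIM('a) - 2)) * (Y x * Z x))"
    by (intro savg_cong) (simp add: laplace_beltrami_harmonic[OF Y])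
  also have "\<dots> = - (real j * (real j + real DIM('a) - 2)) * savg (\<lambda>x. Y x * Z x)"
    by (rule savg_cmult)
  finally have "(real k * (real k + ?d) - real j * (real j + ?d)) * savg (\<lambda>x. Y x * Z x) = 0"
    by (simp add: algebra_simps)
  moreover have "(real k - real j) * (real k + real j + ?d) \<noteq> 0"
    using assms(3,4) by (auto simp: less_imp_neq)
  moreover have "real k * (real k + ?d) - real j * (real j + ?d) = (real k - real j) * (real k + real j + ?d)"
    by (simp add: algebra_simps)
  ultimately show ?thesis by auto
qed

lemma savg_cauchy_schwarz:
  fixes f g :: "'a::euclidean_space \<Rightarrow> real"
  assumes "scont f" "scont g"
  shows "(savg (\<lambda>x. f x * g x))\<^sup>2 \<le> savg (\<lambda>x. (f x)\<^sup>2) * savg (\<lambda>x. (g x)\<^sup>2)"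
proof -
  define A where "A = savg (\<lambda>x. (f x)\<^sup>2)"
  define B where "B = savg (\<lambda>x. f x * g x)"
  define C where "C = savg (\<lambda>x. (g x)\<^sup>2)"
  have q: "0 \<le> A * t\<^sup>2 + 2 * t * B + C" for t
  proof -
    have "0 \<le> savg (\<lambda>x. (t * f x + g x)\<^sup>2)" by (intro savg_nonneg) simp
    also have "\<dots> = savg (\<lambda>x. t\<^sup>2 * (f x)\<^sup>2 + 2 * t * (f x * g x) + (g x)\<^sup>2)"
      by (intro savg_cong) (simp add: power2_eq_square algebra_simps)
    also have "\<dots> = t\<^sup>2 * A + 2 * t * B + C"
      unfolding A_def B_def C_def using assms
      by (subst savg_add savg_cmult, (auto intro!: continuous_intros)[2])+ simp
    finally show ?thesis by (simp add: mult.commute)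
  qed
  have "A \<ge> 0" unfolding A_def by (intro savg_nonneg) simp
  then consider "A > 0" | "A = 0" by linarith
  then have "B\<^sup>2 \<le> A * C"
  proof cases
    case 1
    then have "0 \<le> C - B\<^sup>2 / A"
      using q[of "- B / A"] by (simp add: power2_eq_square divide_simps)
    then show ?thesis using 1 by (simp add: field_simps)
  next
    case 2
    have "B = 0"
    proof (rule ccontr)
      assume "B \<noteq> 0"
      \<comment> \<open>This t makes the linear function 2 t B + C equal to -1.\<close>
      then show False using q[of "- (C + 1) / (2 * B)"] 2 by (simp add: field_simps)
    qed
    then show ?thesis using 2 by simp
  qed
  then show ?thesis by (simp add: A_def B_def C_def)
qed

section \<open>Zonal harmonics and Parseval\<close>

lemma polynomial_inner: "real_polynomial_function (\<lambda>x::'a::euclidean_space. x \<bullet> v)"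
  by (intro real_polynomial_function.intros(1) bounded_linear_inner_left)

lemma polynomial_norm_sq: "real_polynomial_function (\<lambda>x::'a::euclidean_space. x \<bullet> x)"
proof -
  have "real_polynomial_function (\<lambda>x::'a. \<Sum>b\<in>Basis. (x \<bullet> b) * (x \<bullet> b))"
    by (intro real_polynomial_function_sum real_polynomial_function.intros(4) polynomial_inner) auto
  then show ?thesis by (simp add: euclidean_inner[symmetric])
qed

lemma pderiv_dir_mult_poly:
  "real_polynomial_function f \<Longrightarrow> real_polynomial_function g \<Longrightarrow>
    pderiv_dir b (\<lambda>x. f x * g x) = (\<lambda>x. f x * pderiv_dir b g x + pderiv_dir b f x * g x)"
  by (simp add: fun_eq_iff pderiv_dir_mult polynomial_differentiable)

lemma pderiv_dir_diff_poly:
  "real_polynomial_function f \<Longrightarrow> real_polynomial_function g \<Longrightarrow>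
    pderiv_dir b (\<lambda>x. f x - g x) = (\<lambda>x. pderiv_dir b f x - pderiv_dir b g x)"
  by (simp add: fun_eq_iff pderiv_dir_diff polynomial_differentiable)

lemma pderiv_dir_cmult_poly:
  "real_polynomial_function g \<Longrightarrow> pderiv_dir b (\<lambda>x. c * g x) = (\<lambda>x. c * pderiv_dir b g x)"
  by (simp add: fun_eq_iff pderiv_dir_cmult polynomial_differentiable)

lemma pderiv_dir_norm_sq: "pderiv_dir b (\<lambda>x::'a::euclidean_space. x \<bullet> x) x = 2 * (x \<bullet> b)"
  by (rule pderiv_dir_eqI[where D = "\<lambda>h. 2 * (x \<bullet> h)"])
     (auto intro!: derivative_eq_intros simp: inner_commute)

lemma laplacian_mult:
  assumes f: "real_polynomial_function f" and g: "real_polynomial_function g"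
  shows "laplacian (\<lambda>x. f x * g x) x =
    f x * laplacian g x + 2 * (\<Sum>b\<in>Basis. pderiv_dir b f x * pderiv_dir b g x) + laplacian f x * g x"
proof -
  have "pderiv_dir b (pderiv_dir b (\<lambda>x. f x * g x)) x = f x * pderiv_dir b (pderiv_dir b g) x +
    2 * (pderiv_dir b f x * pderiv_dir b g x) + pderiv_dir b (pderiv_dir b f) x * g x" for b
    unfolding pderiv_dir_mult_poly[OF f g]
    by (subst pderiv_dir_add)
       (auto intro!: polynomial_differentiable real_polynomial_function.intros(3,4) polynomial_pderiv_dir f g
         simp: pderiv_dir_mult polynomial_differentiable polynomial_pderiv_dir f g)
  then show ?thesis
    by (simp add: laplacian_pderiv_dir sum.distrib sum_distrib_left[symmetric] sum_distrib_right[symmetric])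
qed

lemma laplacian_diff:
  assumes f: "real_polynomial_function f" and g: "real_polynomial_function g"
  shows "laplacian (\<lambda>x. f x - g x) x = laplacian f x - laplacian g x"
  by (simp add: laplacian_pderiv_dir pderiv_dir_diff_poly f g polynomial_pderiv_dir sum_subtractf)

lemma laplacian_cmult:
  assumes g: "real_polynomial_function g"
  shows "laplacian (\<lambda>x. c * g x) x = c * laplacian g x"
  by (simp add: laplacian_pderiv_dir pderiv_dir_cmult_poly g polynomial_pderiv_dir sum_distrib_left)

section \<open>Zonal harmonics and their recurrence\<close>

locale sphere_axis =
  fixes e :: "'a::euclidean_space" and n :: nat
  assumes e_Basis: "e \<in> Basis" and dim: "DIM('a) = Suc n" and n_ge_2: "n \<ge> 2"
begin

text \<open>The \<open>zon k\<close> are the monic zonal harmonics, i.e. multiples of Gegenbauer polynomials, extended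
  homogeneously; \<open>gam\<close> is the coefficient of their three-term recurrence.\<close>

definition gam :: "nat \<Rightarrow> real" where
  "gam k = real k * (real k + real n - 2) / ((2 * real k + real n - 1) * (2 * real k + real n - 3))"

fun zon :: "nat \<Rightarrow> 'a \<Rightarrow> real" where
  "zon 0 = (\<lambda>x. 1)"
| "zon (Suc 0) = (\<lambda>x. x \<bullet> e)"
| "zon (Suc (Suc k)) = (\<lambda>x. (x \<bullet> e) * zon (Suc k) x - gam (Suc k) * ((x \<bullet> x) * zon k x))"

lemma gam_0 [simp]: "gam 0 = 0"
  by (simp add: gam_def)

lemma gam_Suc: "gam (Suc k) = (real k + 1) * (real k + real n - 1) / ((2 * real k + real n + 1) * (2 * real k + real n - 1))"
  by (simp add: gam_def algebra_simps)

lemma gam_pos: "gam (Suc k) > 0"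
  using n_ge_2 unfolding gam_Suc by (intro divide_pos_pos mult_pos_pos) auto

lemma gam_le_1: "gam (Suc k) \<le> 1"
proof -
  have "(real k + 1) * (real k + real n - 1) \<le> (2 * real k + real n + 1) * (2 * real k + real n - 1)"
    using n_ge_2 by (intro mult_mono) auto
  then show ?thesis
    using n_ge_2 unfolding gam_Suc by (subst divide_le_eq_1_pos) (auto intro!: mult_pos_pos)
qed

lemma zon_polynomial: "real_polynomial_function (zon k)"
  by (induction k rule: zon.induct)
     (auto intro!: real_polynomial_function.intros(2-4) polynomial_inner polynomial_norm_sq real_polynomial_function_diff)

lemma zon_homogeneous: "zon k (c *\<^sub>R x) = c ^ k * zon k x"
  by (induction k rule: zon.induct) (auto simp: algebra_simps)

text \<open>The derivative along the axis stays within the family up to a factor. It is derived from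
  the recurrence alone, because the harmonicity of \<open>zon\<close> in turn rests on it.\<close>

lemma pderiv_dir_zon: "pderiv_dir e (zon (Suc k)) x = gam (Suc k) * (2 * real k + real n + 1) * zon k x"
proof (induction k arbitrary: x rule: zon.induct)
  case 1
  have "gam (Suc 0) * (real n + 1) = 1" using n_ge_2 by (simp add: gam_Suc divide_simps)
  then show ?case using e_Basis by (simp add: pderiv_dir_inner)
next
  case 2
  have p: "real_polynomial_function (\<lambda>x::'a. (x \<bullet> x) * 1)"
    by (intro real_polynomial_function.intros(2-4) polynomial_norm_sq)
  have "pderiv_dir e (zon (Suc (Suc 0))) x = 2 * (x \<bullet> e) - gam (Suc 0) * (2 * (x \<bullet> e))"
    using e_Basis p polynomial_norm_sq
    by (simp add: pderiv_dir_diff_poly pderiv_dir_mult_poly pderiv_dir_cmult_poly polynomial_inner polynomial_norm_sq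
        real_polynomial_function.intros(2-4) pderiv_dir_inner pderiv_dir_norm_sq)
  also have "2 - gam (Suc 0) * 2 = gam (Suc (Suc 0)) * (real n + 3)"
    using n_ge_2 by (simp add: gam_Suc divide_simps) (simp add: algebra_simps)
  then have "2 * (x \<bullet> e) - gam (Suc 0) * (2 * (x \<bullet> e)) = gam (Suc (Suc 0)) * (real n + 3) * (x \<bullet> e)"
    by (metis mult.assoc mult.commute left_diff_distrib)
  finally show ?case by simp
next
  case (3 k)
  let ?d = "\<lambda>k. gam (Suc k) * (2 * real k + real n + 1)"
  have p: "real_polynomial_function (\<lambda>x. (x \<bullet> e) * zon (Suc (Suc k)) x)"
    "real_polynomial_function (\<lambda>x. (x \<bullet> x) * zon (Suc k) x)"
    "real_polynomial_function (\<lambda>x. gam (Suc (Suc k)) * ((x \<bullet> x) * zon (Suc k) x))"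
    by (intro real_polynomial_function.intros(2-4) polynomial_norm_sq polynomial_inner zon_polynomial)+
  have "pderiv_dir e (zon (Suc (Suc (Suc k)))) x =
     (x \<bullet> e) * pderiv_dir e (zon (Suc (Suc k))) x + zon (Suc (Suc k)) x
     - gam (Suc (Suc k)) * ((x \<bullet> x) * pderiv_dir e (zon (Suc k)) x + 2 * (x \<bullet> e) * zon (Suc k) x)"
    unfolding zon.simps(3)[of "Suc k"] pderiv_dir_diff_poly[OF p(1,3)] pderiv_dir_cmult_poly[OF p(2)]
      pderiv_dir_mult_poly[OF polynomial_inner zon_polynomial] pderiv_dir_mult_poly[OF polynomial_norm_sq zon_polynomial]
    using e_Basis by (simp add: pderiv_dir_inner pderiv_dir_norm_sq)
  also have "\<dots> = (x \<bullet> e) * (?d (Suc k) * zon (Suc k) x) + zon (Suc (Suc k)) x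
     - gam (Suc (Suc k)) * ((x \<bullet> x) * (?d k * zon k x) + 2 * (x \<bullet> e) * zon (Suc k) x)"
    using 3 by simp
  also have "\<dots> = ((?d (Suc k) - 2 * gam (Suc (Suc k))) * ((x \<bullet> e) * zon (Suc k) x)) + zon (Suc (Suc k)) x
     - gam (Suc (Suc k)) * ?d k * ((x \<bullet> x) * zon k x)"
    by (simp add: algebra_simps)
  also have "(x \<bullet> e) * zon (Suc k) x = zon (Suc (Suc k)) x + gam (Suc k) * ((x \<bullet> x) * zon k x)"
    by simp
  also have "(?d (Suc k) - 2 * gam (Suc (Suc k))) * (zon (Suc (Suc k)) x + gam (Suc k) * ((x \<bullet> x) * zon k x))
     + zon (Suc (Suc k)) x - gam (Suc (Suc k)) * ?d k * ((x \<bullet> x) * zon k x) =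
     (?d (Suc k) - 2 * gam (Suc (Suc k)) + 1) * zon (Suc (Suc k)) x"
    by (simp add: algebra_simps)
  \<comment> \<open>The terms in (x . x) \<open>zon k\<close> have cancelled; what is left is a
    recursion that determines \<open>gam\<close> from \<open>gam 1\<close>.\<close>
  also have "?d (Suc k) - 2 * gam (Suc (Suc k)) + 1 = ?d (Suc (Suc k))"
  proof -
    have "2 * real k + real n + 1 \<noteq> 0" "2 * real k + real n + 3 \<noteq> 0" "2 * real k + real n + 5 \<noteq> 0"
      using n_ge_2 by auto
    then show ?thesis by (simp add: gam_Suc divide_simps) algebra
  qed
  finally show ?case .
qed

text \<open>The Laplacian of the recurrence is twice the axial derivative of
  \<open>zon (Suc k)\<close> minus \<open>gam (Suc k)\<close> (4 k + 2 DIM) \<open>zon k\<close>,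
  and the two cancel by \<open>pderiv_dir_zon\<close>.\<close>

lemma laplacian_zon: "laplacian (zon k) x = 0"
proof (induction k arbitrary: x rule: zon.induct)
  case 1
  have "pderiv_dir b (\<lambda>x::'a. 1) = (\<lambda>x. 0)" for b by (simp add: fun_eq_iff)
  then show ?case by (simp add: laplacian_pderiv_dir)
next
  case 2
  have "pderiv_dir b (\<lambda>x::'a. x \<bullet> e) = (\<lambda>x. b \<bullet> e)" for b by (simp add: fun_eq_iff pderiv_dir_inner)
  then show ?case by (simp add: laplacian_pderiv_dir)
next
  case (3 k)
  let ?N = "\<lambda>x::'a. x \<bullet> x"
  have p: "real_polynomial_function (\<lambda>x. (x \<bullet> e) * zon (Suc k) x)"
    "real_polynomial_function (\<lambda>x. ?N x * zon k x)"
    "real_polynomial_function (\<lambda>x. gam (Suc k) * (?N x * zon k x))"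
    by (intro real_polynomial_function.intros(2-4) polynomial_norm_sq polynomial_inner zon_polynomial)+
  have l1: "laplacian (\<lambda>x::'a. x \<bullet> e) x = 0"
  proof -
    have "pderiv_dir b (\<lambda>x::'a. x \<bullet> e) = (\<lambda>x. b \<bullet> e)" for b by (simp add: fun_eq_iff pderiv_dir_inner)
    then show ?thesis by (simp add: laplacian_pderiv_dir)
  qed
  have l2: "laplacian ?N x = 2 * real DIM('a)"
  proof -
    have "pderiv_dir b ?N = (\<lambda>x. 2 * (x \<bullet> b))" for b by (simp add: fun_eq_iff pderiv_dir_norm_sq)
    then have "pderiv_dir b (pderiv_dir b ?N) x = 2" if "b \<in> Basis" for b
      using that by (simp add: pderiv_dir_cmult_poly polynomial_inner pderiv_dir_inner inner_Basis)
    then show ?thesis by (simp add: laplacian_pderiv_dir)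
  qed
  have s1: "(\<Sum>b\<in>Basis. pderiv_dir b (\<lambda>x. x \<bullet> e) x * pderiv_dir b (zon (Suc k)) x) = pderiv_dir e (zon (Suc k)) x"
  proof -
    have "(\<Sum>b\<in>Basis. pderiv_dir b (\<lambda>x. x \<bullet> e) x * pderiv_dir b (zon (Suc k)) x) =
      (\<Sum>b\<in>Basis. if b = e then pderiv_dir b (zon (Suc k)) x else 0)"
      using e_Basis by (intro sum.cong) (auto simp: pderiv_dir_inner inner_Basis)
    then show ?thesis using e_Basis by simp
  qed
  have s2: "(\<Sum>b\<in>Basis. pderiv_dir b ?N x * pderiv_dir b (zon k) x) = 2 * (real k * zon k x)"
    using euler_homogeneous[OF zon_polynomial zon_homogeneous, where k = k and x = x]
    by (simp add: pderiv_dir_norm_sq mult.assoc sum_distrib_left[symmetric])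
  have "laplacian (zon (Suc (Suc k))) x = 2 * pderiv_dir e (zon (Suc k)) x
     - gam (Suc k) * (4 * (real k * zon k x) + 2 * real DIM('a) * zon k x)"
    unfolding zon.simps(3) laplacian_diff[OF p(1,3)] laplacian_cmult[OF p(2)]
      laplacian_mult[OF polynomial_inner zon_polynomial] laplacian_mult[OF polynomial_norm_sq zon_polynomial]
    using l1 l2 s1 s2 3 by simp
  then show ?case by (simp add: pderiv_dir_zon dim algebra_simps)
qed

lemma zon_harmonic: "zon k \<in> spherical_harmonics k"
  by (simp add: spherical_harmonics_def zon_polynomial zon_homogeneous laplacian_zon)

lemma zon_smooth: "smooth_on_sphere (zon k)"
  by (rule smooth_on_sphere_polynomial[OF zon_polynomial])

lemma zon_cont: "scont (zon k)"
  by (rule continuous_on_smooth[OF zon_smooth])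

text \<open>For k = 0 the truncated index \<open>k - 1\<close> is harmless since
  \<open>gam 0 = 0\<close>; later formulas rely on the same convention.\<close>

lemma zon_rec:
  assumes "x \<in> sphere 0 1"
  shows "(x \<bullet> e) * zon k x = zon (Suc k) x + gam k * zon (k - 1) x"
  using assms by (cases k) (auto simp: dot_square_norm)

lemma tderiv_zon:
  assumes "x \<in> sphere 0 1"
  shows "tderiv e (zon k) x = - real k * zon (Suc k) x + (real k + real n - 1) * gam k * zon (k - 1) x"
proof -
  have "tderiv e (zon k) x = pderiv_dir e (zon k) x - real k * ((x \<bullet> e) * zon k x)"
    using tderiv_homogeneous[OF zon_polynomial zon_homogeneous assms, where k = k and b = e] by simp
  moreover have "pderiv_dir e (zon k) x = gam k * (2 * real k + real n - 1) * zon (k - 1) x"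
    using pderiv_dir_zon[of _ x] by (cases k) (auto simp: algebra_simps)
  ultimately show ?thesis by (simp add: zon_rec[OF assms] algebra_simps)
qed

lemma zon_orthogonal: "j \<noteq> k \<Longrightarrow> savg (\<lambda>x. zon j x * zon k x) = 0"
  using harmonic_orthogonal[OF zon_harmonic zon_harmonic] dim n_ge_2 by simp

definition zon_norm :: "nat \<Rightarrow> real" where "zon_norm k = savg (\<lambda>x. zon k x * zon k x)"

text \<open>Multiplication by x . e is symmetric. Moved from \<open>zon k\<close> to
  \<open>zon (Suc k)\<close> it leaves, by orthogonality, only the component
  \<open>gam (Suc k) * zon k\<close>.\<close>

lemma zon_norm_Suc: "zon_norm (Suc k) = gam (Suc k) * zon_norm k"
proof -
  have "zon_norm (Suc k) = savg (\<lambda>x. zon (Suc k) x * ((x \<bullet> e) * zon k x) - gam k * (zon (Suc k) x * zon (k - 1) x))"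
    unfolding zon_norm_def by (intro savg_cong) (simp add: zon_rec algebra_simps)
  also have "\<dots> = savg (\<lambda>x. zon (Suc k) x * ((x \<bullet> e) * zon k x)) - gam k * savg (\<lambda>x. zon (Suc k) x * zon (k - 1) x)"
    by (subst savg_diff) (auto intro!: continuous_intros zon_cont)
  also have "savg (\<lambda>x. zon (Suc k) x * zon (k - 1) x) = 0" by (rule zon_orthogonal) simp
  also have "savg (\<lambda>x. zon (Suc k) x * ((x \<bullet> e) * zon k x)) =
    savg (\<lambda>x. zon (Suc (Suc k)) x * zon k x + gam (Suc k) * (zon k x * zon k x))"
  proof (rule savg_cong)
    fix x :: 'a assume "x \<in> sphere 0 1"
    from zon_rec[OF this, of "Suc k"]
    have r: "(x \<bullet> e) * zon (Suc k) x = zon (Suc (Suc k)) x + gam (Suc k) * zon k x" by simp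
    have "zon (Suc k) x * ((x \<bullet> e) * zon k x) = ((x \<bullet> e) * zon (Suc k) x) * zon k x"
      by (simp only: ac_simps)
    then show "zon (Suc k) x * ((x \<bullet> e) * zon k x) = zon (Suc (Suc k)) x * zon k x + gam (Suc k) * (zon k x * zon k x)"
      unfolding r by (simp add: algebra_simps)
  qed
  also have "\<dots> = savg (\<lambda>x. zon (Suc (Suc k)) x * zon k x) + gam (Suc k) * zon_norm k"
    unfolding zon_norm_def by (subst savg_add) (auto intro!: continuous_intros zon_cont simp del: zon.simps)
  also have "savg (\<lambda>x. zon (Suc (Suc k)) x * zon k x) = 0" by (rule zon_orthogonal) simp
  finally show ?thesis by simp
qed

lemma zon_norm_pos: "zon_norm k > 0"
  by (induction k) (auto simp: zon_norm_Suc gam_pos, simp add: zon_norm_def)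

text \<open>Equality is asked on the sphere only, where x . x = 1 lets harmonics of different
  degrees combine into polynomials in x . e.\<close>

definition zspan :: "nat \<Rightarrow> ('a \<Rightarrow> real) \<Rightarrow> bool" where
  "zspan N p \<longleftrightarrow> (\<exists>b. \<forall>x\<in>sphere 0 1. p x = (\<Sum>k\<le>N. b k * zon k x))"

lemma zspan_mono: 
  assumes "zspan N p" "N \<le> M" shows "zspan M p"
proof -
  obtain b where b: "\<forall>x\<in>sphere 0 1. p x = (\<Sum>k\<le>N. b k * zon k x)"
    using assms(1) by (auto simp: zspan_def)
  have "(\<Sum>k\<le>M. (if k \<le> N then b k else 0) * zon k x) = (\<Sum>k\<le>N. b k * zon k x)" for x
    using assms(2) by (intro sum.mono_neutral_cong_right) auto
  with b show ?thesis unfolding zspan_def by (intro exI[of _ "\<lambda>k. if k \<le> N then b k else 0"]) auto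
qed

lemma zspan_add: 
  assumes "zspan N p" "zspan M q" shows "zspan (max N M) (\<lambda>x. p x + q x)"
proof -
  have "zspan (max N M) p" "zspan (max N M) q"
    using assms zspan_mono by auto
  then obtain b c where "\<forall>x\<in>sphere 0 1. p x = (\<Sum>k\<le>max N M. b k * zon k x)"
    "\<forall>x\<in>sphere 0 1. q x = (\<Sum>k\<le>max N M. c k * zon k x)"
    unfolding zspan_def by auto
  then show ?thesis
    unfolding zspan_def by (intro exI[of _ "\<lambda>k. b k + c k"]) (simp add: sum.distrib distrib_right)
qed

lemma zspan_cmult: "zspan N p \<Longrightarrow> zspan N (\<lambda>x. c * p x)"
  unfolding zspan_def
proof (elim exE)
  fix b assume "\<forall>x\<in>sphere 0 1. p x = (\<Sum>k\<le>N. b k * zon k x)"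
  then show "\<exists>b. \<forall>x\<in>sphere 0 1. c * p x = (\<Sum>k\<le>N. b k * zon k x)"
    by (intro exI[of _ "\<lambda>k. c * b k"]) (simp add: sum_distrib_left mult.assoc)
qed

lemma zspan_sum:
  assumes "finite I" "\<And>i. i \<in> I \<Longrightarrow> \<exists>N. zspan N (p i)"
  shows "\<exists>N. zspan N (\<lambda>x. \<Sum>i\<in>I. p i x)"
  using assms
proof (induction I)
  case empty
  have "zspan 0 (\<lambda>x. 0)" unfolding zspan_def by (intro exI[of _ "\<lambda>_. 0"]) auto
  then show ?case by auto
next
  case (insert i I)
  obtain N where N: "zspan N (p i)" using insert.prems by blast
  obtain M where "zspan M (\<lambda>x. \<Sum>i\<in>I. p i x)" using insert by blast
  from zspan_add[OF N this] show ?case using insert.hyps by auto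
qed

lemma zspan_cong: "zspan N p \<Longrightarrow> (\<And>x. x \<in> sphere 0 1 \<Longrightarrow> p x = q x) \<Longrightarrow> zspan N q"
  unfolding zspan_def by auto

lemma zspan_zon: "zspan k (zon k)"
  unfolding zspan_def
proof (intro exI[of _ "\<lambda>j. if j = k then 1 else 0"] ballI)
  fix x :: 'a
  have "(\<Sum>j\<le>k. (if j = k then 1 else 0) * zon j x) = (\<Sum>j\<le>k. if j = k then zon j x else 0)"
    by (intro sum.cong) auto
  then show "zon k x = (\<Sum>j\<le>k. (if j = k then 1 else 0) * zon j x)" by simp
qed

lemma zspan_coord:
  assumes "zspan N p" shows "\<exists>M. zspan M (\<lambda>x. (x \<bullet> e) * p x)"
proof -
  obtain b where b: "\<forall>x\<in>sphere 0 1. p x = (\<Sum>k\<le>N. b k * zon k x)"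
    using assms by (auto simp: zspan_def)
  have "\<exists>M. zspan M (\<lambda>x. \<Sum>k\<le>N. b k * (zon (Suc k) x + gam k * zon (k - 1) x))"
  proof (rule zspan_sum)
    fix k
    show "\<exists>M. zspan M (\<lambda>x. b k * (zon (Suc k) x + gam k * zon (k - 1) x))"
      using zspan_cmult[OF zspan_add[OF zspan_zon zspan_cmult[OF zspan_zon]]] by blast
  qed simp
  then obtain M where "zspan M (\<lambda>x. \<Sum>k\<le>N. b k * (zon (Suc k) x + gam k * zon (k - 1) x))" ..
  then have "zspan M (\<lambda>x. (x \<bullet> e) * p x)"
  proof (rule zspan_cong)
    fix x :: 'a assume x: "x \<in> sphere 0 1"
    have "(x \<bullet> e) * p x = (\<Sum>k\<le>N. b k * ((x \<bullet> e) * zon k x))"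
      using b x by (simp add: sum_distrib_left algebra_simps)
    then show "(\<Sum>k\<le>N. b k * (zon (Suc k) x + gam k * zon (k - 1) x)) = (x \<bullet> e) * p x"
      by (simp only: zon_rec[OF x])
  qed
  then show ?thesis ..
qed

lemma zspan_polynomial:
  fixes p :: "real \<Rightarrow> real"
  assumes "real_polynomial_function p"
  shows "\<exists>N. zspan N (\<lambda>x. p (x \<bullet> e))"
proof -
  obtain a m where p: "p = (\<lambda>t. \<Sum>i\<le>m. a i * t ^ i)"
    using assms real_polynomial_function_iff_sum by blast
  have pow: "\<exists>N. zspan N (\<lambda>x. (x \<bullet> e) ^ i)" for i
  proof (induction i)
    case 0
    then show ?case using zspan_zon[of 0] by auto
  next
    case (Suc i)
    then show ?case using zspan_coord by (auto simp del: zon.simps)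
  qed
  show ?thesis unfolding p
  proof (rule zspan_sum)
    fix i show "\<exists>N. zspan N (\<lambda>x. a i * (x \<bullet> e) ^ i)"
      using pow[of i] zspan_cmult by blast
  qed simp
qed

section \<open>Zonal expansions in the mean square\<close>

definition zon_coef :: "('a \<Rightarrow> real) \<Rightarrow> nat \<Rightarrow> real" where "zon_coef f k = savg (\<lambda>x. f x * zon k x)"

definition zon_proj :: "nat \<Rightarrow> ('a \<Rightarrow> real) \<Rightarrow> 'a \<Rightarrow> real" where
  "zon_proj N f x = (\<Sum>k\<le>N. zon_coef f k / zon_norm k * zon k x)"

lemma zon_proj_cont: "scont (zon_proj N f)"
  unfolding zon_proj_def[abs_def] by (intro continuous_intros zon_cont)

lemma savg_proj: "scont g \<Longrightarrow> savg (\<lambda>x. g x * zon_proj N f x) = (\<Sum>k\<le>N. zon_coef g k * zon_coef f k / zon_norm k)"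
proof -
  assume g: "scont g"
  have "savg (\<lambda>x. g x * zon_proj N f x) = savg (\<lambda>x. \<Sum>k\<le>N. zon_coef f k / zon_norm k * (g x * zon k x))"
    by (intro savg_cong) (simp add: zon_proj_def sum_distrib_left algebra_simps)
  also have "\<dots> = (\<Sum>k\<le>N. savg (\<lambda>x. zon_coef f k / zon_norm k * (g x * zon k x)))"
    using g by (intro savg_sum continuous_intros zon_cont)
  also have "\<dots> = (\<Sum>k\<le>N. zon_coef g k * zon_coef f k / zon_norm k)"
    unfolding savg_cmult by (simp add: zon_coef_def mult.commute)
  finally show ?thesis .
qed

lemma zon_coef_zon: "zon_coef (zon j) k = (if j = k then zon_norm k else 0)"
  by (simp add: zon_coef_def zon_norm_def zon_orthogonal)

lemma zon_proj_residual_orthogonal: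
  assumes f: "scont f" and "k \<le> N"
  shows "savg (\<lambda>x. (f x - zon_proj N f x) * zon k x) = 0"
proof -
  have "savg (\<lambda>x. (f x - zon_proj N f x) * zon k x) = savg (\<lambda>x. f x * zon k x - zon k x * zon_proj N f x)"
    by (intro savg_cong) (simp add: algebra_simps)
  also have "\<dots> = zon_coef f k - savg (\<lambda>x. zon k x * zon_proj N f x)"
    unfolding zon_coef_def using f by (intro savg_diff continuous_intros zon_cont zon_proj_cont)
  also have "savg (\<lambda>x. zon k x * zon_proj N f x) = (\<Sum>j\<le>N. if j = k then zon_coef f j else 0)"
    unfolding savg_proj[OF zon_cont] zon_coef_zon using zon_norm_pos by (intro sum.cong) (auto simp: less_imp_neq[symmetric])
  also have "\<dots> = zon_coef f k" using assms(2) by simp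
  finally show ?thesis by simp
qed

text \<open>Pythagoras: the residual is orthogonal to the span, which contains the difference of the
  projection and p.\<close>

lemma zon_proj_best:
  assumes f: "scont f" and p: "zspan N p"
  shows "savg (\<lambda>x. (f x - zon_proj N f x)\<^sup>2) \<le> savg (\<lambda>x. (f x - p x)\<^sup>2)"
proof -
  obtain b where b: "\<forall>x\<in>sphere 0 1. p x = (\<Sum>k\<le>N. b k * zon k x)"
    using p by (auto simp: zspan_def)
  let ?R = "\<lambda>x. f x - zon_proj N f x"
  let ?d = "\<lambda>x. \<Sum>k\<le>N. (zon_coef f k / zon_norm k - b k) * zon k x"
  have c: "scont ?R" "scont ?d" by (intro continuous_intros f zon_proj_cont zon_cont)+
  have "savg (\<lambda>x. ?R x * ?d x) = savg (\<lambda>x. \<Sum>k\<le>N. (zon_coef f k / zon_norm k - b k) * (?R x * zon k x))"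
    by (intro savg_cong) (simp only: sum_distrib_left mult.left_commute)
  also have "\<dots> = (\<Sum>k\<le>N. savg (\<lambda>x. (zon_coef f k / zon_norm k - b k) * (?R x * zon k x)))"
    using f by (intro savg_sum continuous_intros zon_cont zon_proj_cont)
  also have "\<dots> = 0"
    unfolding savg_cmult using zon_proj_residual_orthogonal[OF f] by (intro sum.neutral) auto
  finally have 0: "savg (\<lambda>x. ?R x * ?d x) = 0" .
  have "savg (\<lambda>x. (f x - p x)\<^sup>2) = savg (\<lambda>x. ((?R x)\<^sup>2 + 2 * (?R x * ?d x)) + (?d x)\<^sup>2)"
  proof (rule savg_cong)
    fix x :: 'a assume x: "x \<in> sphere 0 1"
    have "f x - p x = ?R x + ?d x"
      using b x by (simp add: zon_proj_def left_diff_distrib sum_subtractf)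
    then show "(f x - p x)\<^sup>2 = ((?R x)\<^sup>2 + 2 * (?R x * ?d x)) + (?d x)\<^sup>2"
      by (simp only: power2_sum ac_simps)
  qed
  also have "\<dots> = savg (\<lambda>x. (?R x)\<^sup>2 + 2 * (?R x * ?d x)) + savg (\<lambda>x. (?d x)\<^sup>2)"
    by (intro savg_add continuous_intros f zon_proj_cont zon_cont)
  also have "savg (\<lambda>x. (?R x)\<^sup>2 + 2 * (?R x * ?d x)) = savg (\<lambda>x. (?R x)\<^sup>2) + savg (\<lambda>x. 2 * (?R x * ?d x))"
    by (intro savg_add continuous_intros f zon_proj_cont zon_cont)
  also have "savg (\<lambda>x. 2 * (?R x * ?d x)) = 0"
    unfolding savg_cmult 0 by simp
  finally show ?thesis using savg_nonneg[of "\<lambda>x. (?d x)\<^sup>2"] by simp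
qed

definition zonal :: "('a \<Rightarrow> real) \<Rightarrow> bool" where
  "zonal f \<longleftrightarrow> (\<exists>g. \<forall>x\<in>sphere 0 1. f x = g (x \<bullet> e))"

text \<open>The profile provided by \<open>zonal f\<close> comes with no regularity. Its continuity
  is obtained by restricting f to the half meridian t e + sqrt (1 - t^2) b, where b is a second
  basis vector.\<close>

lemma zonal_continuous_profile:
  assumes "zonal f" "scont f"
  obtains g where "continuous_on {-1..1} g" "\<And>x. x \<in> sphere 0 1 \<Longrightarrow> f x = g (x \<bullet> e)"
proof -
  obtain g where g: "\<forall>x\<in>sphere 0 1. f x = g (x \<bullet> e)" using assms(1) by (auto simp: zonal_def)
  have "\<exists>b\<in>Basis. b \<noteq> e"
  proof (rule ccontr)
    assume "\<not> ?thesis"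
    then have "Basis \<subseteq> {e}" by auto
    from card_mono[OF _ this] have "DIM('a) \<le> 1" by simp
    then show False using dim n_ge_2 by simp
  qed
  then obtain b where b: "b \<in> Basis" "b \<noteq> e" by auto
  define c where "c t = t *\<^sub>R e + sqrt (1 - t\<^sup>2) *\<^sub>R b" for t
  have be: "e \<bullet> b = 0" "b \<bullet> e = 0" "e \<bullet> e = 1" "b \<bullet> b = 1" using b e_Basis by (auto simp: inner_Basis)
  have cs: "c t \<in> sphere 0 1" "c t \<bullet> e = t" if "t \<in> {-1..1}" for t
  proof -
    have "t\<^sup>2 \<le> 1" using that by (auto simp: abs_square_le_1)
    then have "c t \<bullet> c t = 1"
      by (simp add: c_def inner_add_left inner_add_right be power2_eq_square[symmetric])
    then show "c t \<in> sphere 0 1" by (simp add: norm_eq_sqrt_inner)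
    show "c t \<bullet> e = t" by (simp add: c_def inner_add_left be)
  qed
  have "continuous_on {-1..1} (\<lambda>t. f (c t))"
  proof (rule continuous_on_compose2[OF assms(2)])
    show "continuous_on {-1..1} c" unfolding c_def by (intro continuous_intros)
  qed (use cs in auto)
  then have "continuous_on {-1..1} g"
    by (rule continuous_on_eq) (use g cs in auto)
  with g show ?thesis using that by blast
qed

text \<open>Weierstrass approximation of the profile gives a polynomial in x . e uniformly close to
  f. It lies in the zonal span, and the projection is at least as good in the mean square.\<close>

lemma zon_proj_tendsto:
  assumes z: "zonal f" and f: "scont f"
  shows "(\<lambda>N. savg (\<lambda>x. (f x - zon_proj N f x)\<^sup>2)) \<longlonglongrightarrow> 0"
proof (rule LIMSEQ_I)
  fix r :: real assume r: "r > 0"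
  obtain g where g: "continuous_on {-1..1} g" "\<And>x. x \<in> sphere 0 1 \<Longrightarrow> f x = g (x \<bullet> e)"
    using zonal_continuous_profile[OF z f] by metis
  \<comment> \<open>A uniform error of this size has mean square at most r / 2, strictly below
    r.\<close>
  define \<epsilon> where "\<epsilon> = sqrt (r / 2)"
  have e0: "\<epsilon> > 0" using r by (simp add: \<epsilon>_def)
  obtain p where p: "real_polynomial_function p" "\<And>t. t \<in> {-1..1} \<Longrightarrow> \<bar>g t - p t\<bar> < \<epsilon>"
    using Stone_Weierstrass_real_polynomial_function[OF _ g(1) e0] by auto
  obtain N0 where N0: "zspan N0 (\<lambda>x. p (x \<bullet> e))" using zspan_polynomial[OF p(1)] by auto
  have cp: "scont (\<lambda>x. p (x \<bullet> e))"
  proof (rule continuous_on_compose2[of UNIV p])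
    show "continuous_on UNIV p"
      using polynomial_differentiable[OF p(1)] differentiable_imp_continuous_within
      by (auto simp: continuous_on_eq_continuous_within)
  qed (auto intro!: continuous_intros)
  have le: "savg (\<lambda>x. (f x - p (x \<bullet> e))\<^sup>2) \<le> r / 2"
  proof -
    have "savg (\<lambda>x. (f x - p (x \<bullet> e))\<^sup>2) \<le> savg (\<lambda>_::'a. r / 2)"
    proof (rule savg_mono)
      fix x :: 'a assume x: "x \<in> sphere 0 1"
      have "\<bar>x \<bullet> e\<bar> \<le> 1"
        using Cauchy_Schwarz_ineq2[of x e] x e_Basis by simp
      then have "x \<bullet> e \<in> {-1..1}" by auto
      then have "\<bar>f x - p (x \<bullet> e)\<bar> \<le> \<epsilon>" using p(2) g(2)[OF x] by (auto intro: less_imp_le)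
      then have "(f x - p (x \<bullet> e))\<^sup>2 \<le> \<epsilon>\<^sup>2" by (rule power2_le_iff_abs_le[THEN iffD2, rotated]) (use e0 in simp)
      then show "(f x - p (x \<bullet> e))\<^sup>2 \<le> r / 2" using r by (simp add: \<epsilon>_def)
    qed (auto intro!: continuous_intros f cp)
    then show ?thesis by simp
  qed
  have "norm (savg (\<lambda>x. (f x - zon_proj N f x)\<^sup>2) - 0) < r" if "N \<ge> N0" for N
    using zon_proj_best[OF f zspan_mono[OF N0 that]] le r savg_nonneg[of "\<lambda>x. (f x - zon_proj N f x)\<^sup>2"] by simp
  then show "\<exists>N0. \<forall>N\<ge>N0. norm (savg (\<lambda>x. (f x - zon_proj N f x)\<^sup>2) - 0) < r" by blast
qed

text \<open>Only f has to be zonal. The other factor can thus be any spherical harmonic, and later x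
  . e times the tangential derivative of u, with no argument that this product is zonal.\<close>

theorem zonal_parseval:
  assumes z: "zonal f" and f: "scont f" and g: "scont g"
  shows "(\<lambda>k. zon_coef g k * zon_coef f k / zon_norm k) sums savg (\<lambda>x. g x * f x)"
  unfolding sums_def_le
proof -
  let ?E = "\<lambda>N. savg (\<lambda>x. (f x - zon_proj N f x)\<^sup>2)"
  let ?G = "savg (\<lambda>x. (g x)\<^sup>2)"
  have c: "scont (\<lambda>x. f x - zon_proj N f x)" for N by (intro continuous_intros f zon_proj_cont)
  have bd: "norm ((\<Sum>k\<le>N. zon_coef g k * zon_coef f k / zon_norm k) - savg (\<lambda>x. g x * f x)) \<le> sqrt (?G * ?E N)" for N
  proof -
    have "savg (\<lambda>x. g x * f x) - (\<Sum>k\<le>N. zon_coef g k * zon_coef f k / zon_norm k) = savg (\<lambda>x. g x * f x - g x * zon_proj N f x)"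
      unfolding savg_proj[OF g, symmetric] by (intro savg_diff[symmetric] continuous_intros f g zon_proj_cont)
    also have "\<dots> = savg (\<lambda>x. g x * (f x - zon_proj N f x))" by (simp add: right_diff_distrib)
    finally have "((\<Sum>k\<le>N. zon_coef g k * zon_coef f k / zon_norm k) - savg (\<lambda>x. g x * f x))\<^sup>2 \<le> ?G * ?E N"
      using savg_cauchy_schwarz[OF g c, of N] by (simp add: power2_commute)
    then show ?thesis
      using real_le_rsqrt[of "\<bar>(\<Sum>k\<le>N. zon_coef g k * zon_coef f k / zon_norm k) - savg (\<lambda>x. g x * f x)\<bar>"] by simp
  qed
  have lim: "(\<lambda>N. sqrt (?G * ?E N)) \<longlonglongrightarrow> 0"
    using tendsto_real_sqrt[OF tendsto_mult_right_zero[OF zon_proj_tendsto[OF z f], of ?G]] by simp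
  have "(\<lambda>N. (\<Sum>k\<le>N. zon_coef g k * zon_coef f k / zon_norm k) - savg (\<lambda>x. g x * f x)) \<longlonglongrightarrow> 0"
    by (rule Lim_null_comparison[OF always_eventually lim]) (intro allI bd)
  then show "(\<lambda>N. \<Sum>k\<le>N. zon_coef g k * zon_coef f k / zon_norm k) \<longlonglongrightarrow> savg (\<lambda>x. g x * f x)"
    using LIM_zero_iff by blast
qed

end

section \<open>The Paneitz operator on zonal functions\<close>

text \<open>If g x is nonzero, then g (sgn y) is nonzero for y in a nonempty open part of the
  punctured ball, and such a set is not negligible.\<close>

lemma savg_square_eq_0:
  fixes g :: "'a::euclidean_space \<Rightarrow> real"
  assumes g: "scont g" and 0: "savg (\<lambda>x. (g x)\<^sup>2) = 0" and x: "x \<in> sphere 0 1"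
  shows "g x = 0"
proof (rule ccontr)
  assume gx: "g x \<noteq> 0"
  let ?B = "ball 0 1 :: 'a set"
  have c: "scont (\<lambda>x. (g x)\<^sup>2)" using g by (intro continuous_intros)
  obtain C where C: "\<And>x. \<bar>cone_ext (\<lambda>x. (g x)\<^sup>2) x\<bar> \<le> C" using cone_ext_bounded[OF c] by metis
  have int: "integrable lborel (\<lambda>x. indicator ?B x * cone_ext (\<lambda>x. (g x)\<^sup>2) x)"
    by (rule integrable_ball_bounded[OF measurable_cone_ext[OF c] C])
  have "(\<integral>x. indicator ?B x * cone_ext (\<lambda>x. (g x)\<^sup>2) x \<partial>lborel) = 0"
    using 0 unit_ball_measure_pos[where 'a='a] unfolding savg_eq_ball[OF c] by (metis divide_eq_0_iff less_irrefl)
  then have ae: "AE x in lborel. indicator ?B x * cone_ext (\<lambda>x. (g x)\<^sup>2) x = 0"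
    using integral_nonneg_eq_0_iff_AE[OF int] by (simp add: cone_ext_def)
  define U where "U = {x \<in> ?B \<inter> (- {0}). g (sgn x) \<in> - {0}}"
  have cont: "continuous_on (?B \<inter> (- {0})) (\<lambda>x. g (sgn x))"
    by (rule continuous_on_compose2[OF g]) (auto intro!: continuous_intros continuous_on_sgn simp: norm_sgn split: if_splits)
  then have U: "open U"
  proof -
    have "open (?B \<inter> (- {0}))" "open (- {0::real})" by (auto intro!: open_Int open_Compl)
    then have "open ((?B \<inter> (- {0})) \<inter> (\<lambda>x. g (sgn x)) -` (- {0}))"
      by (rule continuous_open_preimage[OF cont])
    also have "(?B \<inter> (- {0})) \<inter> (\<lambda>x. g (sgn x)) -` (- {0}) = U" by (auto simp: U_def)
    finally show ?thesis .
  qed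
  have "AE x in lborel. x \<notin> U"
    using ae
  proof eventually_elim
    case (elim y)
    show ?case
    proof
      assume "y \<in> U"
      then have "y \<noteq> 0" "y \<in> ?B" "g (sgn y) \<noteq> 0" by (auto simp: U_def)
      then show False using elim cone_ext_off_0[of y "\<lambda>x. (g x)\<^sup>2"] by simp
    qed
  qed
  then have "U \<in> null_sets lborel"
    using AE_iff_null_sets[of U lborel] U by simp
  then have "U \<in> null_sets lebesgue" by (rule null_sets_completionI)
  then have "negligible U" by (simp add: negligible_iff_null_sets)
  \<comment> \<open>The point x itself lies on the boundary of the ball.\<close>
  moreover have "(1/2) *\<^sub>R x \<in> U" using x gx sgn_sphere[OF x] by (auto simp: U_def sgn_scaleR)
  ultimately show False using open_not_negligible[OF U] by auto
qed

lemma harmonic_diff: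
  assumes "Y \<in> spherical_harmonics k" "Z \<in> spherical_harmonics k"
  shows "(\<lambda>x. Y x - Z x) \<in> spherical_harmonics k"
  using assms by (auto simp: spherical_harmonics_def laplacian_diff algebra_simps)

lemma harmonic_cmult:
  assumes "Y \<in> spherical_harmonics k" shows "(\<lambda>x. c * Y x) \<in> spherical_harmonics k"
  using assms by (auto simp: spherical_harmonics_def laplacian_cmult intro: real_polynomial_function.intros(2-4))

text \<open>\<open>harmonic_proj\<close> selects a function on the whole space, so vanishing on the
  sphere has to be spread by homogeneity; at the origin, Y 0 = 0^k Y e for a unit vector e.\<close>

lemma harmonic_eq_0:
  fixes Y :: "'a::euclidean_space \<Rightarrow> real"
  assumes Y: "Y \<in> spherical_harmonics k" and 0: "savg (\<lambda>x. Y x * Y x) = 0"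
  shows "Y x = 0"
proof -
  have S: "Y y = 0" if "y \<in> sphere 0 1" for y
    by (rule savg_square_eq_0[OF continuous_on_smooth[OF spherical_harmonicsD(4)[OF Y]] _ that])
       (use 0 in \<open>simp add: power2_eq_square\<close>)
  show ?thesis
  proof (cases "x = 0")
    case True
    obtain e :: 'a where e_Basis: "e \<in> Basis" using nonempty_Basis by blast
    have "Y (0 *\<^sub>R e) = 0 ^ k * Y e" by (rule spherical_harmonicsD(2)[OF Y])
    then show ?thesis using True S[of e] e_Basis by simp
  next
    case False
    have "Y (norm x *\<^sub>R sgn x) = norm x ^ k * Y (sgn x)" by (rule spherical_harmonicsD(2)[OF Y])
    then show ?thesis using False S[of "sgn x"] by (simp add: norm_sgn) (simp add: sgn_div_norm)
  qed
qed

text \<open>Monotone convergence: the sum of the norms has finite integral, hence is finite almost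
  everywhere.\<close>

lemma AE_summable_norm:
  fixes f :: "nat \<Rightarrow> 'b \<Rightarrow> real"
  assumes int: "\<And>i. integrable M (f i)" and sum: "summable (\<lambda>i. \<integral>x. norm (f i x) \<partial>M)"
  shows "AE x in M. summable (\<lambda>i. norm (f i x))"
proof -
  have [measurable]: "f i \<in> borel_measurable M" for i using int by auto
  have "(\<integral>\<^sup>+x. (\<Sum>i. ennreal (norm (f i x))) \<partial>M) = (\<Sum>i. \<integral>\<^sup>+x. ennreal (norm (f i x)) \<partial>M)"
    by (rule nn_integral_suminf) simp
  also have "\<dots> = (\<Sum>i. ennreal (\<integral>x. norm (f i x) \<partial>M))"
    using int by (intro suminf_cong nn_integral_eq_integral integrable_norm) auto
  also have "\<dots> \<noteq> \<infinity>"
    using sum by (simp add: ennreal_suminf_neq_top)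
  finally have "AE x in M. (\<Sum>i. ennreal (norm (f i x))) \<noteq> \<infinity>"
    by (intro nn_integral_PInf_AE) auto
  then show ?thesis
    by eventually_elim (auto intro: summable_suminf_not_top)
qed

lemma prod_reflect:
  fixes x :: real
  assumes "m \<le> n"
  shows "(\<Prod>s<m. x + real n - 1 - real s) = (\<Prod>s\<in>{n-m..<n}. x + real s)"
  by (rule prod.reindex_bij_witness[of _ "\<lambda>s. n - 1 - s" "\<lambda>s. n - 1 - s"])
     (use assms in \<open>auto simp: of_nat_diff\<close>)

text \<open>The weights are tied to s only through a bound on s^2; squaring both sides avoids their
  square roots.\<close>

lemma weighted_am_gm:
  fixes s a b :: real
  assumes "s\<^sup>2 \<le> D * E" "0 \<le> D" "0 \<le> E"
  shows "s * a * b \<le> (D * a\<^sup>2 + E * b\<^sup>2) / 2"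
proof (rule power2_le_imp_le)
  have "(s * a * b)\<^sup>2 = s\<^sup>2 * (a\<^sup>2 * b\<^sup>2)" by (simp add: power_mult_distrib)
  also have "\<dots> \<le> (D * E) * (a\<^sup>2 * b\<^sup>2)" using assms(1) by (rule mult_right_mono) simp
  also have "\<dots> = ((D * a\<^sup>2 + E * b\<^sup>2) / 2)\<^sup>2 - ((D * a\<^sup>2 - E * b\<^sup>2) / 2)\<^sup>2"
    by (simp add: power2_eq_square field_simps)
  also have "\<dots> \<le> ((D * a\<^sup>2 + E * b\<^sup>2) / 2)\<^sup>2" by simp
  finally show "(s * a * b)\<^sup>2 \<le> ((D * a\<^sup>2 + E * b\<^sup>2) / 2)\<^sup>2" .
qed (use assms in simp)

context sphere_axis
begin

section \<open>Eigenvalues of the Paneitz operator\<close>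

definition paneitz_ev :: "nat \<Rightarrow> real" where "paneitz_ev k = (\<Prod>s<n. real k + real s)"

lemma paneitz_ev_0: "paneitz_ev 0 = 0"
  using n_ge_2 by (auto simp: paneitz_ev_def)

lemma paneitz_ev_pos: "k \<ge> 1 \<Longrightarrow> paneitz_ev k > 0"
  unfolding paneitz_ev_def by (intro prod_pos) auto

lemma paneitz_ev_nonneg: "paneitz_ev k \<ge> 0"
  unfolding paneitz_ev_def by (intro prod_nonneg) auto

text \<open>Both sides are k (k + 1) ... (k + n). The form without division includes k = 0.\<close>

lemma paneitz_ev_Suc: "real k * paneitz_ev (Suc k) = (real k + real n) * paneitz_ev k"
proof -
  have "real k * paneitz_ev (Suc k) = (\<Prod>s<Suc n. real k + real s)"
    unfolding paneitz_ev_def by (subst prod.lessThan_Suc_shift) (simp add: algebra_simps)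
  also have "\<dots> = (real k + real n) * paneitz_ev k"
    by (simp add: paneitz_ev_def)
  finally show ?thesis .
qed

lemma paneitz_ev_2: "paneitz_ev 2 = fact (n + 1)"
proof -
  have "(\<Prod>s<n. real 2 + real s) = fact (n + 1)" for n
    by (induction n) (auto simp: algebra_simps)
  then show ?thesis by (simp only: paneitz_ev_def)
qed

text \<open>Keeps the last factor, k + n + 1, and bounds the others below by 1; this absorbs the
  linear growth in \<open>rest_term\<close>.\<close>

lemma paneitz_ev_ge: "paneitz_ev (k + 2) \<ge> real k + real n + 1"
proof -
  obtain m where m: "n = Suc m" using n_ge_2 by (cases n) auto
  have "1 \<le> (\<Prod>s<m. real (k + 2) + real s)" by (intro prod_ge_1) auto
  then have "1 * (real (k + 2) + real m) \<le> (\<Prod>s<m. real (k + 2) + real s) * (real (k + 2) + real m)"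
    by (intro mult_right_mono) auto
  also have "\<dots> = paneitz_ev (k + 2)" unfolding paneitz_ev_def unfolding m by simp
  finally show ?thesis by (simp add: m)
qed

definition lb_ev :: "nat \<Rightarrow> real" where "lb_ev k = real k * (real k + real n - 1)"

text \<open>Each factor of the operator supplies the factors of \<open>paneitz_ev\<close> with
  indices s and n - 1 - s; for odd n the middle index (n - 1) / 2 is left to the square
  root.\<close>

lemma lb_ev_factor: "lb_ev k + real s * (real n - real s - 1) = (real k + real s) * (real k + real n - 1 - real s)"
  by (simp add: lb_ev_def algebra_simps)

lemma lb_ev_DIM: "real k * (real k + real DIM('a) - 2) = lb_ev k"
  by (simp add: dim lb_ev_def)

definition product_ev :: "nat \<Rightarrow> real" where
  "product_ev k = (\<Prod>s\<leftarrow>[0..<n div 2]. lb_ev k + real s * (real n - real s - 1))"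

lemma product_ev_eq: "product_ev k = (\<Prod>s<n div 2. real k + real s) * (\<Prod>s\<in>{n - n div 2..<n}. real k + real s)"
proof -
  have "product_ev k = (\<Prod>s<n div 2. (real k + real s) * (real k + real n - 1 - real s))"
    unfolding product_ev_def lb_ev_factor by (subst prod.distinct_set_conv_list[symmetric]) (auto simp: atLeast0LessThan)
  then show ?thesis by (simp add: prod.distrib prod_reflect)
qed

lemma product_ev_even: "even n \<Longrightarrow> product_ev k = paneitz_ev k"
proof -
  assume "even n"
  then have "n - n div 2 = n div 2" by auto
  then show ?thesis unfolding product_ev_eq paneitz_ev_def
    using prod.atLeastLessThan_concat[of 0 "n div 2" n "\<lambda>s. real k + real s"]
    by (simp add: atLeast0LessThan)
qed

lemma product_ev_odd: "odd n \<Longrightarrow> sqrt (lb_ev k + ((real n - 1) / 2)\<^sup>2) * product_ev k = paneitz_ev k"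
proof -
  assume "odd n"
  then obtain m where m: "n = 2 * m + 1" by (auto elim: oddE)
  have "lb_ev k + ((real n - 1) / 2)\<^sup>2 = (real k + real m)\<^sup>2"
    unfolding lb_ev_def by (simp add: m power2_eq_square algebra_simps)
  then have s: "sqrt (lb_ev k + ((real n - 1) / 2)\<^sup>2) = real k + real m" by simp
  have "n div 2 = m" "n - n div 2 = Suc m" using m by auto
  then have "sqrt (lb_ev k + ((real n - 1) / 2)\<^sup>2) * product_ev k =
     ((\<Prod>s<m. real k + real s) * (real k + real m)) * (\<Prod>s\<in>{Suc m..<n}. real k + real s)"
    unfolding product_ev_eq s by simp
  also have "(\<Prod>s<m. real k + real s) * (real k + real m) = (\<Prod>s\<in>{0..<Suc m}. real k + real s)"
    by (simp add: atLeast0LessThan)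
  finally show ?thesis unfolding paneitz_ev_def
    using prod.atLeastLessThan_concat[of 0 "Suc m" n "\<lambda>s. real k + real s"] m
    by (simp only: atLeast0LessThan)
qed

lemma paneitz_product_smooth:
  fixes u :: "'a \<Rightarrow> real"
  assumes "smooth_on_sphere u" shows "smooth_on_sphere (paneitz_product n u)"
  unfolding paneitz_product_def by (rule fold_neg_lb_plus(1)[OF assms zon_harmonic[of 0]])

lemma savg_paneitz_product:
  fixes u :: "'a \<Rightarrow> real"
  assumes "smooth_on_sphere u" and Z: "Z \<in> spherical_harmonics k"
  shows "savg (\<lambda>x. paneitz_product n u x * Z x) = product_ev k * savg (\<lambda>x. u x * Z x)"
  unfolding paneitz_product_def fold_neg_lb_plus(2)[OF assms] lb_ev_DIM product_ev_def ..

text \<open>By Parseval's identity for zonal functions, the projection of \<open>P u\<close> to the spherical harmonics of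
  degree \<open>k\<close> is a multiple of \<open>zon k\<close>; this avoids both the finite dimension of the space of harmonics
  and the rotation invariance of \<open>P\<close>.\<close>

lemma savg_zonal_harmonic:
  assumes u: "zonal u" "scont u" and Z: "Z \<in> spherical_harmonics k"
  shows "savg (\<lambda>x. u x * Z x) = zon_coef u k / zon_norm k * savg (\<lambda>x. zon k x * Z x)"
proof -
  have cZ: "scont Z" using Z spherical_harmonicsD(4) continuous_on_smooth by blast
  have "zon_coef Z j = 0" if "j \<noteq> k" for j
    using harmonic_orthogonal[OF Z zon_harmonic that[symmetric]] dim n_ge_2 by (simp add: zon_coef_def)
  then have "(\<lambda>j. zon_coef Z j * zon_coef u j / zon_norm j) = (\<lambda>j. if j = k then zon_coef Z j * zon_coef u j / zon_norm j else 0)"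
    by auto
  moreover have "(\<lambda>j. if j = k then zon_coef Z j * zon_coef u j / zon_norm j else 0) sums (zon_coef Z k * zon_coef u k / zon_norm k)"
    by (rule sums_single)
  ultimately have "savg (\<lambda>x. Z x * u x) = zon_coef Z k * zon_coef u k / zon_norm k"
    using zonal_parseval[OF u cZ] sums_unique2 by metis
  then show ?thesis by (simp add: zon_coef_def mult.commute)
qed

lemma harmonic_proj_paneitz_product:
  assumes u: "smooth_on_sphere u" "zonal u"
  defines "f \<equiv> paneitz_product n u"
  shows "harmonic_proj k f = (\<lambda>x. zon_coef f k / zon_norm k * zon k x)"
proof -
  let ?Y = "\<lambda>x. zon_coef f k / zon_norm k * zon k x"
  have cu: "scont u" and cf: "scont f" unfolding f_def
    by (intro continuous_on_smooth paneitz_product_smooth u(1))+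
  have Y: "?Y \<in> spherical_harmonics k" by (intro harmonic_cmult zon_harmonic)
  have cf_eq: "zon_coef f k = product_ev k * zon_coef u k"
    unfolding zon_coef_def f_def by (rule savg_paneitz_product[OF u(1) zon_harmonic])
  have orth: "savg (\<lambda>x. (f x - ?Y x) * Z x) = 0" if Z: "Z \<in> spherical_harmonics k" for Z
  proof -
    have cZ: "scont Z" using Z spherical_harmonicsD(4) continuous_on_smooth by blast
    have "savg (\<lambda>x. (f x - ?Y x) * Z x) = savg (\<lambda>x. f x * Z x - zon_coef f k / zon_norm k * (zon k x * Z x))"
      by (intro savg_cong) (simp add: algebra_simps)
    also have "\<dots> = savg (\<lambda>x. f x * Z x) - savg (\<lambda>x. zon_coef f k / zon_norm k * (zon k x * Z x))"
      by (intro savg_diff continuous_intros cf cZ zon_cont)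
    also have "savg (\<lambda>x. f x * Z x) = product_ev k * (zon_coef u k / zon_norm k * savg (\<lambda>x. zon k x * Z x))"
      unfolding f_def savg_paneitz_product[OF u(1) Z] savg_zonal_harmonic[OF u(2) cu Z] ..
    finally show ?thesis unfolding savg_cmult cf_eq by simp
  qed
  show ?thesis unfolding harmonic_proj_def
  proof (rule the_equality)
    show "?Y \<in> spherical_harmonics k \<and> (\<forall>Z\<in>spherical_harmonics k. savg (\<lambda>x. (f x - ?Y x) * Z x) = 0)"
      using Y orth by blast
    fix Y' assume Y': "Y' \<in> spherical_harmonics k \<and> (\<forall>Z\<in>spherical_harmonics k. savg (\<lambda>x. (f x - Y' x) * Z x) = 0)"
    \<comment> \<open>The difference of two candidates is an admissible test function, hence
      orthogonal to itself.\<close>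
    let ?D = "\<lambda>x. Y' x - ?Y x"
    have D: "?D \<in> spherical_harmonics k" using harmonic_diff[OF _ Y] Y' by blast
    have c: "scont ?D" "scont Y'" "scont ?Y"
      using D Y' Y spherical_harmonicsD(4) continuous_on_smooth by blast+
    have "savg (\<lambda>x. ?D x * ?D x) = savg (\<lambda>x. (f x - ?Y x) * ?D x - (f x - Y' x) * ?D x)"
    proof (rule savg_cong)
      have "(a - y) * (a - y) = (b - y) * (a - y) - (b - a) * (a - y)" for a b y :: real
        by (simp add: algebra_simps)
      then show "?D x * ?D x = (f x - ?Y x) * ?D x - (f x - Y' x) * ?D x" for x .
    qed
    also have "\<dots> = savg (\<lambda>x. (f x - ?Y x) * ?D x) - savg (\<lambda>x. (f x - Y' x) * ?D x)"
      by (intro savg_diff scont_mult continuous_on_diff cf c)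
    also have "\<dots> = 0" using orth[OF D] Y' D by simp
    finally have "?D x = 0" for x by (rule harmonic_eq_0[OF D])
    then show "Y' = ?Y" by (auto simp: fun_eq_iff)
  qed
qed

text \<open>Smoothness becomes decay by moving two Laplacians onto f. One power of
  \<open>lb_ev k\<close> later pays for the square root factor of the operator, the other gives
  summability.\<close>

lemma zon_coef_decay:
  assumes f: "smooth_on_sphere f"
  obtains K where "K \<ge> 0" "\<And>k. (lb_ev k)\<^sup>2 * \<bar>zon_coef f k\<bar> \<le> K * sqrt (zon_norm k)"
proof
  let ?g = "laplace_beltrami (laplace_beltrami f)"
  have s: "smooth_on_sphere (laplace_beltrami f)" "smooth_on_sphere ?g"
    using f by (auto intro: smooth_on_sphere_laplace_beltrami)
  show "sqrt (savg (\<lambda>x. (?g x)\<^sup>2)) \<ge> 0" by (simp add: savg_nonneg)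
  fix k
  have "zon_coef ?g k = (lb_ev k)\<^sup>2 * zon_coef f k"
    unfolding zon_coef_def savg_laplace_beltrami_harmonic[OF s(1) zon_harmonic]
      savg_laplace_beltrami_harmonic[OF f zon_harmonic] lb_ev_DIM by (simp add: power2_eq_square)
  moreover have "(zon_coef ?g k)\<^sup>2 \<le> savg (\<lambda>x. (?g x)\<^sup>2) * zon_norm k"
    using savg_cauchy_schwarz[OF continuous_on_smooth[OF s(2)] zon_cont, of k]
    by (simp add: zon_coef_def zon_norm_def power2_eq_square)
  then have "\<bar>zon_coef ?g k\<bar> \<le> sqrt (savg (\<lambda>x. (?g x)\<^sup>2) * zon_norm k)"
    by (intro real_le_rsqrt) simp
  ultimately show "(lb_ev k)\<^sup>2 * \<bar>zon_coef f k\<bar> \<le> sqrt (savg (\<lambda>x. (?g x)\<^sup>2)) * sqrt (zon_norm k)"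
    by (simp add: abs_mult real_sqrt_mult)
qed

lemma savg_abs_zon: "savg (\<lambda>x. \<bar>zon k x\<bar>) \<le> sqrt (zon_norm k)"
proof -
  have "(savg (\<lambda>x. \<bar>zon k x\<bar> * 1))\<^sup>2 \<le> savg (\<lambda>x. \<bar>zon k x\<bar>\<^sup>2) * savg (\<lambda>x::'a. 1\<^sup>2)"
    by (intro savg_cauchy_schwarz continuous_intros zon_cont)
  then have "(savg (\<lambda>x. \<bar>zon k x\<bar>))\<^sup>2 \<le> zon_norm k"
    by (simp add: zon_norm_def power2_eq_square)
  then show ?thesis by (rule real_le_rsqrt)
qed

text \<open>Absolute convergence in L1 is enough, and it follows from the bound on the mean of
  |\<open>zon k\<close>|. Where the series diverges, \<open>suminf\<close> is an unspecified value,
  but only on a null set.\<close>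

lemma savg_zonal_series:
  fixes c :: "nat \<Rightarrow> real"
  assumes "summable (\<lambda>k. \<bar>c k\<bar> * sqrt (zon_norm k))"
  shows "savg (\<lambda>x. (\<Sum>k. c k * zon k x) * zon j x) = c j * zon_norm j"
proof -
  let ?M = "sphere_measure :: 'a measure"
  have int: "integrable ?M (\<lambda>x. c k * zon k x)" "integrable ?M (\<lambda>x. c k * zon k x * zon j x)" for k
    by (intro integrable_sphere continuous_intros zon_cont)+
  have meas [measurable]: "zon k \<in> borel_measurable ?M" for k
    by (intro measurable_sphere_continuous zon_cont)
  have sum1: "summable (\<lambda>k. savg (\<lambda>x. norm (c k * zon k x)))"
  proof (rule summable_comparison_test'[OF assms])
    fix k
    show "norm (savg (\<lambda>x. norm (c k * zon k x))) \<le> \<bar>c k\<bar> * sqrt (zon_norm k)"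
      using mult_left_mono[OF savg_abs_zon, of "\<bar>c k\<bar>" k] by (simp add: abs_mult savg_nonneg)
  qed
  have ae: "AE x in ?M. summable (\<lambda>k. norm (c k * zon k x))"
    by (rule AE_summable_norm[OF int(1) sum1])
  have "bounded (zon j ` sphere 0 1)"
    using zon_cont compact_continuous_image compact_imp_bounded compact_sphere by blast
  then obtain B where B: "\<forall>x\<in>sphere 0 1. \<bar>zon j x\<bar> \<le> B" by (auto simp: bounded_iff)
  have sum2: "summable (\<lambda>k. savg (\<lambda>x. norm (c k * zon k x * zon j x)))"
  proof (rule summable_comparison_test'[OF summable_mult[OF sum1, of B]])
    fix k
    have "savg (\<lambda>x. norm (c k * zon k x * zon j x)) \<le> savg (\<lambda>x. B * norm (c k * zon k x))"
    proof (rule savg_mono)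
      fix x :: 'a assume "x \<in> sphere 0 1"
      then have "\<bar>zon j x\<bar> * norm (c k * zon k x) \<le> B * norm (c k * zon k x)"
        using B by (intro mult_right_mono) auto
      then show "norm (c k * zon k x * zon j x) \<le> B * norm (c k * zon k x)"
        by (simp add: abs_mult mult.commute)
    qed (intro continuous_intros zon_cont)+
    then show "norm (savg (\<lambda>x. norm (c k * zon k x * zon j x))) \<le> B * savg (\<lambda>x. norm (c k * zon k x))"
      unfolding savg_cmult by (simp add: savg_nonneg)
  qed
  have ae2: "AE x in ?M. summable (\<lambda>k. norm (c k * zon k x * zon j x))"
    using ae by eventually_elim (simp only: norm_mult summable_mult2)
  have "(\<lambda>k. savg (\<lambda>x. c k * zon k x * zon j x)) sums savg (\<lambda>x. \<Sum>k. c k * zon k x * zon j x)"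
    by (rule sums_integral[OF int(2) ae2 sum2])
  moreover have "savg (\<lambda>x. c k * zon k x * zon j x) = (if k = j then c j * zon_norm j else 0)" for k
  proof -
    have "savg (\<lambda>x. c k * zon k x * zon j x) = c k * zon_coef (zon k) j"
      unfolding zon_coef_def savg_cmult[symmetric] by (simp add: mult.assoc)
    then show ?thesis by (simp add: zon_coef_zon)
  qed
  ultimately have "savg (\<lambda>x. \<Sum>k. c k * zon k x * zon j x) = c j * zon_norm j"
    using sums_single[of j "\<lambda>_. c j * zon_norm j"] sums_unique2 by fastforce
  moreover have "savg (\<lambda>x. \<Sum>k. c k * zon k x * zon j x) = savg (\<lambda>x. (\<Sum>k. c k * zon k x) * zon j x)"
  proof (rule integral_cong_AE)
    show "AE x in ?M. (\<Sum>k. c k * zon k x * zon j x) = (\<Sum>k. c k * zon k x) * zon j x"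
      using ae
    proof eventually_elim
      case (elim x)
      then have "summable (\<lambda>k. c k * zon k x)" by (rule summable_norm_cancel)
      then show ?case by (rule suminf_mult2[symmetric])
    qed
  qed measurable
  ultimately show ?thesis by simp
qed

theorem zon_coef_paneitz:
  assumes u: "smooth_on_sphere u" "zonal u"
  shows "zon_coef (paneitz n u) k = paneitz_ev k * zon_coef u k"
proof (cases "even n")
  case True
  then show ?thesis
    using savg_paneitz_product[OF u(1) zon_harmonic, of k] by (simp add: zon_coef_def paneitz_def product_ev_even)
next
  case False
  define f where "f = paneitz_product n u"
  have sf: "smooth_on_sphere f" unfolding f_def by (rule paneitz_product_smooth[OF u(1)])
  define \<sigma> where "\<sigma> j = sqrt (lb_ev j + ((real n - 1) / 2)\<^sup>2)" for j
  define c where "c j = \<sigma> j * (zon_coef f j / zon_norm j)" for j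
  have pan: "paneitz n u x = (\<Sum>j. c j * zon j x)" for x
    using False harmonic_proj_paneitz_product[OF u, folded f_def]
    by (simp add: paneitz_def sqrt_neg_lb_plus_def f_def[symmetric] c_def \<sigma>_def lb_ev_def algebra_simps)
  obtain K where K: "K \<ge> 0" "\<And>k. (lb_ev k)\<^sup>2 * \<bar>zon_coef f k\<bar> \<le> K * sqrt (zon_norm k)"
    using zon_coef_decay[OF sf] by metis
  have "summable (\<lambda>j. \<bar>c j\<bar> * sqrt (zon_norm j))"
  \<comment> \<open>The comparison starts at j = 1 because \<open>lb_ev 0 = 0\<close>. From there on
    the root is j + (n - 1) / 2, which is at most \<open>lb_ev j\<close>.\<close>
  proof (rule summable_comparison_test'[of "\<lambda>j. K * inverse (real j ^ 2)" 1])
    show "summable (\<lambda>j. K * inverse (real j ^ 2))"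
      by (intro summable_mult inverse_power_summable) simp
    fix j :: nat assume j: "1 \<le> j"
    have lb_ev_ge: "real j ^ 2 \<le> lb_ev j" using n_ge_2 by (simp add: lb_ev_def power2_eq_square mult_left_mono)
    have lb_ev_pos: "lb_ev j > 0" using lb_ev_ge j by (meson less_le_trans of_nat_0_less_iff zero_less_power zero_less_one less_le_trans)
    have "\<sigma> j \<le> lb_ev j"
    proof -
      have "\<sigma> j = real j + (real n - 1) / 2"
      proof -
        have "lb_ev j + ((real n - 1) / 2)\<^sup>2 = (real j + (real n - 1) / 2)\<^sup>2"
          by (simp add: lb_ev_def power2_eq_square field_simps)
        then show ?thesis using n_ge_2 by (simp add: \<sigma>_def)
      qed
      also have "\<dots> \<le> 1 * (real j + real n - 1)" using n_ge_2 by simp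
      also have "\<dots> \<le> lb_ev j" unfolding lb_ev_def using j n_ge_2 by (intro mult_right_mono) auto
      finally show ?thesis .
    qed
    have \<sigma>0: "\<sigma> j \<ge> 0" using lb_ev_pos by (simp add: \<sigma>_def)
    have hp: "zon_norm j > 0" by (rule zon_norm_pos)
    have "\<bar>c j\<bar> * sqrt (zon_norm j) = \<sigma> j * (\<bar>zon_coef f j\<bar> / sqrt (zon_norm j))"
      using hp \<sigma>0 by (simp add: c_def abs_mult field_simps)
    also have "\<dots> \<le> lb_ev j * (\<bar>zon_coef f j\<bar> / sqrt (zon_norm j))"
      using \<open>\<sigma> j \<le> lb_ev j\<close> hp by (intro mult_right_mono) auto
    also have "\<dots> = ((lb_ev j)\<^sup>2 * \<bar>zon_coef f j\<bar>) / (lb_ev j * sqrt (zon_norm j))"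
      using lb_ev_pos by (simp add: power2_eq_square)
    also have "\<dots> \<le> (K * sqrt (zon_norm j)) / (lb_ev j * sqrt (zon_norm j))"
      using K(2)[of j] lb_ev_pos hp by (intro divide_right_mono) auto
    also have "\<dots> = K * inverse (lb_ev j)" using hp by (simp add: divide_inverse)
    also have "\<dots> \<le> K * inverse (real j ^ 2)"
      using lb_ev_ge K(1) j by (intro mult_left_mono le_imp_inverse_le) auto
    finally show "norm (\<bar>c j\<bar> * sqrt (zon_norm j)) \<le> K * inverse (real j ^ 2)"
      using hp by simp
  qed
  from savg_zonal_series[OF this, of k] have "zon_coef (paneitz n u) k = c k * zon_norm k"
    by (simp add: zon_coef_def pan)
  also have "\<dots> = \<sigma> k * zon_coef f k" using zon_norm_pos[of k] by (simp add: c_def)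
  also have "zon_coef f k = product_ev k * zon_coef u k"
    unfolding zon_coef_def f_def by (rule savg_paneitz_product[OF u(1) zon_harmonic])
  finally show ?thesis using product_ev_odd[OF False, of k] by (simp add: \<sigma>_def)
qed

end

section \<open>Definiteness of the quadratic form\<close>

context sphere_axis
begin

text \<open>The diagonal entry, in zonal coefficients, of the operator taking u to (x . e) X u, with
  X the tangential derivative along the axis.\<close>

definition diag_coef :: "nat \<Rightarrow> real" where
  "diag_coef k = (real k + real n - 1) * gam k - real k * gam (Suc k)"

lemma diag_coef_eq: "diag_coef k = real k * (real k + real n - 1) * (real n - 1) / ((2 * real k + real n - 3) * (2 * real k + real n + 1))"
proof (cases k)
  case (Suc j)
  have "2 * real j + real n - 1 \<noteq> 0" "2 * real j + real n + 1 \<noteq> 0" "2 * real j + real n + 3 \<noteq> 0"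
    using n_ge_2 by auto
  then show ?thesis
    unfolding diag_coef_def Suc gam_Suc by (simp add: divide_simps) algebra
qed (simp add: diag_coef_def)

lemma diag_coef_pos: "k \<ge> 1 \<Longrightarrow> diag_coef k > 0"
  unfolding diag_coef_eq using n_ge_2 by (intro divide_pos_pos mult_pos_pos) auto

lemma diag_coef_nonneg: "diag_coef k \<ge> 0"
  using diag_coef_pos[of k] by (cases "k = 0") (auto simp: diag_coef_def)

definition diag_term :: "(nat \<Rightarrow> real) \<Rightarrow> nat \<Rightarrow> real" where "diag_term a k = paneitz_ev k * diag_coef k * (a k)\<^sup>2 / zon_norm k"

text \<open>Minus the net coupling of a_k and a_{k+2}: row k contributes
  \<open>rest_term a k\<close>, row k + 2 a term of the same shape with opposite sign, and
  \<open>paneitz_ev_Suc_Suc\<close> merges them.\<close>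

definition off_term :: "(nat \<Rightarrow> real) \<Rightarrow> nat \<Rightarrow> real" where
  "off_term a k = a k * a (k + 2) * paneitz_ev k * (real n - 1) * (real k + real n + 1) / ((real k + 1) * zon_norm k)"

text \<open>The coupling of a_k to a_{k+2} in row k alone; it survives where a partial sum cuts off
  row k + 2.\<close>

definition rest_term :: "(nat \<Rightarrow> real) \<Rightarrow> nat \<Rightarrow> real" where
  "rest_term a k = a k * a (k + 2) * paneitz_ev k * (real k + real n + 1) / zon_norm k"

text \<open>The degree-k coefficient of (x . e) X u, see \<open>zon_coef_tderiv\<close>. For k < 2
  the term with truncated indices is multiplied by \<open>gam 0 = 0\<close>.\<close>

definition xXu_coef :: "(nat \<Rightarrow> real) \<Rightarrow> nat \<Rightarrow> real" where
  "xXu_coef a k = (real k + real n + 1) * a (k + 2) + diag_coef k * a k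
     - (real k - 2) * (gam k * (gam (k - 1) * a (k - 2)))"

lemma diag_term_nonneg: "diag_term a k \<ge> 0"
  unfolding diag_term_def using zon_norm_pos[of k] paneitz_ev_nonneg diag_coef_nonneg by (intro divide_nonneg_pos mult_nonneg_nonneg) auto

lemma paneitz_ev_Suc_Suc: "real k * (real k + 1) * paneitz_ev (k + 2) = (real k + real n) * (real k + real n + 1) * paneitz_ev k"
  using paneitz_ev_Suc[of k] paneitz_ev_Suc[of "Suc k"]
  by (cases "k = 0") (auto simp: paneitz_ev_0 algebra_simps, algebra)

lemma zon_norm_add_2: "zon_norm (k + 2) = gam (k + 2) * gam (k + 1) * zon_norm k"
  using zon_norm_Suc[of k] zon_norm_Suc[of "Suc k"] by simp

text \<open>With the diagonal normalized, the quadratic form is \<open>\<Sum> y\<^sub>k\<^sup>2 - \<Sum> r\<^sub>k y\<^sub>k y\<^bsub>k+2\<^esub>\<close>, where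
  \<open>r\<^sub>k\<^sup>2 = (m\<^sup>2 - 16) / (m\<^sup>2 - 4) < 1\<close> and \<open>m = 2 k + n + 1\<close>.\<close>

lemma off_term_le: "off_term a k \<le> (diag_term a k + diag_term a (k + 2)) / 2"
\<comment> \<open>At k = 0 the coupling vanishes with the eigenvalue, while \<open>E\<close> below
  divides by k.\<close>
proof (cases "k = 0")
  case True
  then show ?thesis using diag_term_nonneg[of a k] diag_term_nonneg[of a "k + 2"] by (simp add: off_term_def paneitz_ev_0)
next
  case False
  define K where "K = real k"
  define N where "N = real n"
  define m where "m = 2 * K + N + 1"
  have K: "K \<ge> 1" and N: "N \<ge> 2" using False n_ge_2 by (auto simp: K_def N_def)
  define q where "q = paneitz_ev k / zon_norm k"
  have q: "q \<ge> 0" unfolding q_def using paneitz_ev_nonneg zon_norm_pos[of k] by simp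
  define s where "s = (N - 1) * (K + N + 1) / (K + 1)"
  \<comment> \<open>The coefficient of the square of \<open>a (k + 2)\<close> in
    \<open>diag_term a (k + 2)\<close> once the common factor \<open>q\<close> is taken out, as
    verified in \<open>y2\<close>.\<close>
  define E where "E = (K + N + 1)\<^sup>2 * (N - 1) * m * (m - 2) * (m + 2) / (K * (K + 1)\<^sup>2 * (K + N - 1) * (m + 4))"
  have m: "m \<ge> 5" using K N by (simp add: m_def)
  have dk: "diag_coef k = K * (K + N - 1) * (N - 1) / ((m - 4) * m)"
    unfolding diag_coef_eq K_def N_def m_def by (simp add: algebra_simps)
  have dk2: "diag_coef (k + 2) = (K + 2) * (K + N + 1) * (N - 1) / (m * (m + 4))"
    unfolding diag_coef_eq K_def N_def m_def by (simp add: algebra_simps)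
  have g1: "gam (k + 1) = (K + 1) * (K + N - 1) / (m * (m - 2))"
    using gam_Suc[of k] unfolding K_def N_def m_def by (simp add: algebra_simps)
  have g2: "gam (k + 2) = (K + 2) * (K + N) / ((m + 2) * m)"
    using gam_Suc[of "Suc k"] unfolding K_def N_def m_def by (simp add: algebra_simps)
  have nz: "K \<noteq> 0" "K + 1 \<noteq> 0" "K + 2 \<noteq> 0" "K + N - 1 \<noteq> 0" "K + N \<noteq> 0" "m \<noteq> 0" "m - 2 \<noteq> 0" "m + 2 \<noteq> 0"
    "m - 4 \<noteq> 0" "m + 4 \<noteq> 0"
    using K N m by auto
  have pk2: "paneitz_ev (k + 2) = (K + N) * (K + N + 1) * paneitz_ev k / (K * (K + 1))"
    using paneitz_ev_Suc_Suc[of k] nz unfolding K_def[symmetric] N_def[symmetric]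
    by (subst nonzero_eq_divide_eq) (use nz in simp, simp only: ac_simps)
  have hne: "zon_norm k \<noteq> 0" using zon_norm_pos[of k] by simp
  have y2: "paneitz_ev (k + 2) * diag_coef (k + 2) / zon_norm (k + 2) = q * E"
    unfolding zon_norm_add_2 pk2 dk2 g1 g2 q_def E_def using nz hne
    by (simp add: divide_simps power2_eq_square)
  have yk: "diag_term a k = q * (diag_coef k * (a k)\<^sup>2)" by (simp add: diag_term_def q_def)
  have "diag_term a (k + 2) = (paneitz_ev (k + 2) * diag_coef (k + 2) / zon_norm (k + 2)) * (a (k + 2))\<^sup>2" by (simp add: diag_term_def)
  then have yk2: "diag_term a (k + 2) = q * (E * (a (k + 2))\<^sup>2)" unfolding y2 by simp
  have xk: "off_term a k = q * (s * a k * a (k + 2))"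
    unfolding off_term_def q_def s_def K_def N_def by (simp add: ac_simps)
  have "diag_coef k * E = s\<^sup>2 * ((m - 2) * (m + 2) / ((m - 4) * (m + 4)))"
    unfolding dk E_def s_def using nz by (simp add: divide_simps power2_eq_square)
  moreover have "1 \<le> (m - 2) * (m + 2) / ((m - 4) * (m + 4))"
    using m mult_mono[of 5 m 5 m] by (subst le_divide_eq_1_pos) (auto simp: algebra_simps)
  then have "s\<^sup>2 * 1 \<le> s\<^sup>2 * ((m - 2) * (m + 2) / ((m - 4) * (m + 4)))"
    by (rule mult_left_mono) simp
  ultimately have "s\<^sup>2 \<le> diag_coef k * E" by simp
  moreover have "E \<ge> 0" unfolding E_def using K N m by (intro divide_nonneg_pos mult_nonneg_nonneg mult_pos_pos) auto
  ultimately have "s * a k * a (k + 2) \<le> (diag_coef k * (a k)\<^sup>2 + E * (a (k + 2))\<^sup>2) / 2"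
    by (intro weighted_am_gm diag_coef_nonneg)
  from mult_left_mono[OF this q] show ?thesis
    unfolding yk yk2 xk by (simp add: algebra_simps)
qed

text \<open>Row k couples upwards through \<open>rest_term a k\<close> and downwards through
  \<open>t k\<close>. Pairing \<open>rest_term a k\<close> with \<open>t (k + 2)\<close> gives minus
  \<open>off_term a k\<close>; cutting at N + 2 leaves the last two upward couplings
  unpaired.\<close>

lemma partial_sums_xXu_coef:
  "(\<Sum>k\<le>N + 2. xXu_coef a k * (paneitz_ev k * a k) / zon_norm k) =
     (\<Sum>k\<le>N + 2. diag_term a k) - (\<Sum>k\<le>N. off_term a k) + rest_term a (N + 1) + rest_term a (N + 2)"
proof -
  define t where "t k = (real k - 2) * (gam k * (gam (k - 1) * a (k - 2))) * (paneitz_ev k * a k) / zon_norm k" for k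
  have split: "xXu_coef a k * (paneitz_ev k * a k) / zon_norm k = diag_term a k + rest_term a k - t k" for k
    by (simp add: xXu_coef_def diag_term_def rest_term_def t_def diff_divide_distrib add_divide_distrib algebra_simps power2_eq_square)
  have t01: "t 0 = 0" "t (Suc 0) = 0" by (simp_all add: t_def)
  \<comment> \<open>By \<open>paneitz_ev_Suc_Suc\<close> the difference carries the factor 1 - (k +
    n) / (k + 1) = -(n - 1) / (k + 1).\<close>
  have rx: "rest_term a k - t (k + 2) = - off_term a k" for k
  proof -
    have h: "zon_norm k \<noteq> 0" "gam (k + 1) \<noteq> 0" "gam (k + 2) \<noteq> 0"
      using zon_norm_pos[of k] gam_pos[of k] gam_pos[of "k + 1"] by auto
    have t: "t (k + 2) = real k * paneitz_ev (k + 2) * (a k * a (k + 2)) / zon_norm k"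
      unfolding t_def zon_norm_add_2 using h by (simp add: field_simps)
    have p: "real k * paneitz_ev (k + 2) = (real k + real n) * (real k + real n + 1) * paneitz_ev k / (real k + 1)"
      using paneitz_ev_Suc_Suc[of k] by (simp add: field_simps)
    show ?thesis unfolding t p rest_term_def off_term_def using h(1)
      by (simp add: divide_simps) (simp add: algebra_simps)
  qed
  show ?thesis
  proof (induction N)
    case 0
    show ?case using rx[of 0] t01 by (simp add: split numeral_2_eq_2)
  next
    case (Suc N)
    have "(\<Sum>k\<le>Suc N + 2. xXu_coef a k * (paneitz_ev k * a k) / zon_norm k) =
      (\<Sum>k\<le>N + 2. xXu_coef a k * (paneitz_ev k * a k) / zon_norm k) + (diag_term a (N + 3) + rest_term a (N + 3) - t (N + 3))"
      by (simp add: split numeral_3_eq_3)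
    also have "\<dots> = (\<Sum>k\<le>N + 2. diag_term a k) - (\<Sum>k\<le>N. off_term a k) + rest_term a (N + 2) + diag_term a (N + 3) + rest_term a (N + 3) + (rest_term a (N + 1) - t (N + 3))"
      unfolding Suc by simp
    also have "rest_term a (N + 1) - t (N + 3) = - off_term a (N + 1)"
      using rx[of "N + 1"] by (simp add: numeral_3_eq_3)
    finally show ?case by (simp add: numeral_3_eq_3)
  qed
qed

text \<open>Makes the boundary terms tend to zero as soon as the Parseval terms of P u do. The shift
  from k to k + 2 is allowed because \<open>gam_le_1\<close> makes \<open>zon_norm\<close>
  decrease.\<close>

lemma rest_term_bound:
  "\<bar>rest_term a k\<bar> \<le> ((paneitz_ev k * a k)\<^sup>2 / zon_norm k + (paneitz_ev (k + 2) * a (k + 2))\<^sup>2 / zon_norm (k + 2)) / 2"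
proof -
  define b where "b k = paneitz_ev k * a k" for k
  have hk: "zon_norm k > 0" "zon_norm (k + 2) > 0" by (rule zon_norm_pos)+
  have "gam (k + 2) * gam (k + 1) \<le> 1 * 1"
    using gam_le_1[of "Suc k"] gam_le_1[of k] gam_pos[of k] gam_pos[of "Suc k"] by (intro mult_mono) auto
  then have hle: "zon_norm (k + 2) \<le> zon_norm k"
    unfolding zon_norm_add_2 using hk(1) by (metis mult_1 mult_right_mono less_imp_le)
  have "\<bar>rest_term a k\<bar> = \<bar>b k\<bar> * ((real k + real n + 1) * \<bar>a (k + 2)\<bar>) / zon_norm k"
    using hk paneitz_ev_nonneg[of k] by (simp add: rest_term_def b_def abs_mult)
  also have "\<dots> \<le> \<bar>b k\<bar> * \<bar>b (k + 2)\<bar> / zon_norm k"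
  proof (intro divide_right_mono mult_left_mono)
    show "(real k + real n + 1) * \<bar>a (k + 2)\<bar> \<le> \<bar>b (k + 2)\<bar>"
      using paneitz_ev_ge[of k] paneitz_ev_nonneg[of "k + 2"] by (simp add: b_def abs_mult mult_right_mono)
  qed (use hk in auto)
  also have "\<dots> \<le> (((b k)\<^sup>2 + (b (k + 2))\<^sup>2) / 2) / zon_norm k"
    using weighted_am_gm[of 1 1 1 "\<bar>b k\<bar>" "\<bar>b (k + 2)\<bar>"] hk by (intro divide_right_mono) auto
  also have "\<dots> = ((b k)\<^sup>2 / zon_norm k + (b (k + 2))\<^sup>2 / zon_norm k) / 2"
    by (simp add: add_divide_distrib)
  also have "\<dots> \<le> ((b k)\<^sup>2 / zon_norm k + (b (k + 2))\<^sup>2 / zon_norm (k + 2)) / 2"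
    using hle hk by (intro divide_right_mono add_left_mono divide_left_mono mult_pos_pos) auto
  finally show ?thesis by (simp add: b_def)
qed

text \<open>Each diagonal term is shared in halves between its couplings to k - 2 and k + 2, so
  \<open>off_term_le\<close> alone gives only a nonnegative form. Definiteness comes from the
  bottom: if all diagonal terms below j vanish, so do their couplings, and half of
  \<open>diag_term a j\<close> remains in every later partial sum, although these tend to
  zero.\<close>

lemma quadratic_form_definite:
  assumes sm: "(\<lambda>k. xXu_coef a k * (paneitz_ev k * a k) / zon_norm k) sums 0"
    and lim: "(\<lambda>k. (paneitz_ev k * a k)\<^sup>2 / zon_norm k) \<longlonglongrightarrow> 0"
    and "k \<ge> 1"
  shows "a k = 0"
proof -
  define S where "S N = (\<Sum>k\<le>N + 2. diag_term a k) - (\<Sum>k\<le>N. off_term a k)" for N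
  have "(\<lambda>k. ((paneitz_ev k * a k)\<^sup>2 / zon_norm k + (paneitz_ev (k + 2) * a (k + 2))\<^sup>2 / zon_norm (k + 2)) / 2) \<longlonglongrightarrow> (0 + 0) / 2"
    by (intro tendsto_intros lim LIMSEQ_ignore_initial_segment[OF lim]) simp
  then have "(\<lambda>k. ((paneitz_ev k * a k)\<^sup>2 / zon_norm k + (paneitz_ev (k + 2) * a (k + 2))\<^sup>2 / zon_norm (k + 2)) / 2) \<longlonglongrightarrow> 0" by simp
  then have r0: "(rest_term a) \<longlonglongrightarrow> 0"
    by (rule Lim_null_comparison[rotated]) (intro always_eventually allI, simp only: real_norm_def rest_term_bound)
  have "(\<lambda>N. \<Sum>k\<le>N. xXu_coef a k * (paneitz_ev k * a k) / zon_norm k) \<longlonglongrightarrow> 0"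
    using sm by (simp add: sums_def_le)
  then have "(\<lambda>N. S N + rest_term a (N + 1) + rest_term a (N + 2)) \<longlonglongrightarrow> 0"
    unfolding S_def partial_sums_xXu_coef[symmetric] by (rule LIMSEQ_ignore_initial_segment)
  then have "(\<lambda>N. S N + rest_term a (N + 1) + rest_term a (N + 2) - rest_term a (N + 1) - rest_term a (N + 2)) \<longlonglongrightarrow> 0 - 0 - 0"
    by (intro tendsto_diff LIMSEQ_ignore_initial_segment r0)
  then have S0: "S \<longlonglongrightarrow> 0" by simp
  have "diag_term a j = 0" for j
  proof (induction j rule: less_induct)
    case (less j)
    have x0: "off_term a i = 0" if "i < j" for i
    proof (cases "i = 0")
      case False
      then have "paneitz_ev i * diag_coef i / zon_norm i \<noteq> 0"
        using paneitz_ev_pos[of i] diag_coef_pos[of i] zon_norm_pos[of i] by auto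
      moreover have "(paneitz_ev i * diag_coef i / zon_norm i) * (a i)\<^sup>2 = 0" using less[OF that] by (simp add: diag_term_def)
      ultimately have "a i = 0" by simp
      then show ?thesis by (simp add: off_term_def)
    qed (simp add: off_term_def paneitz_ev_0)
    \<comment> \<open>The halves of the two top terms are kept in reserve for their couplings to N +
      3 and N + 4.\<close>
    have lb: "S N \<ge> diag_term a j / 2 + (diag_term a (N + 1) + diag_term a (N + 2)) / 2" if "N \<ge> j" for N
      using that
    proof (induction N rule: dec_induct)
      case base
      have "(\<Sum>k\<le>j. off_term a k) = off_term a j"
        using x0 by (simp add: sum.atMost_shift lessThan_Suc_atMost[symmetric])
      moreover have "(\<Sum>k\<le>j + 2. diag_term a k) \<ge> diag_term a j + diag_term a (j + 1) + diag_term a (j + 2)"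
        using sum_nonneg[of "{..<j}" "diag_term a"] diag_term_nonneg by (simp add: lessThan_Suc_atMost[symmetric])
      moreover have "p / 2 + (q + r) / 2 \<le> Y - X"
        if "X = x" "p + q + r \<le> Y" "x \<le> (p + r) / 2" "0 \<le> q" for p q r x X Y :: real
        using that by (simp add: field_simps)
      ultimately show ?case
        using off_term_le[of a j] diag_term_nonneg[of a "j + 1"] unfolding S_def by metis
    next
      case (step N)
      have "S (Suc N) = S N + diag_term a (N + 3) - off_term a (N + 1)" by (simp add: S_def numeral_3_eq_3)
      then show ?case using step.IH off_term_le[of a "N + 1"] by (simp add: numeral_3_eq_3 numeral_2_eq_2 field_simps)
    qed
    have "diag_term a j / 2 \<le> S N" if "N \<ge> j" for N
      using lb[OF that] diag_term_nonneg[of a "N + 1"] diag_term_nonneg[of a "N + 2"] by (simp add: field_simps)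
    then have "diag_term a j / 2 \<le> 0"
      by (intro LIMSEQ_le_const[OF S0]) blast
    then show ?case using diag_term_nonneg[of a j] by simp
  qed
  then have "(paneitz_ev k * diag_coef k / zon_norm k) * (a k)\<^sup>2 = 0" by (simp add: diag_term_def)
  then show ?thesis using paneitz_ev_pos[OF assms(3)] diag_coef_pos[OF assms(3)] zon_norm_pos[of k] by auto
qed

section \<open>Coefficients of the tangential derivative and the integral identity\<close>

lemma savg_tderiv_zon:
  assumes u: "smooth_on_sphere u"
  shows "savg (\<lambda>x. tderiv e u x * zon k x) = (real n + real k) * zon_coef u (Suc k) - (real k - 1) * (gam k * zon_coef u (k - 1))"
proof -
  have cu: "scont u" by (rule continuous_on_smooth[OF u])
  have "savg (\<lambda>x. tderiv e u x * zon k x) = real n * savg (\<lambda>x. (x \<bullet> e) * (u x * zon k x)) - savg (\<lambda>x. u x * tderiv e (zon k) x)"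
    using savg_tderiv_parts[OF u zon_smooth e_Basis] by (simp add: dim)
  also have "savg (\<lambda>x. (x \<bullet> e) * (u x * zon k x)) = savg (\<lambda>x. u x * zon (Suc k) x + gam k * (u x * zon (k - 1) x))"
  proof (rule savg_cong)
    fix x :: 'a assume "x \<in> sphere 0 1"
    then have "u x * ((x \<bullet> e) * zon k x) = u x * (zon (Suc k) x + gam k * zon (k - 1) x)"
      by (simp only: zon_rec)
    then show "(x \<bullet> e) * (u x * zon k x) = u x * zon (Suc k) x + gam k * (u x * zon (k - 1) x)"
      by (simp add: algebra_simps)
  qed
  also have "\<dots> = zon_coef u (Suc k) + gam k * zon_coef u (k - 1)"
    unfolding zon_coef_def savg_cmult[symmetric] by (intro savg_add continuous_intros cu zon_cont)
  also have "savg (\<lambda>x. u x * tderiv e (zon k) x) = savg (\<lambda>x. ((real k + real n - 1) * gam k) * (u x * zon (k - 1) x) - real k * (u x * zon (Suc k) x))"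
    by (intro savg_cong) (simp add: tderiv_zon algebra_simps)
  also have "\<dots> = ((real k + real n - 1) * gam k) * zon_coef u (k - 1) - real k * zon_coef u (Suc k)"
    unfolding zon_coef_def savg_cmult[symmetric] by (intro savg_diff continuous_intros cu zon_cont)
  finally show ?thesis by (simp add: algebra_simps)
qed

lemma zon_coef_tderiv:
  assumes u: "smooth_on_sphere u"
  shows "zon_coef (\<lambda>x. (x \<bullet> e) * tderiv e u x) k = xXu_coef (zon_coef u) k"
proof -
  have cX: "scont (tderiv e u)" by (intro continuous_on_smooth smooth_on_sphere_tderiv u e_Basis)
  have "zon_coef (\<lambda>x. (x \<bullet> e) * tderiv e u x) k = savg (\<lambda>x. tderiv e u x * zon (Suc k) x + gam k * (tderiv e u x * zon (k - 1) x))"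
    unfolding zon_coef_def
  proof (rule savg_cong)
    fix x :: 'a assume "x \<in> sphere 0 1"
    then have "tderiv e u x * ((x \<bullet> e) * zon k x) = tderiv e u x * (zon (Suc k) x + gam k * zon (k - 1) x)"
      by (simp only: zon_rec)
    then show "(x \<bullet> e) * tderiv e u x * zon k x = tderiv e u x * zon (Suc k) x + gam k * (tderiv e u x * zon (k - 1) x)"
      by (simp add: algebra_simps)
  qed
  also have "\<dots> = savg (\<lambda>x. tderiv e u x * zon (Suc k) x) + gam k * savg (\<lambda>x. tderiv e u x * zon (k - 1) x)"
    unfolding savg_cmult[symmetric] by (intro savg_add continuous_intros cX zon_cont)
  also have "\<dots> = xXu_coef (zon_coef u) k"
    unfolding savg_tderiv_zon[OF u] xXu_coef_def diag_coef_def
    by (cases k) (auto simp: algebra_simps numeral_2_eq_2 of_nat_diff)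
  finally show ?thesis .
qed

text \<open>The assumption on \<open>zon_coef F 2\<close> is the equation tested against the second zonal harmonic at
  \<open>\<alpha> = 1 / (n + 1)\<close>.\<close>

lemma kazdan_warner:
  assumes u: "smooth_on_sphere u" and C: "C > 0"
    and F: "\<And>x. F x = exp (real n * u x) / C" and F1: "savg F = 1"
    and F2: "zon_coef F 2 = real n * zon_coef u 2"
  shows "savg (\<lambda>x. (x \<bullet> e) * tderiv e u x * (F x - 1)) = 0"
proof -
  have "smooth_on_sphere (\<lambda>x. (1 / C) * exp (real n * u x))"
    by (intro smooth_on_sphere_cmult smooth_on_sphere_exp u)
  moreover have F_eq: "F = (\<lambda>x. (1 / C) * exp (real n * u x))" using F by (auto simp: fun_eq_iff)
  ultimately have sF: "smooth_on_sphere F" by simp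
  have XF: "tderiv e F x = real n * (F x * tderiv e u x)" if "x \<in> sphere 0 1" for x
  proof -
    have "tderiv e F x = (1 / C) * tderiv e (\<lambda>x. exp (real n * u x)) x"
      unfolding F_eq by (intro tderiv_cmult smooth_on_sphere_exp smooth_on_sphere_cmult u that)
    also have "tderiv e (\<lambda>x. exp (real n * u x)) x = exp (real n * u x) * (real n * tderiv e u x)"
      using that u by (simp add: tderiv_exp tderiv_cmult smooth_on_sphere_cmult)
    finally show ?thesis unfolding F[of x] by simp
  qed
  have cont: "scont F" "scont u" "scont (tderiv e u)" "scont (tderiv e F)"
    by (intro continuous_on_smooth smooth_on_sphere_tderiv u sF e_Basis)+
  \<comment> \<open>1 / (n + 1) is the mean of (x . e)^2 over the sphere.\<close>
  have z2: "(x \<bullet> e) * (x \<bullet> e) = zon 2 x + 1 / (real n + 1)" if "x \<in> sphere 0 1" for x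
  proof -
    have "gam (Suc 0) = 1 / (real n + 1)" using n_ge_2 by (simp add: gam_Suc divide_simps)
    then show ?thesis using zon_rec[OF that, of 1] by (simp add: numeral_2_eq_2)
  qed
  have 1: "savg (\<lambda>x. (x \<bullet> e) * F x * (x \<bullet> e)) = real n * zon_coef u 2 + 1 / (real n + 1)"
  proof -
    have "savg (\<lambda>x. (x \<bullet> e) * F x * (x \<bullet> e)) = savg (\<lambda>x. F x * zon 2 x + 1 / (real n + 1) * F x)"
    proof (rule savg_cong)
      fix x :: 'a assume "x \<in> sphere 0 1"
      then have "F x * ((x \<bullet> e) * (x \<bullet> e)) = F x * (zon 2 x + 1 / (real n + 1))"
        by (simp only: z2)
      then show "(x \<bullet> e) * F x * (x \<bullet> e) = F x * zon 2 x + 1 / (real n + 1) * F x"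
        by (simp add: algebra_simps)
    qed
    also have "\<dots> = savg (\<lambda>x. F x * zon 2 x) + savg (\<lambda>x. 1 / (real n + 1) * F x)"
      by (intro savg_add continuous_intros cont zon_cont)
    finally show ?thesis unfolding savg_cmult using F1 F2 by (simp add: zon_coef_def)
  qed
  have sF': "smooth_on_sphere (\<lambda>x. (x \<bullet> e) * F x)"
    by (intro smooth_on_sphere_mult smooth_on_sphere_inner sF)
  \<comment> \<open>The derivative of the factor x . e contributes F (1 - (x . e)^2); its second
    moment joins the n second moments of the left-hand side to give the factor n + 1.\<close>
  have "real n * savg (\<lambda>x. (x \<bullet> e) * ((x \<bullet> e) * F x)) = savg (tderiv e (\<lambda>x. (x \<bullet> e) * F x))"
    using savg_tderiv[OF sF' e_Basis] dim by simp
  also have "\<dots> = savg (\<lambda>x. real n * ((x \<bullet> e) * tderiv e u x * F x) + (F x - (x \<bullet> e) * F x * (x \<bullet> e)))"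
  proof (rule savg_cong)
    fix x :: 'a assume x: "x \<in> sphere 0 1"
    have "tderiv e (\<lambda>x. (x \<bullet> e) * F x) x = (x \<bullet> e) * tderiv e F x + tderiv e (\<lambda>x. x \<bullet> e) x * F x"
      by (intro tderiv_mult smooth_on_sphere_inner sF x)
    then show "tderiv e (\<lambda>x. (x \<bullet> e) * F x) x = real n * ((x \<bullet> e) * tderiv e u x * F x) + (F x - (x \<bullet> e) * F x * (x \<bullet> e))"
      using e_Basis by (simp add: XF[OF x] tderiv_inner[OF x] algebra_simps)
  qed
  also have "\<dots> = real n * savg (\<lambda>x. (x \<bullet> e) * tderiv e u x * F x) + savg (\<lambda>x. F x - (x \<bullet> e) * F x * (x \<bullet> e))"
    unfolding savg_cmult[symmetric] by (intro savg_add continuous_intros cont)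
  also have "savg (\<lambda>x. F x - (x \<bullet> e) * F x * (x \<bullet> e)) = savg F - savg (\<lambda>x. (x \<bullet> e) * F x * (x \<bullet> e))"
    by (intro savg_diff continuous_intros cont)
  finally have *: "real n * savg (\<lambda>x. (x \<bullet> e) * tderiv e u x * F x) = (real n + 1) * savg (\<lambda>x. (x \<bullet> e) * F x * (x \<bullet> e)) - 1"
    using F1 by (simp add: mult.commute mult.left_commute algebra_simps)
  have "real n * savg (\<lambda>x. (x \<bullet> e) * tderiv e u x * F x) = real n * ((real n + 1) * zon_coef u 2)"
  proof -
    have "(N + 1) * (N * y + 1 / (N + 1)) - 1 = N * ((N + 1) * y)" if "N + 1 \<noteq> 0" for N y :: real
      using that by (simp add: distrib_left)
    from this[of "real n" "zon_coef u 2"] show ?thesis using * unfolding 1 by simp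
  qed
  then have A: "savg (\<lambda>x. (x \<bullet> e) * tderiv e u x * F x) = (real n + 1) * zon_coef u 2"
    using n_ge_2 by simp
  \<comment> \<open>This is the degree-0 coefficient of (x . e) X u, in which only a_2
    occurs.\<close>
  have B: "savg (\<lambda>x. (x \<bullet> e) * tderiv e u x) = (real n + 1) * zon_coef u 2"
    using zon_coef_tderiv[OF u, of 0] by (simp add: zon_coef_def xXu_coef_def diag_coef_def numeral_2_eq_2)
  have "savg (\<lambda>x. (x \<bullet> e) * tderiv e u x * (F x - 1)) = savg (\<lambda>x. (x \<bullet> e) * tderiv e u x * F x - (x \<bullet> e) * tderiv e u x)"
    by (simp add: right_diff_distrib)
  also have "\<dots> = savg (\<lambda>x. (x \<bullet> e) * tderiv e u x * F x) - savg (\<lambda>x. (x \<bullet> e) * tderiv e u x)"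
    by (intro savg_diff continuous_intros cont)
  finally show ?thesis using A B by simp
qed

section \<open>From the quadratic form back to the equation\<close>

theorem zonal_solution_constant:
  assumes u: "smooth_on_sphere u" "zonal u"
    and eq: "\<And>x. x \<in> sphere 0 1 \<Longrightarrow> 1 / (real n + 1) * paneitz n u x
      + fact (n - 1) * (1 - exp (real n * u x) / savg (\<lambda>x. exp (real n * u x))) = 0"
  shows "u constant_on sphere 0 1"
proof -
  define C where "C = savg (\<lambda>x. exp (real n * u x))"
  have cu: "scont u" by (rule continuous_on_smooth[OF u(1)])
  have cexp: "scont (\<lambda>x. exp (real n * u x))" by (intro continuous_intros cu)
  have C: "C > 0"
  proof -
    \<comment> \<open>The exponential is a square, so a zero mean would make it vanish on the
      sphere.\<close>
    have "C \<noteq> 0"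
    proof
      assume "C = 0"
      then have "savg (\<lambda>x. (exp (real n * u x / 2))\<^sup>2) = 0"
        by (simp add: C_def power2_eq_square exp_add[symmetric])
      then have "exp (real n * u e / 2) = 0"
        using e_Basis cu by (intro savg_square_eq_0[of "\<lambda>x. exp (real n * u x / 2)" e]) (auto intro!: continuous_intros)
      then show False by simp
    qed
    moreover have "C \<ge> 0" unfolding C_def by (intro savg_nonneg) simp
    ultimately show ?thesis by simp
  qed
  define F where "F x = exp (real n * u x) / C" for x
  define G where "G x = F x - 1" for x
  have cF: "scont F" "scont G" unfolding F_def G_def by (intro continuous_intros cu; use C in simp)+
  have zG: "zonal G"
  proof -
    obtain g where "\<forall>x\<in>sphere 0 1. u x = g (x \<bullet> e)" using u(2) by (auto simp: zonal_def)
    then show ?thesis unfolding zonal_def G_def F_def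
      by (intro exI[of _ "\<lambda>t. exp (real n * g t) / C - 1"]) simp
  qed
  have F1: "savg F = 1" using C by (simp add: F_def[abs_def] C_def)
  define c where "c = 1 / ((real n + 1) * fact (n - 1))"
  have c: "c > 0" by (simp add: c_def add_pos_nonneg)
  have G: "G x = c * paneitz n u x" if "x \<in> sphere 0 1" for x
    using eq[OF that] unfolding C_def[symmetric] F_def[symmetric]
    by (simp add: G_def c_def field_simps add_nonneg_eq_0_iff)
  have coefG: "zon_coef G k = c * (paneitz_ev k * zon_coef u k)" for k
  proof -
    have "zon_coef G k = savg (\<lambda>x. c * (paneitz n u x * zon k x))"
      unfolding zon_coef_def by (intro savg_cong) (simp add: G)
    also have "\<dots> = c * zon_coef (paneitz n u) k" unfolding savg_cmult zon_coef_def ..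
    finally show ?thesis by (simp add: zon_coef_paneitz[OF u])
  qed
  have F2: "zon_coef F 2 = real n * zon_coef u 2"
  proof -
    have "zon_coef G 2 = savg (\<lambda>x. F x * zon 2 x - zon 0 x * zon 2 x)"
      unfolding zon_coef_def by (intro savg_cong) (simp add: G_def algebra_simps)
    also have "\<dots> = zon_coef F 2 - savg (\<lambda>x. zon 0 x * zon 2 x)"
      unfolding zon_coef_def by (intro savg_diff continuous_intros cF zon_cont)
    also have "savg (\<lambda>x. zon 0 x * zon 2 x) = 0" by (rule zon_orthogonal) simp
    finally have "zon_coef F 2 = c * paneitz_ev 2 * zon_coef u 2" by (simp add: coefG)
    \<comment> \<open>The value of alpha enters here: (n + 1)! divided by (n + 1) (n - 1)! is
      n.\<close>
    also have "c * paneitz_ev 2 = real n"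
    proof -
      obtain m where "n = Suc m" using n_ge_2 by (cases n) auto
      then have "fact (n + 1) = (real n + 1) * (real n * fact (n - 1))" by (simp add: algebra_simps)
      then show ?thesis unfolding paneitz_ev_2 c_def by (simp add: add_nonneg_eq_0_iff)
    qed
    finally show ?thesis .
  qed
  have kw: "savg (\<lambda>x. ((x \<bullet> e) * tderiv e u x) * G x) = 0"
    unfolding G_def by (rule kazdan_warner[OF u(1) C F_def F1 F2])
  have cX: "scont (\<lambda>x. (x \<bullet> e) * tderiv e u x)"
    by (intro scont_mult continuous_on_smooth smooth_on_sphere_tderiv smooth_on_sphere_inner u(1) e_Basis)
  have "(\<lambda>k. xXu_coef (zon_coef u) k * (c * (paneitz_ev k * zon_coef u k)) / zon_norm k) sums 0"
    using zonal_parseval[OF zG cF(2) cX] unfolding kw zon_coef_tderiv[OF u(1)] coefG .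
  then have "(\<lambda>k. (1 / c) * (xXu_coef (zon_coef u) k * (c * (paneitz_ev k * zon_coef u k)) / zon_norm k)) sums ((1 / c) * 0)"
    by (rule sums_mult)
  then have s: "(\<lambda>k. xXu_coef (zon_coef u) k * (paneitz_ev k * zon_coef u k) / zon_norm k) sums 0"
    using c by simp
  have GG: "(\<lambda>k. c\<^sup>2 * ((paneitz_ev k * zon_coef u k)\<^sup>2 / zon_norm k)) sums savg (\<lambda>x. G x * G x)"
    using zonal_parseval[OF zG cF(2) cF(2)] unfolding coefG by (simp add: power2_eq_square algebra_simps)
  then have "(\<lambda>k. (1 / c\<^sup>2) * (c\<^sup>2 * ((paneitz_ev k * zon_coef u k)\<^sup>2 / zon_norm k))) \<longlonglongrightarrow> (1 / c\<^sup>2) * 0"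
    by (intro tendsto_mult tendsto_const summable_LIMSEQ_zero) (rule sums_summable)
  then have l: "(\<lambda>k. (paneitz_ev k * zon_coef u k)\<^sup>2 / zon_norm k) \<longlonglongrightarrow> 0"
    using c by simp
  \<comment> \<open>The form leaves a_0 free; it drops out because P annihilates constants.\<close>
  have z: "paneitz_ev k * zon_coef u k = 0" for k
    using quadratic_form_definite[OF s l, of k] by (cases "k = 0") (auto simp: paneitz_ev_0)
  have "(\<lambda>k. 0) sums savg (\<lambda>x. G x * G x)" using GG unfolding z by simp
  then have "savg (\<lambda>x. G x * G x) = 0" by (rule sums_unique2) simp
  then have G0: "G x = 0" if "x \<in> sphere 0 1" for x
    using savg_square_eq_0[OF cF(2) _ that] by (simp add: power2_eq_square)
  have "u x = ln C / real n" if "x \<in> sphere 0 1" for x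
  proof -
    have "exp (real n * u x) = C" using G0[OF that] C by (simp add: G_def F_def field_simps)
    then have "real n * u x = ln C" by (metis ln_exp)
    then show ?thesis using n_ge_2 by (simp add: field_simps)
  qed
  then show ?thesis unfolding constant_on_def by blast
qed

end

theorem theorem1p1:
  fixes n :: nat and \<alpha> :: real and u :: "real ^ 'm \<Rightarrow> real" and i :: 'm
  assumes "n \<ge> 2"
    and "CARD('m) = n + 1"
    and "\<alpha> = 1 / (real n + 1)"
    and "smooth_on_sphere u"
    and "\<exists>g :: real \<Rightarrow> real. \<forall>\<xi>\<in>sphere 0 1. u \<xi> = g (\<xi> $ i)"
    and "\<forall>\<xi>\<in>sphere 0 1.
           \<alpha> * paneitz n u \<xi>
           + fact (n - 1) * (1 - exp (real n * u \<xi>)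
                                 / (\<integral>\<zeta>. exp (real n * u \<zeta>) \<partial>sphere_measure)) = 0"
  shows "u constant_on sphere 0 1"
proof -
  interpret sphere_axis "axis i 1 :: real ^ 'm" n
    using assms(1,2) by unfold_locales (auto simp: axis_in_Basis_iff)
  have "zonal u" using assms(5) by (simp add: zonal_def inner_axis)
  then show ?thesis
    using assms(6) unfolding assms(3) by (intro zonal_solution_constant assms(4)) auto
qed

end
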